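(* Let $\Bbbk$ be an arbitrary field, $Q$ a finite quiver, and $\alpha,\zeta$ two dimension vectors for $Q$. Let $\mathrm{Rep}^s(Q,\alpha,\zeta)\to\mathcal{M}^s(Q,\alpha,\zeta)=\mathrm{Rep}^s(Q,\alpha,\zeta)/\!\!/GL(\alpha)$ be the geometric quotient of the variety of stable framed representations by $GL(\alpha)$. For a $J$-skeleton $\mathfrak{S}$ with dimension vector $\alpha$ let $X(\mathfrak{S})\subseteq \mathrm{Rep}^s(Q,\alpha,\zeta)$ be the set of stable pairs having $\mathfrak{S}$ as a $J$-skeleton. Then: (1) $$\mathrm{Rep}^s(Q,\alpha,\zeta)=\bigcup_{\mathfrak{S}}X(\mathfrak{S}),$$ the union being over all $J$-skeleta $\mathfrak{S}$ with dimension vector $\alpha$, where the $X(\mathfrak{S})$ are Zariski open subsets of $\mathrm{Rep}^s(Q,\alpha,\zeta)$ such that $X(\mathfrak{S})\cong GL(\alpha)\times\mathbb{A}^N$ for some positive integer $N$, and the restriction of the quotient map to $X(\mathfrak{S})$ is the projection onto the second factor. In particular, $$\mathcal{M}^s(Q,\alpha,\zeta)=\bigcup_{\mathfrak{S}}X(\mathfrak{S})/\!\!/GL(\alpha)$$ is a covering by open subspaces isomorphic to affine spaces. (2) The quotient space $\mathcal{M}^s(Q,\alpha,\zeta)$ is isomorphic to a locally closed subvariety of $\mathrm{Gr}_\alpha(\widehat{J})=\prod_{i\in Q_0}\mathrm{Gr}_{\alpha_i}(\widehat{J}_i)$.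
   Context: Quivers and framed representations. $Q$ is a finite quiver with vertex set $Q_0$, arrow set $Q_1$, and head and tail maps $h,t:Q_1\to Q_0$; dimension vectors have non-negative integer entries. $\mathrm{Rep}(Q,\alpha)=\bigoplus_{a\in Q_1}\mathrm{Hom}(\Bbbk^{\alpha_{ta}},\Bbbk^{\alpha_{ha}})$ and $GL(\alpha)=\prod_{i\in Q_0}GL_{\alpha_i}(\Bbbk)$. The space of framed representations is $\mathrm{Rep}(Q,\alpha,\zeta)=\mathrm{Rep}(Q,\alpha)\oplus\bigoplus_{i\in Q_0}\mathrm{Hom}(\Bbbk^{\alpha_i},\Bbbk^{\zeta_i})$; its elements are pairs $(M,f)$, $f=(f_i)_{i\in Q_0}$, and $GL(\alpha)$ acts by $g\cdot(M,f)=\big((g_{ha}M_ag_{ta}^{-1})_{a\in Q_1},(f_ig_i^{-1})_{i\in Q_0}\big)$. A pair $(M,f)$ is stable if there is no nonzero subrepresentation $N$ of $M$ with $N_i\subseteq\ker f_i$ for all $i\in Q_0$. $\mathrm{Rep}^s(Q,\alpha,\zeta)$ is the (open) set of stable pairs. It is known that it admits a geometric quotient by $GL(\alpha)$, i.e. a morphism to an algebraic variety $\mathcal{M}^s(Q,\alpha,\zeta)$ whose fibers coincide with the $GL(\alpha)$-orbits. Paths. A path is a product of arrows $a_1\cdots a_k$ with $t(a_i)=h(a_{i+1})$ (so $a_k$ is applied first), with tail $t(a_k)$ and head $h(a_1)$, or a path $e_i$ of length zero at a vertex $i$. Extended quiver. $Q^\zeta$ has vertices $Q_0\cup\{\infty\}$;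 its arrows are those of $Q$ together with arrows $f_{iq}:i\to\infty$ for $i\in Q_0$, $q=1,\dots,\zeta_i$. A pair $(M,f)$ is identified with a representation $\widetilde M$ of $Q^\zeta$ with $\widetilde M_i=\Bbbk^{\alpha_i}$ for $i\in Q_0$, $\widetilde M_\infty=\Bbbk$, $\widetilde M_a=M_a$ for $a\in Q_1$, and $\widetilde M_{f_{iq}}$ the $q$-th row of the matrix of $f_i$. For a path $\pi=b_1\cdots b_k$ in $Q^\zeta$ put $\widetilde M_\pi=\widetilde M_{b_1}\cdots\widetilde M_{b_k}$, and let $\widetilde M_{e_i}$ be the identity. The representation $\widetilde J$. For a vertex $i$ of $Q^\zeta$, $\widetilde J_i$ is the dual of the vector space with basis the set of paths from $i$ to $\infty$ (so $\widetilde J_\infty=\Bbbk$), and $\widetilde J=\bigoplus_i\widetilde J_i$. Each path $\pi$ from $i$ to $\infty$ is viewed as a linear function on $\widetilde J$: $\xi\mapsto\xi(\pi)$ on $\widetilde J_i$ and zero on the other components. The map $\widetilde\Phi_{\widetilde M}:\widetilde M\to\widetilde J$ sends $x\in\widetilde M_i$ to the element of $\widetilde J_i$ given by $\pi\mapsto\widetilde M_\pi(x)$. $J$-skeleta. A $J$-skeleton of a stable pair $(M,f)$ is a set $\mathfrak{S}$ of paths of nonzero length in $Q^\zeta$ ending in $\infty$ such that: (i) the restrictions of the paths in $\mathfrak{S}$, together with that of $e_\infty$, form a basis of $\big(\widetilde\Phi_{\widetilde M}(\widetilde M)\big)^*$; (ii) whenever $\tau a\in\mathfrak{S}$ with $a$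 an arrow and $\tau\ne e_\infty$, also $\tau\in\mathfrak{S}$. A "$J$-skeleton with dimension vector $\alpha$" is a $J$-skeleton of some stable pair in $\mathrm{Rep}^s(Q,\alpha,\zeta)$. The space $\widehat J$. $\Gamma(\alpha)$ is the set of all paths occurring in $J$-skeleta with dimension vector $\alpha$; $\widetilde\Gamma(\alpha)=\Gamma(\alpha)\cup\{\tau a\mid\tau\in\Gamma(\alpha),\,a\in Q_1,\,h(a)=t(\tau)\}$; $\widetilde\Gamma_i(\alpha)$ is the subset of paths starting at $i$. $\widehat J=\bigoplus_{i\in Q_0}\widehat J_i$, where $\widehat J_i=\Bbbk^{\widetilde\Gamma_i(\alpha)}$ has one coordinate for each path in $\widetilde\Gamma_i(\alpha)$. $\mathrm{Gr}_{d}(W)$ is the Grassmannian of $d$-dimensional subspaces of $W$.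
   Formalization: "Some positive integer N" is read as "some non-negative integer N": for one vertex without arrows and α=ζ=1 (or for α=0) one has X(𝔖)=GL(α), which forces N=0. *)

theory Defs
  imports
    "HOL-Analysis.Abstract_Topology"
    "HOL-Algebra.Algebraic_Closure_Type"
    "Graph_Theory.Arc_Walk"
    "Jordan_Normal_Form.Matrix_Kernel"
begin

section \<open>Varieties over an arbitrary field\<close>

text \<open>
  Let k be the type \<open>'k\<close> and K = \<open>'k alg_closure\<close>, with embedding \<open>to_ac\<close>.
  A reduced k-scheme of finite type is represented by its set of K-points, together with the
  topology whose open sets are the K-points of the (k-)open subschemes, and, on each such open
  set, the K-valued functions given by the sections of the structure sheaf. For affine n-space
  this is the set of n-tuples over K, where closed sets are zero sets of polynomials with
  coefficients in k, and regular functions are locally fractions of such polynomials.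
  By the Nullstellensatz a map of K-points that is continuous and pulls back regular functions to
  regular functions is the same as a morphism of k-schemes. In particular nothing degenerates when
  k is finite: varieties are not identified with their sets of k-points, and all open sets,
  functions and morphisms below are defined over k.

  \<open>kreg E U f\<close> says that the restriction of \<open>f\<close> to \<open>U\<close> is a regular function on the open
  set \<open>U\<close>; the values of \<open>f\<close> off \<open>U\<close> are irrelevant.
\<close>

record (overloaded) ('p, 'k) k_space =
  ktop :: "'p topology"
  kreg :: "'p set \<Rightarrow> ('p \<Rightarrow> 'k alg_closure) \<Rightarrow> bool"

abbreviation kpts :: "('p, 'k::field) k_space \<Rightarrow> 'p set" where
  "kpts E \<equiv> topspace (ktop E)"

definition kpreimage :: "('p, 'k::field) k_space \<Rightarrow> ('p \<Rightarrow> 'q) \<Rightarrow> 'q set \<Rightarrow> 'p set" where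
  "kpreimage E \<phi> V = {x \<in> kpts E. \<phi> x \<in> V}"

definition kmorphism ::
  "('p, 'k::field) k_space \<Rightarrow> ('q, 'k) k_space \<Rightarrow> ('p \<Rightarrow> 'q) \<Rightarrow> bool" where
  "kmorphism E Y \<phi> \<longleftrightarrow> continuous_map (ktop E) (ktop Y) \<phi> \<and>
     (\<forall>V f. kreg Y V f \<longrightarrow> kreg E (kpreimage E \<phi> V) (f \<circ> \<phi>))"

definition kiso ::
  "('p, 'k::field) k_space \<Rightarrow> ('q, 'k) k_space \<Rightarrow> ('p \<Rightarrow> 'q) \<Rightarrow> bool" where
  "kiso E Y \<phi> \<longleftrightarrow> bij_betw \<phi> (kpts E) (kpts Y) \<and>
     kmorphism E Y \<phi> \<and> kmorphism Y E (inv_into (kpts E) \<phi>)"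

subsection \<open>Quasi-affine spaces and subspaces\<close>

text \<open>The polynomial functions with coefficients in k in a given set of coordinate functions.\<close>

inductive_set kpoly :: "('p \<Rightarrow> 'k::field alg_closure) set \<Rightarrow> ('p \<Rightarrow> 'k alg_closure) set"
  for C where
  kpoly_const: "(\<lambda>_. to_ac c) \<in> kpoly C"
| kpoly_coord: "f \<in> C \<Longrightarrow> f \<in> kpoly C"
| kpoly_add: "f \<in> kpoly C \<Longrightarrow> g \<in> kpoly C \<Longrightarrow> (\<lambda>x. f x + g x) \<in> kpoly C"
| kpoly_mult: "f \<in> kpoly C \<Longrightarrow> g \<in> kpoly C \<Longrightarrow> (\<lambda>x. f x * g x) \<in> kpoly C"

text \<open>
  The Zariski structure on a set \<open>P\<close> of points with coordinate functions \<open>C\<close>. For a (k-)locally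
  closed subset \<open>P\<close> of an affine space this is the reduced quasi-affine variety on \<open>P\<close>.
\<close>

definition zariski_open ::
  "'p set \<Rightarrow> ('p \<Rightarrow> 'k::field alg_closure) set \<Rightarrow> 'p set \<Rightarrow> bool" where
  "zariski_open P C U \<longleftrightarrow> U \<subseteq> P \<and>
     (\<forall>x\<in>U. \<exists>h\<in>kpoly C. h x \<noteq> 0 \<and> {y\<in>P. h y \<noteq> 0} \<subseteq> U)"

definition zariski :: "'p set \<Rightarrow> ('p \<Rightarrow> 'k::field alg_closure) set \<Rightarrow> ('p, 'k) k_space" where
  "zariski P C = \<lparr>
     ktop = topology (zariski_open P C),
     kreg = (\<lambda>U f. zariski_open P C U \<and>
       (\<forall>x\<in>U. \<exists>g\<in>kpoly C. \<exists>h\<in>kpoly C. h x \<noteq> 0 \<and> (\<forall>y\<in>U. h y \<noteq> 0 \<longrightarrow> f y = g y / h y))) \<rparr>"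

lemma istopology_zariski: "istopology (zariski_open P C)"
  unfolding istopology_def
proof (intro conjI allI impI)
  fix S T assume S: "zariski_open P C S" and T: "zariski_open P C T"
  show "zariski_open P C (S \<inter> T)"
    unfolding zariski_open_def
  proof (intro conjI ballI)
    show "S \<inter> T \<subseteq> P" using S by (auto simp: zariski_open_def)
    fix x assume x: "x \<in> S \<inter> T"
    obtain h where h: "h \<in> kpoly C" "h x \<noteq> 0" "{y\<in>P. h y \<noteq> 0} \<subseteq> S"
      using S x unfolding zariski_open_def by blast
    obtain k where k: "k \<in> kpoly C" "k x \<noteq> 0" "{y\<in>P. k y \<noteq> 0} \<subseteq> T"
      using T x unfolding zariski_open_def by blast
    have "(\<lambda>y. h y * k y) \<in> kpoly C" using h k by (intro kpoly_mult)
    moreover have "{y\<in>P. h y * k y \<noteq> 0} \<subseteq> S \<inter> T" using h(3) k(3) by auto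
    ultimately show "\<exists>h\<in>kpoly C. h x \<noteq> 0 \<and> {y\<in>P. h y \<noteq> 0} \<subseteq> S \<inter> T"
      using h(2) k(2) by (intro bexI[of _ "\<lambda>y. h y * k y"]) auto
  qed
next
  fix \<K> assume "\<forall>S\<in>\<K>. zariski_open P C S"
  then show "zariski_open P C (\<Union>\<K>)"
    unfolding zariski_open_def by (meson Sup_upper UnionE Union_least order_trans)
qed

lemma openin_zariski [simp]: "openin (ktop (zariski P C)) = zariski_open P C"
  by (simp add: zariski_def istopology_zariski)

lemma kpts_zariski [simp]: "kpts (zariski P C) = P"
proof -
  have "zariski_open P C P"
    unfolding zariski_open_def using kpoly_const[of 1 C]
    by (auto intro!: bexI[of _ "\<lambda>_. 1"])
  then show ?thesis
    unfolding topspace_def openin_zariski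
    by (intro subset_antisym Union_upper) (auto simp: zariski_open_def)
qed

text \<open>The reduced induced structure on a locally closed subset \<open>Z\<close>, the usual restriction if
  \<open>Z\<close> is open.\<close>

definition ksubspace :: "('p, 'k::field) k_space \<Rightarrow> 'p set \<Rightarrow> ('p, 'k) k_space" where
  "ksubspace E Z = \<lparr>
     ktop = subtopology (ktop E) Z,
     kreg = (\<lambda>U f. openin (subtopology (ktop E) Z) U \<and>
       (\<forall>x\<in>U. \<exists>V g. x \<in> V \<and> kreg E V g \<and> (\<forall>y\<in>U \<inter> V. f y = g y))) \<rparr>"

definition locally_closed :: "('p, 'k::field) k_space \<Rightarrow> 'p set \<Rightarrow> bool" where
  "locally_closed E Z \<longleftrightarrow> (\<exists>U C. openin (ktop E) U \<and> closedin (ktop E) C \<and> Z = U \<inter> C)"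

definition affine_coords :: "nat \<Rightarrow> ('k::field alg_closure vec \<Rightarrow> 'k alg_closure) set" where
  "affine_coords n = {\<lambda>v. v $ j | j. j < n}"

definition affine_space :: "nat \<Rightarrow> ('k::field alg_closure vec, 'k) k_space" where
  "affine_space n = zariski (carrier_vec n) (affine_coords n)"

subsection \<open>Algebraic varieties and geometric quotients\<close>

definition kaffine :: "('p, 'k::field) k_space \<Rightarrow> bool" where
  "kaffine E \<longleftrightarrow> (\<exists>n Z \<phi>. closedin (ktop (affine_space n :: (_, 'k) k_space)) Z \<and>
     kiso E (ksubspace (affine_space n) Z) \<phi>)"

text \<open>
  The diagonal is closed: the sets where a sum of products \<open>f\<^sub>j(x) g\<^sub>j(y)\<close>, with \<open>f\<^sub>j\<close> regular on
  \<open>U\<close> and \<open>g\<^sub>j\<close> regular on \<open>V\<close>, does not vanish form a basis of the topology of the product of a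
  variety with itself, and this says that the complement of the diagonal is a union of such sets.
\<close>

definition kseparated :: "('p, 'k::field) k_space \<Rightarrow> bool" where
  "kseparated E \<longleftrightarrow> (\<forall>x\<in>kpts E. \<forall>y\<in>kpts E. x \<noteq> y \<longrightarrow>
     (\<exists>U V (m::nat) f g. x \<in> U \<and> y \<in> V \<and> (\<forall>j<m. kreg E U (f j) \<and> kreg E V (g j)) \<and>
        openin (ktop E) U \<and> openin (ktop E) V \<and>
        (\<Sum>j<m. f j x * g j y) \<noteq> 0 \<and> (\<forall>z\<in>U \<inter> V. (\<Sum>j<m. f j z * g j z) = 0)))"

definition ksheaf :: "('p, 'k::field) k_space \<Rightarrow> bool" where
  "ksheaf E \<longleftrightarrow>
     (\<forall>U f. kreg E U f \<longrightarrow> openin (ktop E) U) \<and>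
     (\<forall>U f g. kreg E U f \<longrightarrow> (\<forall>x\<in>U. f x = g x) \<longrightarrow> kreg E U g) \<and>
     (\<forall>U V f. kreg E U f \<longrightarrow> openin (ktop E) V \<longrightarrow> V \<subseteq> U \<longrightarrow> kreg E V f) \<and>
     (\<forall>\<U> f. (\<forall>U\<in>\<U>. kreg E U f) \<longrightarrow> kreg E (\<Union>\<U>) f)"

definition algebraic_variety :: "('p, 'k::field) k_space \<Rightarrow> bool" where
  "algebraic_variety E \<longleftrightarrow> ksheaf E \<and> kseparated E \<and>
     (\<exists>\<U>. finite \<U> \<and> \<Union>\<U> = kpts E \<and>
        (\<forall>U\<in>\<U>. openin (ktop E) U \<and> kaffine (ksubspace E U)))"

text \<open>
  \<open>q : E \<rightarrow> Y\<close> is a geometric quotient: a surjective morphism onto a variety, whose fibres are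
  the orbits, such that \<open>Y\<close> has the quotient topology and the regular functions on \<open>Y\<close> are the
  invariant regular functions on \<open>E\<close>. (Fibres being orbits would not be enough to determine
  \<open>Y\<close> in positive characteristic.)
\<close>

definition geometric_quotient ::
  "'g set \<Rightarrow> ('g \<Rightarrow> 'p \<Rightarrow> 'p) \<Rightarrow> ('p, 'k::field) k_space \<Rightarrow> ('q, 'k) k_space \<Rightarrow> ('p \<Rightarrow> 'q) \<Rightarrow> bool"
where
  "geometric_quotient G act E Y q \<longleftrightarrow>
     algebraic_variety Y \<and> kmorphism E Y q \<and> q ` kpts E = kpts Y \<and>
     (\<forall>x\<in>kpts E. {y \<in> kpts E. q y = q x} = {act g x | g. g \<in> G}) \<and>
     (\<forall>V\<subseteq>kpts Y. openin (ktop E) (kpreimage E q V) \<longrightarrow> openin (ktop Y) V) \<and>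
     (\<forall>V h. openin (ktop Y) V \<longrightarrow> kreg E (kpreimage E q V) h \<longrightarrow>
        (\<forall>x\<in>kpreimage E q V. \<forall>g\<in>G. h (act g x) = h x) \<longrightarrow>
        (\<exists>f. kreg Y V f \<and> (\<forall>x\<in>kpreimage E q V. h x = f (q x))))"

subsection \<open>Products of Grassmannians\<close>

text \<open>
  Points of the product over \<open>i \<in> I\<close> of the Grassmannians of \<open>d i\<close>-dimensional subspaces of the
  coordinate spaces with one coordinate for each element of \<open>\<Gamma> i\<close> are the families of spans of
  linearly independent \<open>d i\<close>-tuples (frames). As usual, the structure of a variety is the
  quotient structure coming from the open set of frames in an affine space.
\<close>

definition frames :: "'i set \<Rightarrow> ('i \<Rightarrow> nat) \<Rightarrow> ('i \<Rightarrow> 'g set) \<Rightarrow> ('i \<Rightarrow> nat \<Rightarrow> 'g \<Rightarrow> 'f::field) set"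
where
  "frames I d \<Gamma> = {b \<in> (\<Pi>\<^sub>E i\<in>I. \<Pi>\<^sub>E j\<in>{..<d i}. \<Gamma> i \<rightarrow>\<^sub>E UNIV).
     \<forall>i\<in>I. \<forall>c. (\<forall>\<gamma>\<in>\<Gamma> i. (\<Sum>j<d i. c j * b i j \<gamma>) = 0) \<longrightarrow> (\<forall>j<d i. c j = 0)}"

definition frame_span ::
  "'i set \<Rightarrow> ('i \<Rightarrow> nat) \<Rightarrow> ('i \<Rightarrow> 'g set) \<Rightarrow> ('i \<Rightarrow> nat \<Rightarrow> 'g \<Rightarrow> 'f::field) \<Rightarrow> ('i \<Rightarrow> ('g \<Rightarrow> 'f) set)"
where
  "frame_span I d \<Gamma> b = (\<lambda>i\<in>I. {(\<lambda>\<gamma>\<in>\<Gamma> i. \<Sum>j<d i. c j * b i j \<gamma>) | c. True})"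

definition frame_space ::
  "'i set \<Rightarrow> ('i \<Rightarrow> nat) \<Rightarrow> ('i \<Rightarrow> 'g set) \<Rightarrow> ('i \<Rightarrow> nat \<Rightarrow> 'g \<Rightarrow> 'k alg_closure, 'k::field) k_space"
where
  "frame_space I d \<Gamma> =
     zariski (frames I d \<Gamma>) {\<lambda>b. b i j \<gamma> | i j \<gamma>. i \<in> I \<and> j < d i \<and> \<gamma> \<in> \<Gamma> i}"

definition grassmannian ::
  "'i set \<Rightarrow> ('i \<Rightarrow> nat) \<Rightarrow> ('i \<Rightarrow> 'g set) \<Rightarrow> ('i \<Rightarrow> ('g \<Rightarrow> 'k alg_closure) set, 'k::field) k_space"
where
  "grassmannian I d \<Gamma> = (let F = frame_space I d \<Gamma>; s = frame_span I d \<Gamma>;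
     opn = (\<lambda>U. U \<subseteq> s ` kpts F \<and> openin (ktop F) (kpreimage F s U)) in
     \<lparr> ktop = topology opn,
       kreg = (\<lambda>U f. opn U \<and> kreg F (kpreimage F s U) (f \<circ> s)) \<rparr>)"

lemma openin_grassmannian:
  fixes \<Gamma> :: "'i \<Rightarrow> 'g set" and U :: "('i \<Rightarrow> ('g \<Rightarrow> 'k::field alg_closure) set) set"
  shows "openin (ktop (grassmannian I d \<Gamma> :: (_, 'k) k_space)) U \<longleftrightarrow>
     U \<subseteq> frame_span I d \<Gamma> ` frames I d \<Gamma> \<and>
     openin (ktop (frame_space I d \<Gamma> :: (_, 'k) k_space))
       (kpreimage (frame_space I d \<Gamma> :: (_, 'k) k_space) (frame_span I d \<Gamma>) U)"
proof -
  define F where "F = (frame_space I d \<Gamma> :: (_, 'k) k_space)"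
  define s where "s = (frame_span I d \<Gamma> :: _ \<Rightarrow> ('i \<Rightarrow> ('g \<Rightarrow> 'k alg_closure) set))"
  have "istopology (\<lambda>U. U \<subseteq> s ` kpts F \<and> openin (ktop F) (kpreimage F s U))"
    unfolding istopology_def
  proof (intro conjI allI impI)
    fix S T assume "S \<subseteq> s ` kpts F \<and> openin (ktop F) (kpreimage F s S)"
      "T \<subseteq> s ` kpts F \<and> openin (ktop F) (kpreimage F s T)"
    moreover have "kpreimage F s (S \<inter> T) = kpreimage F s S \<inter> kpreimage F s T"
      by (auto simp: kpreimage_def)
    ultimately show "S \<inter> T \<subseteq> s ` kpts F" "openin (ktop F) (kpreimage F s (S \<inter> T))"
      by auto
  next
    fix \<K> assume K: "\<forall>U\<in>\<K>. U \<subseteq> s ` kpts F \<and> openin (ktop F) (kpreimage F s U)"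
    have "kpreimage F s (\<Union>\<K>) = \<Union>(kpreimage F s ` \<K>)"
      by (auto simp: kpreimage_def)
    then show "openin (ktop F) (kpreimage F s (\<Union>\<K>))" using K by auto
    show "\<Union>\<K> \<subseteq> s ` kpts F" using K by blast
  qed
  then show ?thesis
    unfolding grassmannian_def Let_def
    by (simp add: F_def[symmetric] s_def[symmetric]) (simp add: F_def frame_space_def)
qed

section \<open>Framed representations of quivers\<close>

text \<open>A finite quiver is a \<open>fin_digraph\<close>, where loops and multiple arrows are allowed.\<close>

type_synonym ('v, 'a, 'f) framed_rep = "('a \<Rightarrow> 'f mat) \<times> ('v \<Rightarrow> 'f mat)"

definition framed_reps ::
  "('v, 'a) pre_digraph \<Rightarrow> ('v \<Rightarrow> nat) \<Rightarrow> ('v \<Rightarrow> nat) \<Rightarrow> ('v, 'a, 'f::field) framed_rep set" where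
  "framed_reps Q \<alpha> \<zeta> =
     (\<Pi>\<^sub>E a\<in>arcs Q. carrier_mat (\<alpha> (head Q a)) (\<alpha> (tail Q a))) \<times>
     (\<Pi>\<^sub>E i\<in>verts Q. carrier_mat (\<zeta> i) (\<alpha> i))"

definition GL :: "('v, 'a) pre_digraph \<Rightarrow> ('v \<Rightarrow> nat) \<Rightarrow> ('v \<Rightarrow> 'f::field mat) set" where
  "GL Q \<alpha> = (\<Pi>\<^sub>E i\<in>verts Q. {g \<in> carrier_mat (\<alpha> i) (\<alpha> i). invertible_mat g})"

definition GL_act ::
  "('v, 'a) pre_digraph \<Rightarrow> ('v \<Rightarrow> 'f::field mat) \<Rightarrow> ('v, 'a, 'f) framed_rep \<Rightarrow> ('v, 'a, 'f) framed_rep"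
where
  "GL_act Q g = (\<lambda>(M, f).
     (\<lambda>a\<in>arcs Q. g (head Q a) * M a * the (mat_inverse (g (tail Q a))),
      \<lambda>i\<in>verts Q. f i * the (mat_inverse (g i))))"

definition subrepresentation ::
  "('v, 'a) pre_digraph \<Rightarrow> ('v \<Rightarrow> nat) \<Rightarrow> ('a \<Rightarrow> 'f::field mat) \<Rightarrow> ('v \<Rightarrow> 'f vec set) \<Rightarrow> bool"
where
  "subrepresentation Q \<alpha> M N \<longleftrightarrow>
     (\<forall>i\<in>verts Q. VectorSpace.subspace class_ring (N i) (module_vec TYPE('f) (\<alpha> i))) \<and>
     (\<forall>a\<in>arcs Q. \<forall>x\<in>N (tail Q a). M a *\<^sub>v x \<in> N (head Q a))"

definition stable_pairs ::
  "('v, 'a) pre_digraph \<Rightarrow> ('v \<Rightarrow> nat) \<Rightarrow> ('v \<Rightarrow> nat) \<Rightarrow> ('v, 'a, 'f::field) framed_rep set" where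
  "stable_pairs Q \<alpha> \<zeta> = {(M, f) \<in> framed_reps Q \<alpha> \<zeta>.
     \<not> (\<exists>N. subrepresentation Q \<alpha> M N \<and> (\<exists>i\<in>verts Q. N i \<noteq> {0\<^sub>v (\<alpha> i)}) \<and>
           (\<forall>i\<in>verts Q. N i \<subseteq> mat_kernel (f i)))}"

definition Rep_coords ::
  "('v, 'a) pre_digraph \<Rightarrow> ('v \<Rightarrow> nat) \<Rightarrow> ('v \<Rightarrow> nat) \<Rightarrow>
     (('v, 'a, 'k::field alg_closure) framed_rep \<Rightarrow> 'k alg_closure) set" where
  "Rep_coords Q \<alpha> \<zeta> =
     {\<lambda>(M, f). M a $$ (r, s) | a r s. a \<in> arcs Q \<and> r < \<alpha> (head Q a) \<and> s < \<alpha> (tail Q a)} \<union>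
     {\<lambda>(M, f). f i $$ (r, s) | i r s. i \<in> verts Q \<and> r < \<zeta> i \<and> s < \<alpha> i}"

definition Rep_space ::
  "('v, 'a) pre_digraph \<Rightarrow> ('v \<Rightarrow> nat) \<Rightarrow> ('v \<Rightarrow> nat) \<Rightarrow>
     (('v, 'a, 'k alg_closure) framed_rep, 'k::field) k_space" where
  "Rep_space Q \<alpha> \<zeta> = zariski (framed_reps Q \<alpha> \<zeta>) (Rep_coords Q \<alpha> \<zeta>)"

definition stable_space ::
  "('v, 'a) pre_digraph \<Rightarrow> ('v \<Rightarrow> nat) \<Rightarrow> ('v \<Rightarrow> nat) \<Rightarrow>
     (('v, 'a, 'k alg_closure) framed_rep, 'k::field) k_space" where
  "stable_space Q \<alpha> \<zeta> = ksubspace (Rep_space Q \<alpha> \<zeta>) (stable_pairs Q \<alpha> \<zeta>)"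

definition GL_coords ::
  "('v, 'a) pre_digraph \<Rightarrow> ('v \<Rightarrow> nat) \<Rightarrow> (('v \<Rightarrow> 'k::field alg_closure mat) \<Rightarrow> 'k alg_closure) set"
where
  "GL_coords Q \<alpha> = {\<lambda>g. g i $$ (r, s) | i r s. i \<in> verts Q \<and> r < \<alpha> i \<and> s < \<alpha> i}"

definition GL_times_affine ::
  "('v, 'a) pre_digraph \<Rightarrow> ('v \<Rightarrow> nat) \<Rightarrow> nat \<Rightarrow>
     (('v \<Rightarrow> 'k alg_closure mat) \<times> 'k alg_closure vec, 'k::field) k_space" where
  "GL_times_affine Q \<alpha> n = zariski (GL Q \<alpha> \<times> carrier_vec n)
     ((\<lambda>c. c \<circ> fst) ` GL_coords Q \<alpha> \<union> (\<lambda>c. c \<circ> snd) ` affine_coords n)"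

section \<open>J-skeleta\<close>

text \<open>The vertex \<open>\<infinity>\<close> is \<open>None\<close>, and \<open>Inr (i, q)\<close> is the arrow \<open>f\<^sub>i\<^sub>q\<close>, with \<open>q\<close> counted from 0.\<close>

definition ext_quiver ::
  "('v, 'a) pre_digraph \<Rightarrow> ('v \<Rightarrow> nat) \<Rightarrow> ('v option, 'a + 'v \<times> nat) pre_digraph" where
  "ext_quiver Q \<zeta> = \<lparr>
     verts = insert None (Some ` verts Q),
     arcs = Inl ` arcs Q \<union> Inr ` {(i, q). i \<in> verts Q \<and> q < \<zeta> i},
     tail = case_sum (\<lambda>a. Some (tail Q a)) (\<lambda>(i, q). Some i),
     head = case_sum (\<lambda>a. Some (head Q a)) (\<lambda>(i, q). None) \<rparr>"

text \<open>
  A path ending in \<open>\<infinity>\<close> is a pair of its tail and the list of its arrows in the order in which they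
  are applied, so the path \<open>b\<^sub>1 \<dots> b\<^sub>k\<close> is the list \<open>[b\<^sub>k, \<dots>, b\<^sub>1]\<close>, and \<open>\<tau> a\<close> is
  obtained from \<open>\<tau>\<close> by adding \<open>a\<close> at the front of the list.
\<close>

type_synonym ('v, 'a) ext_path = "'v option \<times> ('a + 'v \<times> nat) list"

definition e_inf :: "('v, 'a) ext_path" where
  "e_inf = (None, [])"

definition inf_paths ::
  "('v, 'a) pre_digraph \<Rightarrow> ('v \<Rightarrow> nat) \<Rightarrow> ('v, 'a) ext_path set" where
  "inf_paths Q \<zeta> = {(u, p). pre_digraph.awalk (ext_quiver Q \<zeta>) u p None}"

definition ext_dim :: "('v \<Rightarrow> nat) \<Rightarrow> 'v option \<Rightarrow> nat" where
  "ext_dim \<alpha> = case_option 1 \<alpha>"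

definition ext_mat :: "('v, 'a, 'f::field) framed_rep \<Rightarrow> 'a + 'v \<times> nat \<Rightarrow> 'f mat" where
  "ext_mat Mf = case_sum (fst Mf) (\<lambda>(i, q). mat_of_row (row (snd Mf i) q))"

primrec path_mat ::
  "('v, 'a) pre_digraph \<Rightarrow> ('v \<Rightarrow> nat) \<Rightarrow> ('v \<Rightarrow> nat) \<Rightarrow> ('v, 'a, 'f::field) framed_rep \<Rightarrow>
     'v option \<Rightarrow> ('a + 'v \<times> nat) list \<Rightarrow> 'f mat" where
  "path_mat Q \<alpha> \<zeta> Mf u [] = 1\<^sub>m (ext_dim \<alpha> u)"
| "path_mat Q \<alpha> \<zeta> Mf u (b # p) =
     path_mat Q \<alpha> \<zeta> Mf (head (ext_quiver Q \<zeta>) b) p * ext_mat Mf b"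

text \<open>
  An element of \<open>J\<close> is a function on the set of all paths ending in \<open>\<infinity>\<close> (which is the disjoint
  union of the sets of paths from \<open>i\<close> to \<open>\<infinity>\<close>), extended by zero. The value of \<open>Phi\<close> at a path
  from \<open>u\<close> lies in the 1-dimensional space at \<open>\<infinity>\<close>, hence the component 0.
\<close>

definition ext_space ::
  "('v, 'a) pre_digraph \<Rightarrow> ('v \<Rightarrow> nat) \<Rightarrow> ('v \<Rightarrow> nat) \<Rightarrow> ('v option \<Rightarrow> 'f::field vec) set" where
  "ext_space Q \<alpha> \<zeta> = (\<Pi>\<^sub>E u\<in>verts (ext_quiver Q \<zeta>). carrier_vec (ext_dim \<alpha> u))"

definition Phi ::
  "('v, 'a) pre_digraph \<Rightarrow> ('v \<Rightarrow> nat) \<Rightarrow> ('v \<Rightarrow> nat) \<Rightarrow> ('v, 'a, 'f::field) framed_rep \<Rightarrow>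
     ('v option \<Rightarrow> 'f vec) \<Rightarrow> ('v, 'a) ext_path \<Rightarrow> 'f" where
  "Phi Q \<alpha> \<zeta> Mf x = (\<lambda>(u, p).
     if (u, p) \<in> inf_paths Q \<zeta> then (path_mat Q \<alpha> \<zeta> Mf u p *\<^sub>v x u) $ 0 else 0)"

definition linear_functional_on :: "('p \<Rightarrow> 'f::field) set \<Rightarrow> (('p \<Rightarrow> 'f) \<Rightarrow> 'f) \<Rightarrow> bool" where
  "linear_functional_on W \<phi> \<longleftrightarrow>
     (\<forall>\<xi>\<in>W. \<forall>\<eta>\<in>W. \<phi> (\<lambda>\<pi>. \<xi> \<pi> + \<eta> \<pi>) = \<phi> \<xi> + \<phi> \<eta>) \<and>
     (\<forall>c. \<forall>\<xi>\<in>W. \<phi> (\<lambda>\<pi>. c * \<xi> \<pi>) = c * \<phi> \<xi>)"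

text \<open>
  The family of restrictions to the subspace \<open>W\<close> of the evaluations at elements of \<open>B\<close> is a
  basis of the dual of \<open>W\<close>; distinct elements of \<open>B\<close> have distinct restrictions.
\<close>

definition restrictions_basis_of_dual :: "('p \<Rightarrow> 'f::field) set \<Rightarrow> 'p set \<Rightarrow> bool" where
  "restrictions_basis_of_dual W B \<longleftrightarrow>
     (\<forall>F c. finite F \<longrightarrow> F \<subseteq> B \<longrightarrow> (\<forall>\<xi>\<in>W. (\<Sum>\<pi>\<in>F. c \<pi> * \<xi> \<pi>) = 0) \<longrightarrow> (\<forall>\<pi>\<in>F. c \<pi> = 0)) \<and>
     (\<forall>\<phi>. linear_functional_on W \<phi> \<longrightarrow>
        (\<exists>F c. finite F \<and> F \<subseteq> B \<and> (\<forall>\<xi>\<in>W. \<phi> \<xi> = (\<Sum>\<pi>\<in>F. c \<pi> * \<xi> \<pi>))))"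

definition J_skeleton ::
  "('v, 'a) pre_digraph \<Rightarrow> ('v \<Rightarrow> nat) \<Rightarrow> ('v \<Rightarrow> nat) \<Rightarrow> ('v, 'a, 'f::field) framed_rep \<Rightarrow>
     ('v, 'a) ext_path set \<Rightarrow> bool" where
  "J_skeleton Q \<alpha> \<zeta> Mf S \<longleftrightarrow>
     S \<subseteq> {(u, p) \<in> inf_paths Q \<zeta>. p \<noteq> []} \<and>
     restrictions_basis_of_dual (Phi Q \<alpha> \<zeta> Mf ` ext_space Q \<alpha> \<zeta>) (insert e_inf S) \<and>
     (\<forall>u b p. (u, b # p) \<in> S \<longrightarrow> (head (ext_quiver Q \<zeta>) b, p) \<noteq> e_inf \<longrightarrow>
        (head (ext_quiver Q \<zeta>) b, p) \<in> S)"

definition stable_with_skeleton ::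
  "('v, 'a) pre_digraph \<Rightarrow> ('v \<Rightarrow> nat) \<Rightarrow> ('v \<Rightarrow> nat) \<Rightarrow> ('v, 'a) ext_path set \<Rightarrow>
     ('v, 'a, 'f::field) framed_rep set" where
  "stable_with_skeleton Q \<alpha> \<zeta> S = {Mf \<in> stable_pairs Q \<alpha> \<zeta>. J_skeleton Q \<alpha> \<zeta> Mf S}"

definition J_skeleta ::
  "'k::field itself \<Rightarrow> ('v, 'a) pre_digraph \<Rightarrow> ('v \<Rightarrow> nat) \<Rightarrow> ('v \<Rightarrow> nat) \<Rightarrow>
     ('v, 'a) ext_path set set" where
  "J_skeleta _ Q \<alpha> \<zeta> =
     {S. \<exists>Mf :: ('v, 'a, 'k) framed_rep. Mf \<in> stable_pairs Q \<alpha> \<zeta> \<and> J_skeleton Q \<alpha> \<zeta> Mf S}"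

definition Gam ::
  "'k::field itself \<Rightarrow> ('v, 'a) pre_digraph \<Rightarrow> ('v \<Rightarrow> nat) \<Rightarrow> ('v \<Rightarrow> nat) \<Rightarrow> ('v, 'a) ext_path set"
where
  "Gam t Q \<alpha> \<zeta> = \<Union>(J_skeleta t Q \<alpha> \<zeta>)"

definition Gam_tilde ::
  "'k::field itself \<Rightarrow> ('v, 'a) pre_digraph \<Rightarrow> ('v \<Rightarrow> nat) \<Rightarrow> ('v \<Rightarrow> nat) \<Rightarrow> ('v, 'a) ext_path set"
where
  "Gam_tilde t Q \<alpha> \<zeta> = Gam t Q \<alpha> \<zeta> \<union>
     {(Some (tail Q a), Inl a # p) | a p. a \<in> arcs Q \<and> (Some (head Q a), p) \<in> Gam t Q \<alpha> \<zeta>}"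

definition Gr_J_hat ::
  "('v, 'a) pre_digraph \<Rightarrow> ('v \<Rightarrow> nat) \<Rightarrow> ('v \<Rightarrow> nat) \<Rightarrow>
     ('v \<Rightarrow> (('v, 'a) ext_path \<Rightarrow> 'k alg_closure) set, 'k::field) k_space" where
  "Gr_J_hat Q \<alpha> \<zeta> =
     grassmannian (verts Q) \<alpha> (\<lambda>i. {\<pi> \<in> Gam_tilde TYPE('k) Q \<alpha> \<zeta>. fst \<pi> = Some i})"

end

theory Submission
  imports Defs
begin

text \<open>
  Write \<open>r\<^sub>\<pi>\<close> for the row vector of a path \<open>\<pi>\<close> ending in \<open>\<infinity>\<close>. A pair is stable iff the rows \<open>r\<^sub>\<pi>\<close>
  have no common zero, and a suffix-closed set \<open>S\<close> with \<open>\<alpha>\<^sub>i\<close> paths from each vertex \<open>i\<close> is a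
  \<open>J\<close>-skeleton of a pair iff for every \<open>i\<close> the square matrix \<open>P\<^sub>i\<close> with the rows \<open>r\<^sub>\<pi>\<close>, \<open>\<pi> \<in> S\<close>, is
  invertible. So the chart of \<open>S\<close> is a principal open set. The element \<open>P\<close> of \<open>GL(\<alpha>)\<close> moves a pair of
  the chart to one with \<open>P = 1\<close>; these normal forms are the pairs where certain rows of the matrices
  are prescribed unit vectors and all others are arbitrary, hence an affine space of dimension
  \<open>\<Sum>\<^sub>a \<alpha>\<^sub>h\<^sub>a \<alpha>\<^sub>t\<^sub>a + \<Sum>\<^sub>i \<zeta>\<^sub>i \<alpha>\<^sub>i - \<Sum>\<^sub>i \<alpha>\<^sub>i\<^sup>2\<close>. In particular the skeleta are
  characterised combinatorially and are the same over \<open>k\<close> and over its algebraic closure.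

  The embedding into the product of Grassmannians maps the orbit of a pair to the spans of the columns
  of the matrices with rows \<open>r\<^sub>\<pi>\<close>. Where the \<open>S\<close>-minors do not vanish, a subspace has a
  unique basis with \<open>S\<close>-minors 1, whose entries give back the free coordinates of the normal form,
  and the image is cut out by the condition that the remaining entries are those of this normal form.
  Morphisms out of the quotient are obtained from invariant morphisms on stable pairs.
\<close>

section \<open>Regular functions, sheaves and quotients\<close>

text \<open>The quotient is given only by its defining property. Maps out of it are therefore
  written with a chosen representative of the orbit and shown to be morphisms by descent. In
  positive characteristic a bijective morphism need not be an isomorphism, so every isomorphism
  below comes with an explicit inverse morphism.

  The charts and the embedding meet in one point: the free entries of a normal form must be visible
  among the coordinates of \<open>Gr_J_hat\<close>. A free row of \<open>M_a\<close> is the row of a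
  path \<open>\<tau> a\<close> with \<tau> in the skeleton, and such paths belong to
  \<open>Gam_tilde\<close> by definition. A free row of \<open>f_i\<close> is the row of a framing
  arrow, which may lie outside the skeleton at hand; that some other skeleton contains it needs an
  exchange of path ends.

  Rows of paths are handled as scalar functions of an index, since the same expressions have to
  serve as linear equations over any field and as regular functions of the pair.\<close>

definition kfun :: "'p set \<Rightarrow> ('p \<Rightarrow> 'k::field alg_closure) set \<Rightarrow> ('p \<Rightarrow> 'k alg_closure) \<Rightarrow> bool" where
  "kfun P C f \<longleftrightarrow>
     (\<forall>x\<in>P. \<exists>g\<in>kpoly C. \<exists>h\<in>kpoly C. h x \<noteq> 0 \<and> (\<forall>y\<in>P. h y \<noteq> 0 \<longrightarrow> f y = g y / h y))"

text \<open>Separates the openness of the domain from the local fraction condition.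
  \<open>kfun\<close> makes sense on any set of points and restricts to subsets, so that regularity
  below becomes a matter of calculation.\<close>

lemma kreg_zariski: "kreg (zariski P C) U f \<longleftrightarrow> zariski_open P C U \<and> kfun U C f"
  by (simp add: zariski_def kfun_def)

lemma kpoly_one: "(\<lambda>_. 1) \<in> kpoly C"
  using kpoly_const[of 1 C] by simp

lemma zariski_open_whole: "zariski_open P C P"
  unfolding zariski_open_def using kpoly_one by (intro conjI ballI bexI) auto

lemma zariski_openE:
  assumes "zariski_open P C U" "x \<in> U"
  obtains h where "h \<in> kpoly C" "h x \<noteq> 0" "\<forall>y\<in>P. h y \<noteq> 0 \<longrightarrow> y \<in> U"
  using assms unfolding zariski_open_def by blast

lemma zariski_openI:
  assumes "U \<subseteq> P"
    and "\<And>x. x \<in> U \<Longrightarrow> \<exists>h\<in>kpoly C. h x \<noteq> 0 \<and> (\<forall>y\<in>P. h y \<noteq> 0 \<longrightarrow> y \<in> U)"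
  shows "zariski_open P C U"
  using assms unfolding zariski_open_def by blast

lemma kfunE:
  assumes "kfun P C f" "x \<in> P"
  obtains g h where "g \<in> kpoly C" "h \<in> kpoly C" "h x \<noteq> 0"
    "\<forall>y\<in>P. h y \<noteq> 0 \<longrightarrow> f y = g y / h y"
  using assms unfolding kfun_def by blast

lemma kfunI:
  assumes "\<And>x. x \<in> P \<Longrightarrow> \<exists>g\<in>kpoly C. \<exists>h\<in>kpoly C. h x \<noteq> 0 \<and> (\<forall>y\<in>P. h y \<noteq> 0 \<longrightarrow> f y = g y / h y)"
  shows "kfun P C f"
  using assms unfolding kfun_def by blast

text \<open>A fraction that represents \<open>f\<close> only where a further polynomial
  \<open>k\<close> does not vanish suffices: numerator and denominator are multiplied by
  \<open>k\<close>.\<close>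

lemma kfun_local:
  assumes "\<And>x. x \<in> P \<Longrightarrow>
    \<exists>g\<in>kpoly C. \<exists>h\<in>kpoly C. \<exists>k\<in>kpoly C. h x \<noteq> 0 \<and> k x \<noteq> 0 \<and>
      (\<forall>y\<in>P. k y \<noteq> 0 \<longrightarrow> h y \<noteq> 0 \<longrightarrow> f y = g y / h y)"
  shows "kfun P C f"
proof (rule kfunI)
  fix x assume "x \<in> P"
  from assms[OF this] obtain g h k where gh: "g \<in> kpoly C" "h \<in> kpoly C" "k \<in> kpoly C" "h x \<noteq> 0" "k x \<noteq> 0"
    "\<forall>y\<in>P. k y \<noteq> 0 \<longrightarrow> h y \<noteq> 0 \<longrightarrow> f y = g y / h y"
    by blast
  show "\<exists>g\<in>kpoly C. \<exists>h\<in>kpoly C. h x \<noteq> 0 \<and> (\<forall>y\<in>P. h y \<noteq> 0 \<longrightarrow> f y = g y / h y)"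
    by (rule bexI[of _ "\<lambda>y. g y * k y"], rule bexI[of _ "\<lambda>y. h y * k y"])
      (use gh in \<open>auto intro: kpoly_mult\<close>)
qed

lemma kfun_cong: "(\<And>x. x \<in> P \<Longrightarrow> f x = g x) \<Longrightarrow> kfun P C f \<longleftrightarrow> kfun P C g"
  unfolding kfun_def by simp

lemma kfun_subset: "kfun P C f \<Longrightarrow> U \<subseteq> P \<Longrightarrow> kfun U C f"
  unfolding kfun_def by blast

section \<open>Closure properties of regular functions\<close>

lemma kfun_kpoly: "f \<in> kpoly C \<Longrightarrow> kfun P C f"
  by (rule kfunI, rule bexI[of _ f], rule bexI[of _ "\<lambda>_. 1"]) (auto intro: kpoly_one)

lemma kfun_const: "kfun P C (\<lambda>_. to_ac c)"
  by (intro kfun_kpoly kpoly_const)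

lemma kfun_0: "kfun P C (\<lambda>_. 0)" and kfun_1: "kfun P C (\<lambda>_. 1)"
  using kfun_const[of P C 0] kfun_const[of P C 1] by simp_all

lemma kfun_coord: "f \<in> C \<Longrightarrow> kfun P C f"
  by (intro kfun_kpoly kpoly_coord)

lemma kfun_add:
  assumes "kfun P C f" "kfun P C f'"
  shows "kfun P C (\<lambda>x. f x + f' x)"
proof (rule kfunI)
  fix x assume x: "x \<in> P"
  obtain g h where 1: "g \<in> kpoly C" "h \<in> kpoly C" "h x \<noteq> 0"
    "\<forall>y\<in>P. h y \<noteq> 0 \<longrightarrow> f y = g y / h y"
    by (rule kfunE[OF assms(1) x])
  obtain g' h' where 2: "g' \<in> kpoly C" "h' \<in> kpoly C" "h' x \<noteq> 0"
    "\<forall>y\<in>P. h' y \<noteq> 0 \<longrightarrow> f' y = g' y / h' y"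
    by (rule kfunE[OF assms(2) x])
  show "\<exists>g\<in>kpoly C. \<exists>h\<in>kpoly C. h x \<noteq> 0 \<and> (\<forall>y\<in>P. h y \<noteq> 0 \<longrightarrow> f y + f' y = g y / h y)"
    by (rule bexI[of _ "\<lambda>y. g y * h' y + g' y * h y"], rule bexI[of _ "\<lambda>y. h y * h' y"])
      (use 1 2 in \<open>auto intro!: kpoly_mult kpoly_add simp: add_frac_eq\<close>)
qed

lemma kfun_mult:
  assumes "kfun P C f" "kfun P C f'"
  shows "kfun P C (\<lambda>x. f x * f' x)"
proof (rule kfunI)
  fix x assume x: "x \<in> P"
  obtain g h where 1: "g \<in> kpoly C" "h \<in> kpoly C" "h x \<noteq> 0"
    "\<forall>y\<in>P. h y \<noteq> 0 \<longrightarrow> f y = g y / h y"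
    by (rule kfunE[OF assms(1) x])
  obtain g' h' where 2: "g' \<in> kpoly C" "h' \<in> kpoly C" "h' x \<noteq> 0"
    "\<forall>y\<in>P. h' y \<noteq> 0 \<longrightarrow> f' y = g' y / h' y"
    by (rule kfunE[OF assms(2) x])
  show "\<exists>g\<in>kpoly C. \<exists>h\<in>kpoly C. h x \<noteq> 0 \<and> (\<forall>y\<in>P. h y \<noteq> 0 \<longrightarrow> f y * f' y = g y / h y)"
    by (rule bexI[of _ "\<lambda>y. g y * g' y"], rule bexI[of _ "\<lambda>y. h y * h' y"])
      (use 1 2 in \<open>auto intro!: kpoly_mult\<close>)
qed

lemma kfun_inverse:
  assumes "kfun P C f" "\<And>x. x \<in> P \<Longrightarrow> f x \<noteq> 0"
  shows "kfun P C (\<lambda>x. 1 / f x)"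
proof (rule kfun_local)
  fix x assume x: "x \<in> P"
  obtain g h where 1: "g \<in> kpoly C" "h \<in> kpoly C" "h x \<noteq> 0"
    "\<forall>y\<in>P. h y \<noteq> 0 \<longrightarrow> f y = g y / h y"
    by (rule kfunE[OF assms(1) x])
  show "\<exists>g\<in>kpoly C. \<exists>h\<in>kpoly C. \<exists>k\<in>kpoly C. h x \<noteq> 0 \<and> k x \<noteq> 0 \<and>
      (\<forall>y\<in>P. k y \<noteq> 0 \<longrightarrow> h y \<noteq> 0 \<longrightarrow> 1 / f y = g y / h y)"
    \<comment> \<open>Near \<open>x\<close> the inverse is \<open>h / g\<close>. This holds where
      \<open>h\<close> does not vanish, so \<open>h\<close> is also the third polynomial.\<close>
    by (rule bexI[of _ h], rule bexI[of _ g], rule bexI[of _ h])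
      (use 1 assms(2)[OF x] x in auto)
qed

lemma kfun_divide:
  assumes "kfun P C f" "kfun P C g" "\<And>x. x \<in> P \<Longrightarrow> g x \<noteq> 0"
  shows "kfun P C (\<lambda>x. f x / g x)"
  using kfun_mult[OF assms(1) kfun_inverse[OF assms(2,3)]] by simp

lemma kfun_uminus: "kfun P C f \<Longrightarrow> kfun P C (\<lambda>x. - f x)"
  using kfun_mult[OF kfun_const[of P C "-1"]] by fastforce

lemma kfun_diff: "kfun P C f \<Longrightarrow> kfun P C g \<Longrightarrow> kfun P C (\<lambda>x. f x - g x)"
  using kfun_add[OF _ kfun_uminus, of P C f g] by simp

lemma kfun_sum: "(\<And>i. i \<in> I \<Longrightarrow> kfun P C (f i)) \<Longrightarrow> kfun P C (\<lambda>x. \<Sum>i\<in>I. f i x)"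
  by (induction I rule: infinite_finite_induct) (auto intro!: kfun_add kfun_0)

lemma kfun_prod: "(\<And>i. i \<in> I \<Longrightarrow> kfun P C (f i)) \<Longrightarrow> kfun P C (\<lambda>x. \<Prod>i\<in>I. f i x)"
  by (induction I rule: infinite_finite_induct) (auto intro!: kfun_mult kfun_1)

lemma zariski_open_kfun_neq_0:
  assumes "kfun P C f"
  shows "zariski_open P C {x \<in> P. f x \<noteq> 0}"
proof (rule zariski_openI)
  fix x assume x: "x \<in> {x \<in> P. f x \<noteq> 0}"
  then obtain g h where 1: "g \<in> kpoly C" "h \<in> kpoly C" "h x \<noteq> 0"
    "\<forall>y\<in>P. h y \<noteq> 0 \<longrightarrow> f y = g y / h y"
    using kfunE[OF assms(1)] by blast
  show "\<exists>k\<in>kpoly C. k x \<noteq> 0 \<and> (\<forall>y\<in>P. k y \<noteq> 0 \<longrightarrow> y \<in> {x \<in> P. f x \<noteq> 0})"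
    \<comment> \<open>The factor \<open>h\<close> secures the representation
      \<open>f = g / h\<close>; the factor \<open>g\<close> then detects the zeros of
      \<open>f\<close>.\<close>
    by (rule bexI[of _ "\<lambda>y. g y * h y"]) (use 1 x in \<open>auto intro: kpoly_mult\<close>)
qed auto

lemma kfun_compose_kpoly:
  assumes "p \<in> kpoly C'" "\<And>c. c \<in> C' \<Longrightarrow> kfun P C (\<lambda>x. c (\<phi> x))"
  shows "kfun P C (\<lambda>x. p (\<phi> x))"
  using assms(1)
  by induction (auto intro: kfun_const kfun_add kfun_mult assms(2))

text \<open>Polynomials in the coordinates pull back to regular functions, hence basic open sets to
  open sets and local fractions to quotients of regular functions. All concrete morphisms into
  Zariski spaces are checked on coordinates in this way.\<close>

lemma kmorphism_zariski:
  assumes P: "\<And>x. x \<in> P \<Longrightarrow> \<phi> x \<in> P'"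
    and C: "\<And>c. c \<in> C' \<Longrightarrow> kfun P C (\<lambda>x. c (\<phi> x))"
  shows "kmorphism (zariski P C) (zariski P' C') \<phi>"
proof -
  have op: "zariski_open P C {x \<in> P. \<phi> x \<in> U}" if "zariski_open P' C' U" for U
  proof -
    have "\<exists>h\<in>kpoly C. h x \<noteq> 0 \<and> (\<forall>y\<in>P. h y \<noteq> 0 \<longrightarrow> y \<in> {x \<in> P. \<phi> x \<in> U})"
      if x: "x \<in> P" "\<phi> x \<in> U" for x
    proof -
      obtain h where h: "h \<in> kpoly C'" "h (\<phi> x) \<noteq> 0" "\<forall>y\<in>P'. h y \<noteq> 0 \<longrightarrow> y \<in> U"
        by (rule zariski_openE[OF \<open>zariski_open P' C' U\<close> x(2)])
      have "zariski_open P C {x \<in> P. h (\<phi> x) \<noteq> 0}"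
        by (intro zariski_open_kfun_neq_0 kfun_compose_kpoly[OF h(1)] C)
      then obtain k where "k \<in> kpoly C" "k x \<noteq> 0"
        "\<forall>y\<in>P. k y \<noteq> 0 \<longrightarrow> y \<in> {x \<in> P. h (\<phi> x) \<noteq> 0}"
        by (rule zariski_openE) (use x h(2) in auto)
      then show ?thesis using P h(3) by auto
    qed
    then show ?thesis by (intro zariski_openI) auto
  qed
  have cont: "continuous_map (ktop (zariski P C)) (ktop (zariski P' C')) \<phi>"
    unfolding continuous_map_def using P op by auto
  moreover have "kreg (zariski P C) (kpreimage (zariski P C) \<phi> V) (f \<circ> \<phi>)"
    if f: "kreg (zariski P' C') V f" for V f
  proof -
    define U where "U = {x \<in> P. \<phi> x \<in> V}"
    have U: "kpreimage (zariski P C) \<phi> V = U" by (auto simp: kpreimage_def U_def)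
    have f': "zariski_open P' C' V" "kfun V C' f" using f by (auto simp: kreg_zariski)
    have C': "kfun U C (\<lambda>x. c (\<phi> x))" if "c \<in> C'" for c
      using kfun_subset[OF C[OF that], of U] by (auto simp: U_def)
    have "kfun U C (f \<circ> \<phi>)"
    proof (rule kfun_local)
      fix x assume "x \<in> U"
      then have x: "x \<in> U" "\<phi> x \<in> V" by (auto simp: U_def)
      obtain g h where gh: "g \<in> kpoly C'" "h \<in> kpoly C'" "h (\<phi> x) \<noteq> 0"
        "\<forall>y\<in>V. h y \<noteq> 0 \<longrightarrow> f y = g y / h y"
        by (rule kfunE[OF f'(2) x(2)])
      obtain a b where ab: "a \<in> kpoly C" "b \<in> kpoly C" "b x \<noteq> 0"
        "\<forall>y\<in>U. b y \<noteq> 0 \<longrightarrow> g (\<phi> y) = a y / b y"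
        by (rule kfunE[OF kfun_compose_kpoly[OF gh(1) C'] x(1)])
      obtain c d where cd: "c \<in> kpoly C" "d \<in> kpoly C" "d x \<noteq> 0"
        "\<forall>y\<in>U. d y \<noteq> 0 \<longrightarrow> h (\<phi> y) = c y / d y"
        by (rule kfunE[OF kfun_compose_kpoly[OF gh(2) C'] x(1)])
      \<comment> \<open>With \<open>g \<circ> \<phi> = a / b\<close> and
        \<open>h \<circ> \<phi> = c / d\<close> near \<open>x\<close>, the pullback of
        \<open>g / h\<close> is \<open>a d / (b c)\<close> wherever \<open>d\<close> is nonzero.
        This is a fraction at \<open>x\<close> because \<open>c\<close> does not vanish
        there.\<close>
      have cx: "c x \<noteq> 0" using cd(3,4) gh(3) x(1) by fastforce
      show "\<exists>g\<in>kpoly C. \<exists>h\<in>kpoly C. \<exists>k\<in>kpoly C. h x \<noteq> 0 \<and> k x \<noteq> 0 \<and>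
          (\<forall>y\<in>U. k y \<noteq> 0 \<longrightarrow> h y \<noteq> 0 \<longrightarrow> (f \<circ> \<phi>) y = g y / h y)"
        by (rule bexI[of _ "\<lambda>y. a y * d y"], rule bexI[of _ "\<lambda>y. b y * c y"], rule bexI[of _ d])
          (use gh ab cd cx in \<open>auto intro!: kpoly_mult simp: U_def\<close>)
    qed
    then show ?thesis using op[OF f'(1)] by (simp add: U kreg_zariski U_def)
  qed
  ultimately show ?thesis unfolding kmorphism_def by blast
qed

section \<open>Induced structures on subsets of Zariski spaces\<close>

lemma subtopology_zariski:
  assumes "Z \<subseteq> P"
  shows "subtopology (ktop (zariski P C)) Z = ktop (zariski Z C)"
  unfolding topology_eq
proof
  fix S
  show "openin (subtopology (ktop (zariski P C)) Z) S = openin (ktop (zariski Z C)) S"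
  proof
    assume "openin (subtopology (ktop (zariski P C)) Z) S"
    then obtain T where T: "zariski_open P C T" "S = T \<inter> Z" by (auto simp: openin_subtopology)
    show "openin (ktop (zariski Z C)) S"
      unfolding openin_zariski
    proof (rule zariski_openI)
      fix x assume x: "x \<in> S"
      then have "x \<in> T" using T by simp
      then obtain h where "h \<in> kpoly C" "h x \<noteq> 0" "\<forall>y\<in>P. h y \<noteq> 0 \<longrightarrow> y \<in> T"
        by (rule zariski_openE[OF T(1)])
      then show "\<exists>h\<in>kpoly C. h x \<noteq> 0 \<and> (\<forall>y\<in>Z. h y \<noteq> 0 \<longrightarrow> y \<in> S)"
        using T(2) assms by blast
    qed (use T in auto)
  next
    assume "openin (ktop (zariski Z C)) S"
    then have S: "zariski_open Z C S" by simp
    \<comment> \<open>The union of all basic open sets of \<open>P\<close> whose trace on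
      \<open>Z\<close> lies in \<open>S\<close>; taking all of them avoids a choice for each
      point.\<close>
    define T where "T = \<Union>{{y \<in> P. h y \<noteq> 0} |h. h \<in> kpoly C \<and> (\<forall>y\<in>Z. h y \<noteq> 0 \<longrightarrow> y \<in> S)}"
    have "zariski_open P C T"
      by (rule zariski_openI) (unfold T_def, blast+)
    moreover have "S = T \<inter> Z"
    proof
      show "S \<subseteq> T \<inter> Z"
      proof
        fix x assume x: "x \<in> S"
        then have "x \<in> Z" using S by (auto simp: zariski_open_def)
        obtain h where h: "h \<in> kpoly C" "h x \<noteq> 0" "\<forall>y\<in>Z. h y \<noteq> 0 \<longrightarrow> y \<in> S"
          by (rule zariski_openE[OF S x])
        have "x \<in> {y \<in> P. h y \<noteq> 0}" using \<open>x \<in> Z\<close> assms h(2) by auto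
        then show "x \<in> T \<inter> Z" using \<open>x \<in> Z\<close> h(1,3) unfolding T_def by blast
      qed
    qed (auto simp: T_def)
    ultimately show "openin (subtopology (ktop (zariski P C)) Z) S"
      by (auto simp: openin_subtopology)
  qed
qed

text \<open>The fractions that represent a regular function on \<open>Z\<close> locally are already
  defined on a basic open subset of \<open>P\<close>. Stable pairs and charts thereby become Zariski
  spaces with the coordinate functions of the ambient space.\<close>

lemma ksubspace_zariski:
  assumes Z: "Z \<subseteq> P"
  shows "ksubspace (zariski P C) Z = zariski Z C"
proof -
  have "kreg (ksubspace (zariski P C) Z) U f = kreg (zariski Z C) U f" for U f
  proof -
    have "(\<forall>x\<in>U. \<exists>V g. x \<in> V \<and> kreg (zariski P C) V g \<and> (\<forall>y\<in>U \<inter> V. f y = g y)) \<longleftrightarrow> kfun U C f"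
      (is "?L \<longleftrightarrow> _") if U: "zariski_open Z C U"
    proof
      assume ?L
      show "kfun U C f"
      proof (rule kfun_local)
        fix x assume x: "x \<in> U"
        then obtain V g where V: "x \<in> V" "kreg (zariski P C) V g" "\<And>y. y \<in> U \<inter> V \<Longrightarrow> f y = g y"
          using bspec[OF \<open>?L\<close> x] by blast
        then have V': "zariski_open P C V" "kfun V C g" by (auto simp: kreg_zariski)
        obtain k where k: "k \<in> kpoly C" "k x \<noteq> 0" "\<forall>y\<in>P. k y \<noteq> 0 \<longrightarrow> y \<in> V"
          by (rule zariski_openE[OF V'(1) V(1)])
        obtain a b where ab: "a \<in> kpoly C" "b \<in> kpoly C" "b x \<noteq> 0"
          "\<forall>y\<in>V. b y \<noteq> 0 \<longrightarrow> g y = a y / b y"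
          by (rule kfunE[OF V'(2) V(1)])
        have "U \<subseteq> P" using U Z by (auto simp: zariski_open_def)
        then show "\<exists>g\<in>kpoly C. \<exists>h\<in>kpoly C. \<exists>k\<in>kpoly C. h x \<noteq> 0 \<and> k x \<noteq> 0 \<and>
            (\<forall>y\<in>U. k y \<noteq> 0 \<longrightarrow> h y \<noteq> 0 \<longrightarrow> f y = g y / h y)"
          by (intro bexI[of _ a] bexI[of _ b] bexI[of _ k]) (use ab k V(3) in auto)
      qed
    next
      assume f: "kfun U C f"
      show ?L
      proof
        fix x assume x: "x \<in> U"
        obtain a b where ab: "a \<in> kpoly C" "b \<in> kpoly C" "b x \<noteq> 0"
          "\<forall>y\<in>U. b y \<noteq> 0 \<longrightarrow> f y = a y / b y"
          by (rule kfunE[OF f x])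
        have "kreg (zariski P C) {y \<in> P. b y \<noteq> 0} (\<lambda>y. a y / b y)"
          unfolding kreg_zariski using ab
          by (intro conjI zariski_open_kfun_neq_0 kfun_divide kfun_kpoly) auto
        moreover have "x \<in> P" using x U Z by (auto simp: zariski_open_def)
        ultimately show "\<exists>V g. x \<in> V \<and> kreg (zariski P C) V g \<and> (\<forall>y\<in>U \<inter> V. f y = g y)"
          using ab by (intro exI[of _ "{y \<in> P. b y \<noteq> 0}"] exI[of _ "\<lambda>y. a y / b y"]) auto
      qed
    qed
    moreover have "kreg (ksubspace (zariski P C) Z) U f \<longleftrightarrow> zariski_open Z C U \<and>
        (\<forall>x\<in>U. \<exists>V g. x \<in> V \<and> kreg (zariski P C) V g \<and> (\<forall>y\<in>U \<inter> V. f y = g y))"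
      by (simp add: ksubspace_def subtopology_zariski[OF Z])
    ultimately show ?thesis
      unfolding kreg_zariski[of Z C U f] by (cases "zariski_open Z C U") simp_all
  qed
  then have "kreg (ksubspace (zariski P C) Z) = kreg (zariski Z C)" by (intro ext)
  then show ?thesis
    by (intro k_space.equality) (simp_all add: ksubspace_def subtopology_zariski[OF Z])
qed

section \<open>The sheaf axioms and their passage to subspaces\<close>

lemma ksheafD:
  assumes "ksheaf E"
  shows ksheaf_openin: "kreg E U f \<Longrightarrow> openin (ktop E) U"
    and ksheaf_cong: "kreg E U f \<Longrightarrow> (\<And>x. x \<in> U \<Longrightarrow> f x = g x) \<Longrightarrow> kreg E U g"
    and ksheaf_restrict: "kreg E U f \<Longrightarrow> openin (ktop E) V \<Longrightarrow> V \<subseteq> U \<Longrightarrow> kreg E V f"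
    and ksheaf_glue: "(\<And>U. U \<in> \<U> \<Longrightarrow> kreg E U f) \<Longrightarrow> kreg E (\<Union>\<U>) f"
  using assms unfolding ksheaf_def by metis+

lemma ksheaf_local:
  assumes "ksheaf E" "\<And>x. x \<in> U \<Longrightarrow> \<exists>V. x \<in> V \<and> V \<subseteq> U \<and> kreg E V f"
  shows "kreg E U f"
proof -
  have "kreg E (\<Union>{V. V \<subseteq> U \<and> kreg E V f}) f"
    using assms(1) by (rule ksheaf_glue) auto
  moreover have "\<Union>{V. V \<subseteq> U \<and> kreg E V f} = U" using assms(2) by blast
  ultimately show ?thesis by simp
qed

lemma ksheaf_zariski: "ksheaf (zariski P C)"
  unfolding ksheaf_def
proof (intro conjI allI impI)
  show "openin (ktop (zariski P C)) U" if "kreg (zariski P C) U f" for U f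
    using that by (simp add: kreg_zariski)
  show "kreg (zariski P C) U g" if "kreg (zariski P C) U f" "\<forall>x\<in>U. f x = g x" for U f g
    using that kfun_cong[of U f g C] by (auto simp: kreg_zariski)
  show "kreg (zariski P C) V f" if "kreg (zariski P C) U f" "openin (ktop (zariski P C)) V" "V \<subseteq> U"
    for U V f
    using that by (auto simp: kreg_zariski intro: kfun_subset)
  fix \<U> f assume U: "\<forall>U\<in>\<U>. kreg (zariski P C) U f"
  have "openin (ktop (zariski P C)) (\<Union>\<U>)"
    by (rule openin_Union) (use U in \<open>simp add: kreg_zariski\<close>)
  moreover have "kfun (\<Union>\<U>) C f"
  proof (rule kfun_local)
    fix x assume "x \<in> \<Union>\<U>"
    then obtain V where V: "V \<in> \<U>" "x \<in> V" by blast
    then have V': "zariski_open P C V" "kfun V C f" using U by (auto simp: kreg_zariski)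
    obtain k where k: "k \<in> kpoly C" "k x \<noteq> 0" "\<forall>y\<in>P. k y \<noteq> 0 \<longrightarrow> y \<in> V"
      by (rule zariski_openE[OF V'(1) V(2)])
    obtain a b where ab: "a \<in> kpoly C" "b \<in> kpoly C" "b x \<noteq> 0"
      "\<forall>y\<in>V. b y \<noteq> 0 \<longrightarrow> f y = a y / b y"
      by (rule kfunE[OF V'(2) V(2)])
    have "\<Union>\<U> \<subseteq> P" using U by (auto simp: kreg_zariski zariski_open_def)
    then show "\<exists>g\<in>kpoly C. \<exists>h\<in>kpoly C. \<exists>k\<in>kpoly C. h x \<noteq> 0 \<and> k x \<noteq> 0 \<and>
        (\<forall>y\<in>\<Union>\<U>. k y \<noteq> 0 \<longrightarrow> h y \<noteq> 0 \<longrightarrow> f y = g y / h y)"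
      by (intro bexI[of _ a] bexI[of _ b] bexI[of _ k]) (use ab k in auto)
  qed
  ultimately show "kreg (zariski P C) (\<Union>\<U>) f" by (simp add: kreg_zariski)
qed

lemma kpts_ksubspace: "D \<subseteq> kpts E \<Longrightarrow> kpts (ksubspace E D) = D"
  by (auto simp: ksubspace_def)

lemma openin_ksubspace:
  "openin (ktop (ksubspace E Z)) V \<longleftrightarrow> (\<exists>T. openin (ktop E) T \<and> V = T \<inter> Z)"
  by (simp add: ksubspace_def openin_subtopology)

lemma kreg_ksubspaceE:
  assumes "kreg (ksubspace E Z) U f" "x \<in> U"
  obtains V g where "x \<in> V" "kreg E V g" "\<forall>y\<in>U \<inter> V. f y = g y"
proof -
  have "\<forall>x\<in>U. \<exists>V g. x \<in> V \<and> kreg E V g \<and> (\<forall>y\<in>U \<inter> V. f y = g y)"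
    using assms(1) by (simp add: ksubspace_def)
  from bspec[OF this assms(2)] show thesis using that by blast
qed

lemma openin_ksubspace_open:
  assumes "openin (ktop E) D"
  shows "openin (ktop (ksubspace E D)) U \<longleftrightarrow> openin (ktop E) U \<and> U \<subseteq> D"
  using assms by (auto simp: ksubspace_def openin_open_subtopology)

text \<open>The induced structure only asks for local extensions to \<open>E\<close>. Over an open
  \<open>D\<close> these can be cut down to \<open>D\<close> and glued to a section of
  \<open>E\<close>.\<close>

lemma kreg_ksubspace_open:
  assumes E: "ksheaf E" and D: "openin (ktop E) D"
  shows "kreg (ksubspace E D) U f \<longleftrightarrow> kreg E U f \<and> U \<subseteq> D"
proof
  assume f: "kreg (ksubspace E D) U f"
  then have U: "openin (ktop E) U" "U \<subseteq> D"
    using D by (auto simp: ksubspace_def openin_open_subtopology)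
  have "kreg E U f"
  proof (rule ksheaf_local[OF E])
    fix x assume x: "x \<in> U"
    then obtain V g where V: "x \<in> V" "kreg E V g" "\<forall>y\<in>U \<inter> V. f y = g y"
      using kreg_ksubspaceE[OF f] by blast
    then have "openin (ktop E) (U \<inter> V)" using U ksheaf_openin[OF E] by blast
    then have "kreg E (U \<inter> V) g" using ksheaf_restrict[OF E V(2)] by blast
    then have "kreg E (U \<inter> V) f" by (rule ksheaf_cong[OF E]) (use V(3) in auto)
    then show "\<exists>V. x \<in> V \<and> V \<subseteq> U \<and> kreg E V f" using x V(1) by blast
  qed
  then show "kreg E U f \<and> U \<subseteq> D" using U by blast
next
  assume f: "kreg E U f \<and> U \<subseteq> D"
  then have "openin (ktop E) U" using ksheaf_openin[OF E] by blast
  then show "kreg (ksubspace E D) U f"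
    using f D by (auto simp: ksubspace_def openin_open_subtopology)
qed

lemma kreg_ksubspaceI:
  assumes "openin (ktop (ksubspace E Z)) U"
    and "\<And>x. x \<in> U \<Longrightarrow> \<exists>V g. x \<in> V \<and> kreg E V g \<and> (\<forall>y\<in>U \<inter> V. f y = g y)"
  shows "kreg (ksubspace E Z) U f"
  using assms by (simp add: ksubspace_def)

lemma ksheaf_ksubspace:
  assumes E: "ksheaf E"
  shows "ksheaf (ksubspace E Z)"
  unfolding ksheaf_def
proof (intro conjI allI impI)
  show op: "openin (ktop (ksubspace E Z)) U" if "kreg (ksubspace E Z) U f" for U f
    using that by (simp add: ksubspace_def)
  show "kreg (ksubspace E Z) U g" if f: "kreg (ksubspace E Z) U f" and eq: "\<forall>x\<in>U. f x = g x" for U f g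
  proof (rule kreg_ksubspaceI[OF op[OF f]])
    fix x assume "x \<in> U"
    then obtain V h where "x \<in> V" "kreg E V h" "\<forall>y\<in>U \<inter> V. f y = h y" by (rule kreg_ksubspaceE[OF f])
    then show "\<exists>V h. x \<in> V \<and> kreg E V h \<and> (\<forall>y\<in>U \<inter> V. g y = h y)"
      using eq by (intro exI[of _ V] exI[of _ h]) auto
  qed
  show "kreg (ksubspace E Z) V f"
    if f: "kreg (ksubspace E Z) U f" and V: "openin (ktop (ksubspace E Z)) V" "V \<subseteq> U" for U V f
  proof (rule kreg_ksubspaceI[OF V(1)])
    fix x assume "x \<in> V"
    then have "x \<in> U" using V(2) by blast
    then obtain V' h where "x \<in> V'" "kreg E V' h" "\<forall>y\<in>U \<inter> V'. f y = h y" by (rule kreg_ksubspaceE[OF f])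
    then show "\<exists>V' h. x \<in> V' \<and> kreg E V' h \<and> (\<forall>y\<in>V \<inter> V'. f y = h y)"
      using V(2) by (intro exI[of _ V'] exI[of _ h]) auto
  qed
  fix \<U> f assume \<U>: "\<forall>U\<in>\<U>. kreg (ksubspace E Z) U f"
  show "kreg (ksubspace E Z) (\<Union>\<U>) f"
  proof (rule kreg_ksubspaceI)
    show "openin (ktop (ksubspace E Z)) (\<Union>\<U>)" by (rule openin_Union) (use \<U> op in blast)
    fix x assume "x \<in> \<Union>\<U>"
    then obtain U where U: "U \<in> \<U>" "x \<in> U" by blast
    then have f: "kreg (ksubspace E Z) U f" using \<U> by blast
    obtain V h where V: "x \<in> V" "kreg E V h" "\<forall>y\<in>U \<inter> V. f y = h y" by (rule kreg_ksubspaceE[OF f U(2)])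
    \<comment> \<open>Shrinking \<open>V\<close> to \<open>V \<inter> T\<close> forces the points of
      the union that lie in it into \<open>U\<close>, where \<open>h\<close> is known to represent
      \<open>f\<close>.\<close>
    obtain T where T: "openin (ktop E) T" "U = T \<inter> Z" using op[OF f] by (auto simp: openin_ksubspace)
    have "openin (ktop E) (V \<inter> T)" using T(1) ksheaf_openin[OF E V(2)] by blast
    then have "kreg E (V \<inter> T) h" using ksheaf_restrict[OF E V(2)] by blast
    moreover have "\<Union>\<U> \<subseteq> Z"
      using \<U> op by (fastforce simp: openin_ksubspace)
    ultimately show "\<exists>V h. x \<in> V \<and> kreg E V h \<and> (\<forall>y\<in>\<Union>\<U> \<inter> V. f y = h y)"
      using V T(2) U(2) by (intro exI[of _ "V \<inter> T"] exI[of _ h]) auto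
  qed
qed

lemma ksubspace_kpts:
  assumes E: "ksheaf E"
  shows "ksubspace E (kpts E) = E"
proof (intro k_space.equality)
  have "kreg (ksubspace E (kpts E)) U f = kreg E U f" for U f
    using kreg_ksubspace_open[OF E openin_topspace, of U f] ksheaf_openin[OF E, of U f] openin_subset
    by metis
  then show "kreg (ksubspace E (kpts E)) = kreg E" by (intro ext)
qed (simp_all add: ksubspace_def)

section \<open>Morphisms and isomorphisms\<close>

lemma kpreimage_cong:
  "(\<And>x. x \<in> kpts E \<Longrightarrow> \<phi> x = \<chi> x) \<Longrightarrow> kpreimage E \<phi> V = kpreimage E \<chi> V"
  by (auto simp: kpreimage_def)

lemma kmorphismD:
  assumes "kmorphism E Y \<phi>"
  shows kmorphism_kreg: "kreg Y V f \<Longrightarrow> kreg E (kpreimage E \<phi> V) (f \<circ> \<phi>)"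
    and kmorphism_kpts: "x \<in> kpts E \<Longrightarrow> \<phi> x \<in> kpts Y"
    and kmorphism_openin: "openin (ktop Y) V \<Longrightarrow> openin (ktop E) (kpreimage E \<phi> V)"
  using assms unfolding kmorphism_def continuous_map_def kpreimage_def by auto

lemma kmorphismI:
  assumes "\<And>x. x \<in> kpts E \<Longrightarrow> \<phi> x \<in> kpts Y"
    and "\<And>V. openin (ktop Y) V \<Longrightarrow> openin (ktop E) (kpreimage E \<phi> V)"
    and "\<And>V f. kreg Y V f \<Longrightarrow> kreg E (kpreimage E \<phi> V) (f \<circ> \<phi>)"
  shows "kmorphism E Y \<phi>"
  using assms unfolding kmorphism_def continuous_map_def kpreimage_def by auto

lemma kmorphism_cong:
  assumes E: "ksheaf E" and "kmorphism E Y \<phi>" and eq: "\<And>x. x \<in> kpts E \<Longrightarrow> \<phi> x = \<chi> x"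
  shows "kmorphism E Y \<chi>"
proof (rule kmorphismI)
  show "\<chi> x \<in> kpts Y" if "x \<in> kpts E" for x
    using kmorphism_kpts[OF assms(2) that] eq[OF that] by simp
  show "openin (ktop E) (kpreimage E \<chi> V)" if "openin (ktop Y) V" for V
    using kmorphism_openin[OF assms(2) that] kpreimage_cong[of E \<phi> \<chi> V, OF eq] by simp
  fix V f assume f: "kreg Y V f"
  have "kreg E (kpreimage E \<chi> V) (f \<circ> \<phi>)"
    using kmorphism_kreg[OF assms(2) f] kpreimage_cong[of E \<phi> \<chi> V, OF eq] by simp
  then show "kreg E (kpreimage E \<chi> V) (f \<circ> \<chi>)"
    by (rule ksheaf_cong[OF E]) (simp add: kpreimage_def eq)
qed

lemma kmorphism_comp:
  assumes "kmorphism E F \<phi>" "kmorphism F Y \<chi>"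
  shows "kmorphism E Y (\<chi> \<circ> \<phi>)"
proof -
  have pre: "kpreimage E (\<chi> \<circ> \<phi>) V = kpreimage E \<phi> (kpreimage F \<chi> V)" for V
    using kmorphism_kpts[OF assms(1)] by (auto simp: kpreimage_def)
  show ?thesis
  proof (rule kmorphismI)
    show "(\<chi> \<circ> \<phi>) x \<in> kpts Y" if "x \<in> kpts E" for x
      using kmorphism_kpts[OF assms(2) kmorphism_kpts[OF assms(1) that]] by simp
    show "openin (ktop E) (kpreimage E (\<chi> \<circ> \<phi>) V)" if "openin (ktop Y) V" for V
      unfolding pre by (intro kmorphism_openin[OF assms(1)] kmorphism_openin[OF assms(2)] that)
    show "kreg E (kpreimage E (\<chi> \<circ> \<phi>) V) (f \<circ> (\<chi> \<circ> \<phi>))" if "kreg Y V f" for V f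
      unfolding pre using kmorphism_kreg[OF assms(1) kmorphism_kreg[OF assms(2) that]]
      by (simp add: comp_assoc)
  qed
qed

lemma kmorphism_to_ksubspace:
  assumes E: "ksheaf E" and \<phi>: "kmorphism E Y \<phi>" and Z: "\<And>x. x \<in> kpts E \<Longrightarrow> \<phi> x \<in> Z"
  shows "kmorphism E (ksubspace Y Z) \<phi>"
proof (rule kmorphismI)
  show "\<phi> x \<in> kpts (ksubspace Y Z)" if "x \<in> kpts E" for x
    using that Z kmorphism_kpts[OF \<phi>] by (auto simp: ksubspace_def)
  have op: "openin (ktop E) (kpreimage E \<phi> V)" if V: "openin (ktop (ksubspace Y Z)) V" for V
  proof -
    obtain T where T: "openin (ktop Y) T" "V = T \<inter> Z"
      using V by (auto simp: openin_ksubspace)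
    then have "kpreimage E \<phi> V = kpreimage E \<phi> T" using Z by (auto simp: kpreimage_def)
    then show ?thesis using kmorphism_openin[OF \<phi> T(1)] by simp
  qed
  then show "openin (ktop E) (kpreimage E \<phi> V)" if "openin (ktop (ksubspace Y Z)) V" for V
    using that .
  fix V f assume f: "kreg (ksubspace Y Z) V f"
  then have V: "openin (ktop (ksubspace Y Z)) V" by (simp add: ksubspace_def)
  show "kreg E (kpreimage E \<phi> V) (f \<circ> \<phi>)"
  proof (rule ksheaf_local[OF E])
    fix x assume x: "x \<in> kpreimage E \<phi> V"
    then have "\<phi> x \<in> V" by (auto simp: kpreimage_def)
    then obtain W g where W: "\<phi> x \<in> W" "kreg Y W g" "\<forall>y\<in>V \<inter> W. f y = g y"
      using kreg_ksubspaceE[OF f] by blast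
    let ?U = "kpreimage E \<phi> V \<inter> kpreimage E \<phi> W"
    have gW: "kreg E (kpreimage E \<phi> W) (g \<circ> \<phi>)" using kmorphism_kreg[OF \<phi> W(2)] .
    have "openin (ktop E) ?U" using op[OF V] ksheaf_openin[OF E gW] by blast
    then have "kreg E ?U (g \<circ> \<phi>)" using ksheaf_restrict[OF E gW] by blast
    then have "kreg E ?U (f \<circ> \<phi>)"
      by (rule ksheaf_cong[OF E]) (use W(3) in \<open>auto simp: kpreimage_def\<close>)
    then show "\<exists>U. x \<in> U \<and> U \<subseteq> kpreimage E \<phi> V \<and> kreg E U (f \<circ> \<phi>)"
      using x W(1) by (intro exI[of _ ?U]) (auto simp: kpreimage_def)
  qed
qed

lemma kmorphism_from_ksubspace_open:
  assumes E: "ksheaf E" and D: "openin (ktop E) D" and \<phi>: "kmorphism E Y \<phi>"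
  shows "kmorphism (ksubspace E D) Y \<phi>"
proof -
  have DE: "D \<subseteq> kpts E" using D by (rule openin_subset)
  have pre: "kpreimage (ksubspace E D) \<phi> V = kpreimage E \<phi> V \<inter> D" for V
    using DE by (auto simp: kpreimage_def kpts_ksubspace[OF DE])
  show ?thesis
  proof (rule kmorphismI)
    show "\<phi> x \<in> kpts Y" if "x \<in> kpts (ksubspace E D)" for x
      using that DE kmorphism_kpts[OF \<phi>] by (auto simp: kpts_ksubspace[OF DE])
    show "openin (ktop (ksubspace E D)) (kpreimage (ksubspace E D) \<phi> V)" if "openin (ktop Y) V" for V
      using kmorphism_openin[OF \<phi> that] D by (auto simp: pre openin_ksubspace_open[OF D])
    show "kreg (ksubspace E D) (kpreimage (ksubspace E D) \<phi> V) (f \<circ> \<phi>)" if "kreg Y V f" for V f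
      unfolding pre kreg_ksubspace_open[OF E D]
      using ksheaf_restrict[OF E kmorphism_kreg[OF \<phi> that], of "kpreimage E \<phi> V \<inter> D"]
        ksheaf_openin[OF E kmorphism_kreg[OF \<phi> that]] D by blast
  qed
qed

text \<open>An explicit inverse agrees with \<open>inv_into\<close> on the points of
  \<open>Y\<close>, and over a sheaf a morphism may be changed off the points.\<close>

lemma kisoI:
  assumes Y: "ksheaf Y" and \<phi>: "kmorphism E Y \<phi>" and \<chi>: "kmorphism Y E \<chi>"
    and inv: "\<And>x. x \<in> kpts E \<Longrightarrow> \<chi> (\<phi> x) = x" "\<And>y. y \<in> kpts Y \<Longrightarrow> \<phi> (\<chi> y) = y"
  shows "kiso E Y \<phi>"
proof -
  have bij: "bij_betw \<phi> (kpts E) (kpts Y)"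
    using inv kmorphism_kpts[OF \<phi>] kmorphism_kpts[OF \<chi>]
    by (intro bij_betw_byWitness[of _ \<chi>]) auto
  have "\<chi> y = inv_into (kpts E) \<phi> y" if "y \<in> kpts Y" for y
    using inv_into_f_f[OF bij_betw_imp_inj_on[OF bij] kmorphism_kpts[OF \<chi> that]] inv(2)[OF that] by simp
  then have "kmorphism Y E (inv_into (kpts E) \<phi>)" by (rule kmorphism_cong[OF Y \<chi>])
  then show ?thesis unfolding kiso_def using bij \<phi> by blast
qed

text \<open>Affine space is closed in itself, and its induced structure is the given one.\<close>

lemma kaffine_affine_space_iso:
  assumes "ksheaf E" and "kmorphism E (affine_space n) \<chi>" and "kmorphism (affine_space n) E \<phi>"
    and "\<And>x. x \<in> kpts E \<Longrightarrow> \<phi> (\<chi> x) = x"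
    and "\<And>y. y \<in> kpts (affine_space n :: (_, 'k) k_space) \<Longrightarrow> \<chi> (\<phi> y) = y"
  shows "kaffine (E :: (_, 'k::field) k_space)"
proof -
  let ?A = "affine_space n :: (_, 'k) k_space"
  have A: "ksheaf ?A" by (simp add: affine_space_def ksheaf_zariski)
  have "kiso E (ksubspace ?A (kpts ?A)) \<chi>"
    unfolding ksubspace_kpts[OF A] using A assms by (intro kisoI)
  then show ?thesis unfolding kaffine_def
    by (intro exI[of _ n] exI[of _ "kpts ?A"] exI[of _ \<chi>]) auto
qed

text \<open>
  The part of \<open>geometric_quotient\<close> that passes to saturated open subsets without knowing that the
  quotient is a variety; on the charts the latter follows only afterwards, because they are affine
  spaces.
\<close>

definition quotient_like ::
  "'g set \<Rightarrow> ('g \<Rightarrow> 'p \<Rightarrow> 'p) \<Rightarrow> ('p, 'k::field) k_space \<Rightarrow> ('q, 'k) k_space \<Rightarrow> ('p \<Rightarrow> 'q) \<Rightarrow> bool"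
where
  "quotient_like G act E Y q \<longleftrightarrow>
     kmorphism E Y q \<and> q ` kpts E = kpts Y \<and>
     (\<forall>x\<in>kpts E. {y \<in> kpts E. q y = q x} = {act g x | g. g \<in> G}) \<and>
     (\<forall>V\<subseteq>kpts Y. openin (ktop E) (kpreimage E q V) \<longrightarrow> openin (ktop Y) V) \<and>
     (\<forall>V h. openin (ktop Y) V \<longrightarrow> kreg E (kpreimage E q V) h \<longrightarrow>
        (\<forall>x\<in>kpreimage E q V. \<forall>g\<in>G. h (act g x) = h x) \<longrightarrow>
        (\<exists>f. kreg Y V f \<and> (\<forall>x\<in>kpreimage E q V. h x = f (q x))))"

lemma geometric_quotient_alt:
  "geometric_quotient G act E Y q \<longleftrightarrow> algebraic_variety Y \<and> quotient_like G act E Y q"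
  unfolding geometric_quotient_def quotient_like_def by blast

lemma quotient_likeD:
  assumes "quotient_like G act E Y q"
  shows quotient_like_kmorphism: "kmorphism E Y q"
    and quotient_like_surj: "q ` kpts E = kpts Y"
    and quotient_like_fibre: "x \<in> kpts E \<Longrightarrow> {y \<in> kpts E. q y = q x} = {act g x | g. g \<in> G}"
    and quotient_like_openin: "V \<subseteq> kpts Y \<Longrightarrow> openin (ktop E) (kpreimage E q V) \<Longrightarrow> openin (ktop Y) V"
    and quotient_like_invariant: "openin (ktop Y) V \<Longrightarrow> kreg E (kpreimage E q V) h \<Longrightarrow>
        (\<And>x g. x \<in> kpreimage E q V \<Longrightarrow> g \<in> G \<Longrightarrow> h (act g x) = h x) \<Longrightarrow>
        \<exists>f. kreg Y V f \<and> (\<forall>x\<in>kpreimage E q V. h x = f (q x))"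
proof -
  note Q = assms[unfolded quotient_like_def]
  note Q3 = Q[THEN conjunct2, THEN conjunct2] and Q4 = Q[THEN conjunct2, THEN conjunct2, THEN conjunct2]
  show "kmorphism E Y q" by (rule Q[THEN conjunct1])
  show "q ` kpts E = kpts Y" by (rule Q[THEN conjunct2, THEN conjunct1])
  show "{y \<in> kpts E. q y = q x} = {act g x | g. g \<in> G}" if "x \<in> kpts E"
    by (rule bspec[OF Q3[THEN conjunct1] that])
  show "openin (ktop Y) V" if "V \<subseteq> kpts Y" "openin (ktop E) (kpreimage E q V)"
    using Q4[THEN conjunct1, rule_format, OF that] .
  show "\<exists>f. kreg Y V f \<and> (\<forall>x\<in>kpreimage E q V. h x = f (q x))"
    if "openin (ktop Y) V" "kreg E (kpreimage E q V) h"
      "\<And>x g. x \<in> kpreimage E q V \<Longrightarrow> g \<in> G \<Longrightarrow> h (act g x) = h x"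
    using Q4[THEN conjunct2, rule_format, OF that] .
qed

section \<open>Saturated open subsets and descent\<close>

lemma quotient_like_act:
  assumes "quotient_like G act E Y q" "x \<in> kpts E" "g \<in> G"
  shows "act g x \<in> kpts E" "q (act g x) = q x"
  using quotient_like_fibre[OF assms(1,2)] assms(3) by blast+

text \<open>Saturation makes \<open>D\<close> the full preimage of its image, so that open sets,
  fibres and invariant functions over the image are those of \<open>Y\<close>.\<close>

lemma quotient_like_restrict:
  assumes Q: "quotient_like G act E Y q" and E: "ksheaf E" and Y: "ksheaf Y"
    and D: "openin (ktop E) D"
    and sat: "\<And>x y. x \<in> D \<Longrightarrow> y \<in> kpts E \<Longrightarrow> q y = q x \<Longrightarrow> y \<in> D"
  shows "openin (ktop Y) (q ` D)" "quotient_like G act (ksubspace E D) (ksubspace Y (q ` D)) q"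
proof -
  have DE: "D \<subseteq> kpts E" using D by (rule openin_subset)
  have qDY: "q ` D \<subseteq> kpts Y" using DE quotient_like_surj[OF Q] by blast
  have preD: "kpreimage E q (q ` D) = D" using sat DE by (auto simp: kpreimage_def)
  show qD: "openin (ktop Y) (q ` D)"
    using quotient_like_openin[OF Q qDY] D by (simp add: preD)
  have pre: "kpreimage (ksubspace E D) q V = kpreimage E q V" if "V \<subseteq> q ` D" for V
    using that sat DE by (auto simp: kpreimage_def kpts_ksubspace[OF DE])
  show "quotient_like G act (ksubspace E D) (ksubspace Y (q ` D)) q"
    unfolding quotient_like_def kpts_ksubspace[OF DE] kpts_ksubspace[OF qDY]
      openin_ksubspace_open[OF D] openin_ksubspace_open[OF qD] kreg_ksubspace_open[OF E D]
      kreg_ksubspace_open[OF Y qD]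
  proof (intro conjI allI impI ballI)
    show "kmorphism (ksubspace E D) (ksubspace Y (q ` D)) q"
      by (intro kmorphism_to_ksubspace ksheaf_ksubspace E D kmorphism_from_ksubspace_open
          quotient_like_kmorphism[OF Q]) (simp add: kpts_ksubspace[OF DE])
    show "{y \<in> D. q y = q x} = {act g x |g. g \<in> G}" if "x \<in> D" for x
      using quotient_like_fibre[OF Q, of x] that DE sat by blast
    show "openin (ktop Y) V"
      if "V \<subseteq> q ` D" "openin (ktop E) (kpreimage (ksubspace E D) q V) \<and> kpreimage (ksubspace E D) q V \<subseteq> D"
      for V
      using that qDY by (intro quotient_like_openin[OF Q]) (auto simp: pre)
    show "\<exists>f. (kreg Y V f \<and> V \<subseteq> q ` D) \<and> (\<forall>x\<in>kpreimage (ksubspace E D) q V. h x = f (q x))"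
      if "openin (ktop Y) V \<and> V \<subseteq> q ` D"
        "kreg E (kpreimage (ksubspace E D) q V) h \<and> kpreimage (ksubspace E D) q V \<subseteq> D"
        "\<forall>x\<in>kpreimage (ksubspace E D) q V. \<forall>g\<in>G. h (act g x) = h x" for V h
      using quotient_like_invariant[OF Q, of V h] that by (auto simp: pre)
  qed auto
qed

text \<open>The universal property of the quotient. For \<open>f\<close> regular on
  \<open>T\<close>, the function \<open>f \<circ> \<phi>\<close> is constant on orbits and hence the
  pullback of a regular function on \<open>Y\<close>; as \<open>q\<close> is surjective, that
  function can only be \<open>f \<circ> \<chi>\<close>.\<close>

lemma quotient_like_descend:
  assumes Q: "quotient_like G act E Y q" and E: "ksheaf E" and Y: "ksheaf Y"
    and \<phi>: "kmorphism E T \<phi>" and desc: "\<And>x. x \<in> kpts E \<Longrightarrow> \<chi> (q x) = \<phi> x"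
  shows "kmorphism Y T \<chi>"
proof -
  have surj: "\<exists>x\<in>kpts E. q x = y" if "y \<in> kpts Y" for y
    using quotient_like_surj[OF Q] that by force
  have qY: "q x \<in> kpts Y" if "x \<in> kpts E" for x
    using quotient_like_surj[OF Q] that by blast
  have pre: "kpreimage E q (kpreimage Y \<chi> V) = kpreimage E \<phi> V" for V
    using qY by (auto simp: kpreimage_def desc)
  have op: "openin (ktop Y) (kpreimage Y \<chi> V)" if "openin (ktop E) (kpreimage E \<phi> V)" for V
    using that by (intro quotient_like_openin[OF Q]) (auto simp: pre, auto simp: kpreimage_def)
  show ?thesis
  proof (rule kmorphismI)
    show "\<chi> y \<in> kpts T" if "y \<in> kpts Y" for y
      using surj[OF that] kmorphism_kpts[OF \<phi>] desc by auto
    show "openin (ktop Y) (kpreimage Y \<chi> V)" if "openin (ktop T) V" for V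
      using op kmorphism_openin[OF \<phi> that] by blast
    fix V f assume "kreg T V f"
    then have f: "kreg E (kpreimage E \<phi> V) (f \<circ> \<phi>)" by (rule kmorphism_kreg[OF \<phi>])
    have "\<exists>f'. kreg Y (kpreimage Y \<chi> V) f' \<and> (\<forall>x\<in>kpreimage E q (kpreimage Y \<chi> V). (f \<circ> \<phi>) x = f' (q x))"
    proof (rule quotient_like_invariant[OF Q op])
      show "openin (ktop E) (kpreimage E \<phi> V)" using ksheaf_openin[OF E f] .
      show "kreg E (kpreimage E q (kpreimage Y \<chi> V)) (f \<circ> \<phi>)" using f by (simp add: pre)
      fix x g assume "x \<in> kpreimage E q (kpreimage Y \<chi> V)" and g: "g \<in> G"
      then have x: "x \<in> kpts E" by (auto simp: kpreimage_def)
      then show "(f \<circ> \<phi>) (act g x) = (f \<circ> \<phi>) x"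
        using desc[OF x] desc[OF quotient_like_act(1)[OF Q x g]] quotient_like_act(2)[OF Q x g] by simp
    qed
    then obtain f' where f': "kreg Y (kpreimage Y \<chi> V) f'"
      "\<And>x. x \<in> kpreimage E \<phi> V \<Longrightarrow> f (\<phi> x) = f' (q x)" by (auto simp: pre)
    have "f' y = (f \<circ> \<chi>) y" if y: "y \<in> kpreimage Y \<chi> V" for y
    proof -
      obtain x where "x \<in> kpts E" "q x = y" using surj y by (auto simp: kpreimage_def)
      then show ?thesis using f'(2)[of x] y desc[of x] by (auto simp: kpreimage_def)
    qed
    then show "kreg Y (kpreimage Y \<chi> V) (f \<circ> \<chi>)" by (rule ksheaf_cong[OF Y f'(1)])
  qed
qed

section \<open>Open affine subvarieties\<close>

lemma kseparated_ksubspace_open: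
  assumes Y: "ksheaf Y" and sep: "kseparated Y" and V: "openin (ktop Y) V"
  shows "kseparated (ksubspace Y V)"
  unfolding kseparated_def kpts_ksubspace[OF openin_subset[OF V]] kreg_ksubspace_open[OF Y V]
    openin_ksubspace_open[OF V]
proof (intro ballI impI)
  fix x y assume xy: "x \<in> V" "y \<in> V" "x \<noteq> y"
  then have "x \<in> kpts Y" "y \<in> kpts Y" using openin_subset[OF V] by auto
  then have "\<exists>U V (m::nat) f g. x \<in> U \<and> y \<in> V \<and> (\<forall>j<m. kreg Y U (f j) \<and> kreg Y V (g j)) \<and>
      openin (ktop Y) U \<and> openin (ktop Y) V \<and>
      (\<Sum>j<m. f j x * g j y) \<noteq> 0 \<and> (\<forall>z\<in>U \<inter> V. (\<Sum>j<m. f j z * g j z) = 0)"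
    using sep[unfolded kseparated_def, THEN bspec, THEN bspec, THEN mp] xy(3) by blast
  then obtain A B and m :: nat and f g where AB: "x \<in> A" "y \<in> B"
    "\<forall>j<m. kreg Y A (f j) \<and> kreg Y B (g j)" "openin (ktop Y) A" "openin (ktop Y) B"
    "(\<Sum>j<m. f j x * g j y) \<noteq> 0" "\<forall>z\<in>A \<inter> B. (\<Sum>j<m. f j z * g j z) = 0"
    by (elim exE conjE) (rule that; assumption)
  have AV: "kreg Y (A \<inter> V) (f j)" "kreg Y (B \<inter> V) (g j)" if "j < m" for j
    using AB(3-5) that V ksheaf_restrict[OF Y, of A "f j" "A \<inter> V"]
      ksheaf_restrict[OF Y, of B "g j" "B \<inter> V"] by auto
  show "\<exists>A B (m::nat) f g. x \<in> A \<and> y \<in> B \<and>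
      (\<forall>j<m. (kreg Y A (f j) \<and> A \<subseteq> V) \<and> (kreg Y B (g j) \<and> B \<subseteq> V)) \<and>
      (openin (ktop Y) A \<and> A \<subseteq> V) \<and> (openin (ktop Y) B \<and> B \<subseteq> V) \<and>
      (\<Sum>j<m. f j x * g j y) \<noteq> 0 \<and> (\<forall>z\<in>A \<inter> B. (\<Sum>j<m. f j z * g j z) = 0)"
    by (rule exI[of _ "A \<inter> V"], rule exI[of _ "B \<inter> V"], rule exI[of _ m], rule exI[of _ f],
        rule exI[of _ g])
      (use AB xy V AV in auto)
qed

text \<open>The single set \<open>V\<close> serves as the finite affine cover, so that no cover of
  \<open>Y\<close> has to be intersected with \<open>V\<close>.\<close>

lemma algebraic_variety_ksubspace_open_affine:
  assumes Y: "algebraic_variety Y" and V: "openin (ktop Y) V" and aff: "kaffine (ksubspace Y V)"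
  shows "algebraic_variety (ksubspace Y V)"
proof -
  have sh: "ksheaf Y" "kseparated Y" using Y by (auto simp: algebraic_variety_def)
  have sV: "ksheaf (ksubspace Y V)" using sh by (intro ksheaf_ksubspace)
  have kV: "kpts (ksubspace Y V) = V" using V by (simp add: kpts_ksubspace openin_subset)
  show ?thesis
    unfolding algebraic_variety_def
    using sV kseparated_ksubspace_open[OF sh V] aff ksubspace_kpts[OF sV]
      openin_topspace[of "ktop (ksubspace Y V)"] kV
    by (intro conjI exI[of _ "{V}"]) simp_all
qed

section \<open>Inverse matrices and linear dependence\<close>

text \<open>Cramer's formula rather than a chosen inverse: the entries are visibly regular functions
  of the entries of \<open>A\<close> where the determinant does not vanish.\<close>

definition minv :: "'f::field mat \<Rightarrow> 'f mat" where
  "minv A = (1 / det A) \<cdot>\<^sub>m adj_mat A"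

lemma minv_carrier [simp]: "A \<in> carrier_mat n n \<Longrightarrow> minv A \<in> carrier_mat n n"
  by (simp add: minv_def adj_mat)

lemma
  assumes A: "A \<in> carrier_mat n n" and d: "det A \<noteq> 0"
  shows minv_right: "A * minv A = 1\<^sub>m n" and minv_left: "minv A * A = 1\<^sub>m n"
proof -
  have "(1 / det A) \<cdot>\<^sub>m (det A \<cdot>\<^sub>m 1\<^sub>m n) = 1\<^sub>m n" using d by (intro eq_matI) auto
  then show "A * minv A = 1\<^sub>m n" "minv A * A = 1\<^sub>m n"
    unfolding minv_def
    using adj_mat[OF A] mult_smult_distrib[OF A adj_mat(1)[OF A]]
      mult_smult_assoc_mat[OF adj_mat(1)[OF A] A] by simp_all
qed

lemma det_neq_0_right_inverse:
  fixes A :: "'f::field mat"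
  assumes A: "A \<in> carrier_mat n n" and B: "B \<in> carrier_mat n n" and AB: "A * B = 1\<^sub>m n"
  shows "det A \<noteq> 0" "det B \<noteq> 0"
  using det_mult[OF A B] by (auto simp: AB)

lemma minv_unique:
  assumes A: "A \<in> carrier_mat n n" and B: "B \<in> carrier_mat n n" and AB: "A * B = 1\<^sub>m n"
  shows "B = minv A"
proof -
  have d: "det A \<noteq> 0" using det_neq_0_right_inverse[OF assms] by simp
  have "B = (minv A * A) * B" using B by (simp add: minv_left[OF A d])
  also have "\<dots> = minv A * (A * B)" using assoc_mult_mat[OF minv_carrier[OF A] A B] .
  also have "\<dots> = minv A" using minv_carrier[OF A] by (simp add: AB)
  finally show ?thesis .
qed

lemma minv_one [simp]: "minv (1\<^sub>m n) = (1\<^sub>m n :: 'f::field mat)"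
  by (rule minv_unique[symmetric, of _ n]) auto

lemma det_minv: "A \<in> carrier_mat n n \<Longrightarrow> det A \<noteq> 0 \<Longrightarrow> det (minv A) \<noteq> 0"
  using det_neq_0_right_inverse(2)[of A n "minv A"] minv_right minv_carrier by blast

lemma minv_minv: "A \<in> carrier_mat n n \<Longrightarrow> det A \<noteq> 0 \<Longrightarrow> minv (minv A) = A"
  using minv_unique[of "minv A" n A] minv_left minv_carrier by metis

lemma minv_mult:
  assumes A: "A \<in> carrier_mat n n" and B: "B \<in> carrier_mat n n" and d: "det A \<noteq> 0" "det B \<noteq> 0"
  shows "minv (A * B) = minv B * minv A"
proof -
  note cs = minv_carrier[OF A] minv_carrier[OF B]
  have "(A * B) * (minv B * minv A) = A * ((B * minv B) * minv A)"
    using A B cs by (simp add: assoc_mult_mat[of _ n n _ n _ n] mult_carrier_mat[of _ n n _ n])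
  also have "\<dots> = 1\<^sub>m n" using A left_mult_one_mat[OF cs(1)] by (simp add: minv_right[OF A d(1)] minv_right[OF B d(2)])
  finally show ?thesis
    by (intro minv_unique[symmetric, of _ n] mult_carrier_mat[OF A B] mult_carrier_mat[OF cs(2,1)])
qed

lemma invertible_mat_iff_det:
  fixes A :: "'f::field mat"
  assumes A: "A \<in> carrier_mat n n"
  shows "invertible_mat A \<longleftrightarrow> det A \<noteq> 0"
proof
  assume "invertible_mat A"
  then obtain B where AB: "A * B = 1\<^sub>m n" and BA: "B * A = 1\<^sub>m (dim_row B)"
    using A by (auto simp: invertible_mat_def inverts_mat_def)
  have "dim_col B = n" using arg_cong[OF AB, of dim_col] by simp
  moreover have "dim_row B = n" using arg_cong[OF BA, of dim_col] A by simp
  ultimately have "B \<in> carrier_mat n n" by auto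
  then show "det A \<noteq> 0" using det_neq_0_right_inverse[OF A _ AB] by blast
next
  assume d: "det A \<noteq> 0"
  have "inverts_mat A (minv A)" "inverts_mat (minv A) A"
    using A minv_right[OF A d] minv_left[OF A d] carrier_matD(1)[OF minv_carrier[OF A]]
    by (auto simp: inverts_mat_def)
  then show "invertible_mat A" using A unfolding invertible_mat_def by auto
qed

text \<open>Translates \<open>mat_inverse\<close>, in terms of which the group action is defined,
  into Cramer's formula.\<close>

lemma the_mat_inverse:
  assumes A: "A \<in> carrier_mat n n" and d: "det A \<noteq> 0"
  shows "the (mat_inverse A) = minv A"
proof -
  have "A \<in> Units (ring_mat TYPE('a) n ())"
    using A minv_carrier[OF A] minv_left[OF A d] minv_right[OF A d]
    unfolding Units_def ring_mat_def by auto
  then obtain B where B: "mat_inverse A = Some B"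
    using mat_inverse(1)[OF A, where b="()"] by (cases "mat_inverse A") auto
  show ?thesis using mat_inverse(2)[OF A B] minv_unique[OF A, of B] B by simp
qed

lemma mat_index_mult:
  assumes "A \<in> carrier_mat m n" "B \<in> carrier_mat n p" "i < m" "j < p"
  shows "(A * B) $$ (i, j) = (\<Sum>l<n. A $$ (i, l) * B $$ (l, j))"
  using assms by (auto simp: scalar_prod_def atLeast0LessThan)

section \<open>Regularity of determinants and inverse matrices\<close>

lemma kfun_det:
  assumes A: "\<And>x. x \<in> P \<Longrightarrow> A x \<in> carrier_mat n n"
    and C: "\<And>i j. i < n \<Longrightarrow> j < n \<Longrightarrow> kfun P C (\<lambda>x. A x $$ (i, j))"
  shows "kfun P C (\<lambda>x. det (A x))"
proof -
  have "kfun P C (\<lambda>x. \<Sum>p\<in>{p. p permutes {0..<n}}. signof p * (\<Prod>i=0..<n. A x $$ (i, p i)))"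
  proof (intro kfun_sum kfun_mult kfun_prod C)
    fix p :: "nat \<Rightarrow> nat"
    \<comment> \<open>Constants of regular functions have to come from the ground field, and the
      sign of a permutation does.\<close>
    have "kfun P C (\<lambda>x. to_ac (signof p))" by (rule kfun_const)
    then show "kfun P C (\<lambda>x. signof p)" by simp
  qed (use permutes_in_image in fastforce)+
  then show ?thesis by (subst kfun_cong[OF det_def'[OF A]])
qed

lemma kfun_minv:
  assumes A: "\<And>x. x \<in> P \<Longrightarrow> A x \<in> carrier_mat n n"
    and d: "\<And>x. x \<in> P \<Longrightarrow> det (A x) \<noteq> 0"
    and C: "\<And>i j. i < n \<Longrightarrow> j < n \<Longrightarrow> kfun P C (\<lambda>x. A x $$ (i, j))"
    and ij: "i < n" "j < n"
  shows "kfun P C (\<lambda>x. minv (A x) $$ (i, j))"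
proof -
  have del: "mat_delete (A x) j i \<in> carrier_mat (n - 1) (n - 1)" if "x \<in> P" for x
    using mat_delete_carrier[OF A[OF that]] .
  have "kfun P C (\<lambda>x. mat_delete (A x) j i $$ (a, b))" if "a < n - 1" "b < n - 1" for a b
  proof -
    have "mat_delete (A x) j i $$ (a, b) =
        A x $$ (if a < j then a else Suc a, if b < i then b else Suc b)" if "x \<in> P" for x
      using A[OF that] \<open>a < n - 1\<close> \<open>b < n - 1\<close> by (auto simp: mat_delete_def)
    moreover have "kfun P C (\<lambda>x. A x $$ (if a < j then a else Suc a, if b < i then b else Suc b))"
      using that by (intro C) auto
    ultimately show ?thesis by (subst kfun_cong)
  qed
  \<comment> \<open>The sign of the cofactor is written as a product of \<open>j + i\<close> factors
    -1, so that closure under products covers it.\<close>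
  then have "kfun P C (\<lambda>x. 1 / det (A x) * ((\<Prod>k<j+i. - 1) * det (mat_delete (A x) j i)))"
    using kfun_uminus[OF kfun_1]
    by (intro kfun_mult kfun_inverse kfun_prod kfun_det[OF A] kfun_det[OF del] C d) auto
  moreover have "minv (A x) $$ (i, j) = 1 / det (A x) * ((\<Prod>k<j+i. - 1) * det (mat_delete (A x) j i))"
    if "x \<in> P" for x
    using A[OF that] ij by (auto simp: minv_def adj_mat_def cofactor_def)
  ultimately show ?thesis by (subst kfun_cong)
qed

lemma kfun_mat_mult:
  assumes A: "\<And>x. x \<in> P \<Longrightarrow> A x \<in> carrier_mat m n" and B: "\<And>x. x \<in> P \<Longrightarrow> B x \<in> carrier_mat n p"
    and CA: "\<And>i j. i < m \<Longrightarrow> j < n \<Longrightarrow> kfun P C (\<lambda>x. A x $$ (i, j))"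
    and CB: "\<And>i j. i < n \<Longrightarrow> j < p \<Longrightarrow> kfun P C (\<lambda>x. B x $$ (i, j))"
    and ij: "i < m" "j < p"
  shows "kfun P C (\<lambda>x. (A x * B x) $$ (i, j))"
proof -
  have "kfun P C (\<lambda>x. \<Sum>l<n. A x $$ (i, l) * B x $$ (l, j))"
    using ij by (intro kfun_sum kfun_mult CA CB) auto
  then show ?thesis by (subst kfun_cong[OF mat_index_mult[OF A B ij]])
qed

text \<open>The \<open>n\<close> equations in \<open>m\<close> unknowns are padded by zero rows to a
  square matrix. Row \<open>n\<close> is one of the zero rows, so expansion along it shows that the
  determinant vanishes.\<close>

lemma exists_null_combination_nat:
  fixes R :: "nat \<Rightarrow> nat \<Rightarrow> 'f::field"
  assumes "n < m"
  shows "\<exists>c. (\<exists>i<m. c i \<noteq> 0) \<and> (\<forall>j<n. (\<Sum>i<m. c i * R i j) = 0)"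
proof -
  define A where "A = mat m m (\<lambda>(j, i). if j < n then R i j else 0)"
  have A: "A \<in> carrier_mat m m" by (simp add: A_def)
  have "det A = (\<Sum>i<m. A $$ (n, i) * cofactor A n i)"
    by (rule laplace_expansion_row[OF A assms])
  also have "\<dots> = 0" using assms by (intro sum.neutral) (auto simp: A_def)
  finally have "det A = 0" .
  then obtain v where v: "v \<in> carrier_vec m" "v \<noteq> 0\<^sub>v m" "A *\<^sub>v v = 0\<^sub>v m"
    using det_0_iff_vec_prod_zero_field[OF A] by auto
  have "\<exists>i<m. v $ i \<noteq> 0"
  proof (rule ccontr)
    assume "\<not> ?thesis"
    then have "v = 0\<^sub>v m" using v(1) by (intro eq_vecI) auto
    then show False using v(2) by simp
  qed
  moreover have "(\<Sum>i<m. v $ i * R i j) = 0" if "j < n" for j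
  proof -
    have "(A *\<^sub>v v) $ j = (\<Sum>i<m. v $ i * R i j)"
      using that assms v(1) by (auto simp: A_def scalar_prod_def atLeast0LessThan mult.commute)
    then show ?thesis using v(3) that assms by simp
  qed
  ultimately show ?thesis by blast
qed

lemma exists_null_combination:
  fixes R :: "'a \<Rightarrow> 'b \<Rightarrow> 'f::field"
  assumes "finite A" "finite B" "card B < card A"
  shows "\<exists>c. (\<exists>a\<in>A. c a \<noteq> 0) \<and> (\<forall>b\<in>B. (\<Sum>a\<in>A. c a * R a b) = 0)"
proof -
  obtain e where e: "bij_betw e {..<card A} A"
    using ex_bij_betw_nat_finite[OF assms(1)] by (auto simp: atLeast0LessThan)
  obtain f where f: "bij_betw f {..<card B} B"
    using ex_bij_betw_nat_finite[OF assms(2)] by (auto simp: atLeast0LessThan)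
  obtain c where c: "\<exists>i<card A. c i \<noteq> 0" "\<And>j. j < card B \<Longrightarrow> (\<Sum>i<card A. c i * R (e i) (f j)) = 0"
    using exists_null_combination_nat[OF assms(3), of "\<lambda>i j. R (e i) (f j)"] by blast
  define d where "d = c \<circ> inv_into {..<card A} e"
  have d: "d (e i) = c i" if "i < card A" for i
    using that bij_betw_imp_inj_on[OF e] by (simp add: d_def)
  have "\<exists>a\<in>A. d a \<noteq> 0"
    using c(1) d bij_betwE[OF e] by (metis lessThan_iff)
  moreover have "(\<Sum>a\<in>A. d a * R a b) = 0" if b: "b \<in> B" for b
  proof -
    obtain j where j: "j < card B" "b = f j"
      using b f by (auto simp: bij_betw_def)
    have "(\<Sum>a\<in>A. d a * R a b) = (\<Sum>i<card A. d (e i) * R (e i) b)"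
      using sum.reindex_bij_betw[OF e, of "\<lambda>a. d a * R a b"] by simp
    also have "\<dots> = 0" using c(2)[OF j(1)] d j(2) by simp
    finally show ?thesis .
  qed
  ultimately show ?thesis by blast
qed

unbundle no fps_syntax

lemma subspace_module_vec_iff:
  "VectorSpace.subspace class_ring W (module_vec TYPE('f::field) n) \<longleftrightarrow>
     W \<subseteq> carrier_vec n \<and> 0\<^sub>v n \<in> W \<and> (\<forall>v\<in>W. \<forall>w\<in>W. v + w \<in> W) \<and> (\<forall>c. \<forall>v\<in>W. c \<cdot>\<^sub>v v \<in> W)"
  using vec_vs[of n, where 'a='f] vec_module[of n, where 'a='f]
  by (auto simp: VectorSpace.subspace_def submodule_def module_vec_simps class_ring_simps)

section \<open>Paths and stability\<close>

type_synonym ('v, 'a, 'f) frame_fun = "'v \<Rightarrow> nat \<Rightarrow> ('v, 'a) ext_path \<Rightarrow> 'f"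

locale framed_quiver =
  fixes Q :: "('v, 'a) pre_digraph" and \<alpha> \<zeta> :: "'v \<Rightarrow> nat"
  assumes fin_digraph: "fin_digraph Q"
begin

abbreviation reps :: "('v, 'a, 'f::field) framed_rep set" where
  "reps \<equiv> framed_reps Q \<alpha> \<zeta>"

abbreviation stables :: "('v, 'a, 'f::field) framed_rep set" where
  "stables \<equiv> stable_pairs Q \<alpha> \<zeta>"

abbreviation cell :: "('v, 'a) ext_path set \<Rightarrow> ('v, 'a, 'f::field) framed_rep set" where
  "cell \<equiv> stable_with_skeleton Q \<alpha> \<zeta>"

abbreviation coords :: "(('v, 'a, 'k::field alg_closure) framed_rep \<Rightarrow> 'k alg_closure) set" where
  "coords \<equiv> Rep_coords Q \<alpha> \<zeta>"

lemma finite_quiver [simp]: "finite (verts Q)" "finite (arcs Q)"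
  using fin_digraph by (auto simp: fin_digraph_def fin_digraph_axioms_def)

lemma arc_ends [simp]: "a \<in> arcs Q \<Longrightarrow> tail Q a \<in> verts Q" "a \<in> arcs Q \<Longrightarrow> head Q a \<in> verts Q"
  using fin_digraph by (auto simp: fin_digraph_def wf_digraph_def)

section \<open>Paths of nonzero length ending in infinity\<close>

definition npaths :: "('v, 'a) ext_path set" where
  "npaths = {\<pi> \<in> inf_paths Q \<zeta>. snd \<pi> \<noteq> []}"

lemma inf_paths_Nil: "(u, []) \<in> inf_paths Q \<zeta> \<longleftrightarrow> u = None"
  by (auto simp: inf_paths_def pre_digraph.awalk_def pre_digraph.cas.simps ext_quiver_def)

lemma inf_paths_None: "(None, p) \<in> inf_paths Q \<zeta> \<longleftrightarrow> p = []"
  by (cases p) (auto simp: inf_paths_def pre_digraph.awalk_def pre_digraph.cas.simps ext_quiver_def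
      split: sum.splits)

lemma head_ext_verts: "b \<in> arcs (ext_quiver Q \<zeta>) \<Longrightarrow> head (ext_quiver Q \<zeta>) b \<in> verts (ext_quiver Q \<zeta>)"
  by (auto simp: ext_quiver_def)

lemma inf_paths_Cons:
  "(u, b # p) \<in> inf_paths Q \<zeta> \<longleftrightarrow> b \<in> arcs (ext_quiver Q \<zeta>) \<and> u = tail (ext_quiver Q \<zeta>) b \<and>
     (head (ext_quiver Q \<zeta>) b, p) \<in> inf_paths Q \<zeta>"
proof -
  have "tail (ext_quiver Q \<zeta>) b \<in> verts (ext_quiver Q \<zeta>)" if "b \<in> arcs (ext_quiver Q \<zeta>)"
    using that by (auto simp: ext_quiver_def)
  then show ?thesis
    using head_ext_verts[of b]
    by (auto simp: inf_paths_def pre_digraph.awalk_def pre_digraph.cas.simps)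
qed

lemma inf_paths_eq: "inf_paths Q \<zeta> = insert e_inf npaths"
proof -
  have "\<pi> \<in> inf_paths Q \<zeta> \<longleftrightarrow> \<pi> = e_inf \<or> \<pi> \<in> npaths" for \<pi>
  proof (cases \<pi>)
    case (Pair u p)
    then show ?thesis by (cases p) (simp_all add: npaths_def e_inf_def inf_paths_Nil)
  qed
  then show ?thesis by blast
qed

lemma e_inf_notin_npaths [simp]: "e_inf \<notin> npaths"
  by (simp add: npaths_def e_inf_def)

lemma npaths_Inr:
  "(u, Inr (i, q) # p) \<in> npaths \<longleftrightarrow> i \<in> verts Q \<and> q < \<zeta> i \<and> u = Some i \<and> p = []"
  by (auto simp: npaths_def inf_paths_Cons inf_paths_None ext_quiver_def)

lemma npaths_Inl:
  "(u, Inl a # p) \<in> npaths \<longleftrightarrow> a \<in> arcs Q \<and> u = Some (tail Q a) \<and> (Some (head Q a), p) \<in> npaths"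
  using inf_paths_Nil[of "Some (head Q a)"]
  by (auto simp: npaths_def inf_paths_Cons ext_quiver_def)

lemma npaths_Nil [simp]: "(u, []) \<notin> npaths"
  by (simp add: npaths_def)

text \<open>No arrow leaves the vertex at infinity, so a path of nonzero length to it uses exactly
  one framing arrow, as its last step, and arrows of \<open>Q\<close> before.\<close>

lemma npaths_induct [consumes 1, case_names frame arc]:
  assumes "\<pi> \<in> npaths"
    and "\<And>i q. i \<in> verts Q \<Longrightarrow> q < \<zeta> i \<Longrightarrow> P (Some i, [Inr (i, q)])"
    and "\<And>a p. a \<in> arcs Q \<Longrightarrow> (Some (head Q a), p) \<in> npaths \<Longrightarrow> P (Some (head Q a), p) \<Longrightarrow>
           P (Some (tail Q a), Inl a # p)"
  shows "P \<pi>"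
proof -
  have "(u, p) \<in> npaths \<Longrightarrow> P (u, p)" for u p
  proof (induction p arbitrary: u)
    case (Cons b p)
    show ?case
    proof (cases b)
      case (Inl a)
      then show ?thesis using Cons assms(3) by (auto simp: npaths_Inl)
    next
      case (Inr iq)
      then show ?thesis using Cons assms(2) by (cases iq) (auto simp: npaths_Inr)
    qed
  qed simp
  then show ?thesis using assms(1) by (cases \<pi>) auto
qed

lemma npaths_vert:
  assumes "\<pi> \<in> npaths"
  obtains i where "i \<in> verts Q" "fst \<pi> = Some i"
proof -
  have "\<exists>i\<in>verts Q. fst \<pi> = Some i" using assms by (induction rule: npaths_induct) auto
  then show thesis using that by blast
qed

section \<open>Rows of paths and the map to J\<close>

definition path_row :: "('v, 'a, 'f::field) framed_rep \<Rightarrow> ('v, 'a) ext_path \<Rightarrow> nat \<Rightarrow> 'f" where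
  "path_row Mf \<pi> j = path_mat Q \<alpha> \<zeta> Mf (fst \<pi>) (snd \<pi>) $$ (0, j)"

lemma framed_reps_fst: "Mf \<in> reps \<Longrightarrow> a \<in> arcs Q \<Longrightarrow>
    fst Mf a \<in> carrier_mat (\<alpha> (head Q a)) (\<alpha> (tail Q a))"
  and framed_reps_snd: "Mf \<in> reps \<Longrightarrow> i \<in> verts Q \<Longrightarrow>
    snd Mf i \<in> carrier_mat (\<zeta> i) (\<alpha> i)"
  by (auto simp: framed_reps_def)

lemma ext_mat_Inl [simp]: "ext_mat Mf (Inl a) = fst Mf a"
  and ext_mat_Inr [simp]: "ext_mat Mf (Inr (i, q)) = mat_of_row (row (snd Mf i) q)"
  by (simp_all add: ext_mat_def)

lemma ext_mat_carrier:
  assumes "Mf \<in> reps" "b \<in> arcs (ext_quiver Q \<zeta>)"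
  shows "ext_mat Mf b \<in> carrier_mat (ext_dim \<alpha> (head (ext_quiver Q \<zeta>) b)) (ext_dim \<alpha> (tail (ext_quiver Q \<zeta>) b))"
  using assms framed_reps_fst[of Mf] framed_reps_snd[of Mf]
  by (auto simp: ext_quiver_def ext_dim_def carrier_matD)

lemma path_mat_carrier:
  assumes "Mf \<in> reps" "(u, p) \<in> inf_paths Q \<zeta>"
  shows "path_mat Q \<alpha> \<zeta> Mf u p \<in> carrier_mat 1 (ext_dim \<alpha> u)"
  using assms(2)
proof (induction p arbitrary: u)
  case Nil
  then show ?case by (simp add: inf_paths_Nil ext_dim_def)
next
  case (Cons b p)
  then have b: "b \<in> arcs (ext_quiver Q \<zeta>)" "u = tail (ext_quiver Q \<zeta>) b"
    "(head (ext_quiver Q \<zeta>) b, p) \<in> inf_paths Q \<zeta>" by (auto simp: inf_paths_Cons)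
  show ?case
    using mult_carrier_mat[OF Cons.IH[OF b(3)] ext_mat_carrier[OF assms(1) b(1)]] b(2) by simp
qed

lemma path_row_frame:
  assumes "Mf \<in> reps" "i \<in> verts Q" "q < \<zeta> i" "j < \<alpha> i"
  shows "path_row Mf (Some i, [Inr (i, q)]) j = snd Mf i $$ (q, j)"
proof -
  have "mat_of_row (row (snd Mf i) q) \<in> carrier_mat 1 (\<alpha> i)"
    using framed_reps_snd[OF assms(1,2)] by auto
  moreover have "row (snd Mf i) q $ j = snd Mf i $$ (q, j)"
    using framed_reps_snd[OF assms(1,2)] assms(3,4) by auto
  moreover have "mat_of_row (row (snd Mf i) q) $$ (0, j) = row (snd Mf i) q $ j"
    using framed_reps_snd[OF assms(1,2)] assms(4) by (simp add: mat_of_row_def)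
  ultimately show ?thesis by (simp add: path_row_def ext_quiver_def ext_dim_def)
qed

lemma path_row_arc:
  assumes "Mf \<in> reps" "a \<in> arcs Q" "(Some (head Q a), p) \<in> npaths" "j < \<alpha> (tail Q a)"
  shows "path_row Mf (Some (tail Q a), Inl a # p) j =
    (\<Sum>l<\<alpha> (head Q a). path_row Mf (Some (head Q a), p) l * fst Mf a $$ (l, j))"
proof -
  have "path_mat Q \<alpha> \<zeta> Mf (Some (head Q a)) p \<in> carrier_mat 1 (\<alpha> (head Q a))"
    using path_mat_carrier[OF assms(1), of "Some (head Q a)" p] assms(3) by (simp add: npaths_def ext_dim_def)
  from mat_index_mult[OF this framed_reps_fst[OF assms(1,2)], of 0 j] assms(4)
  show ?thesis by (simp add: path_row_def ext_quiver_def)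
qed

text \<open>
  Paths in \<open>npaths\<close> start in \<open>Q\<close>, so \<open>the (fst \<pi>)\<close> is never applied to \<open>None\<close>.
\<close>

definition Psi :: "('v, 'a, 'f::field) framed_rep \<Rightarrow> ('v \<Rightarrow> nat \<Rightarrow> 'f) \<Rightarrow> 'f \<Rightarrow> ('v, 'a) ext_path \<Rightarrow> 'f" where
  "Psi Mf y z \<pi> = (if \<pi> \<in> npaths then (\<Sum>j<\<alpha> (the (fst \<pi>)). path_row Mf \<pi> j * y (the (fst \<pi>)) j)
     else if \<pi> = e_inf then z else 0)"

lemma ext_space_carrier:
  assumes "x \<in> ext_space Q \<alpha> \<zeta>"
  shows "x None \<in> carrier_vec 1" "i \<in> verts Q \<Longrightarrow> x (Some i) \<in> carrier_vec (\<alpha> i)"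
  using PiE_mem[OF assms[unfolded ext_space_def], of None]
    PiE_mem[OF assms[unfolded ext_space_def], of "Some i"]
  by (auto simp: ext_quiver_def ext_dim_def)

lemma Phi_eq_Psi:
  assumes Mf: "Mf \<in> reps" and x: "x \<in> ext_space Q \<alpha> \<zeta>"
  shows "Phi Q \<alpha> \<zeta> Mf x = Psi Mf (\<lambda>i j. x (Some i) $ j) (x None $ 0)"
proof
  fix \<pi> :: "('v, 'a) ext_path"
  obtain u p where \<pi>: "\<pi> = (u, p)" by (cases \<pi>)
  consider "\<pi> \<in> npaths" | "\<pi> = e_inf" | "\<pi> \<notin> inf_paths Q \<zeta>" "\<pi> \<notin> npaths" "\<pi> \<noteq> e_inf"
    using inf_paths_eq by blast
  then show "Phi Q \<alpha> \<zeta> Mf x \<pi> = Psi Mf (\<lambda>i j. x (Some i) $ j) (x None $ 0) \<pi>"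
  proof cases
    case 1
    then obtain i where i: "i \<in> verts Q" "u = Some i" using \<pi> by (auto elim: npaths_vert)
    have in_inf: "(u, p) \<in> inf_paths Q \<zeta>" using 1 \<pi> by (simp add: npaths_def)
    have "x u \<in> carrier_vec (\<alpha> i)" using ext_space_carrier(2)[OF x i(1)] i(2) by simp
    moreover have "path_mat Q \<alpha> \<zeta> Mf u p \<in> carrier_mat 1 (\<alpha> i)"
      using path_mat_carrier[OF Mf in_inf] i by (simp add: ext_dim_def)
    ultimately have "(path_mat Q \<alpha> \<zeta> Mf u p *\<^sub>v x u) $ 0 = (\<Sum>j<\<alpha> i. path_row Mf \<pi> j * x u $ j)"
      by (auto simp: scalar_prod_def path_row_def \<pi> atLeast0LessThan intro!: sum.cong)
    then show ?thesis using 1 in_inf i by (simp add: Phi_def Psi_def \<pi>)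
  next
    case 2
    have "x None \<in> carrier_vec 1" using ext_space_carrier(1)[OF x] .
    then show ?thesis using 2 inf_paths_Nil[of None]
      by (simp add: Phi_def Psi_def e_inf_def ext_dim_def)
  next
    case 3
    then show ?thesis by (simp add: Phi_def Psi_def \<pi>)
  qed
qed

text \<open>Removes the carrier conditions: \<open>Psi\<close> reads \<open>y\<close> only at
  indices below the dimensions, so arbitrary functions \<open>y\<close> and scalars \<open>z\<close>
  describe the same subspace.\<close>

lemma Phi_image:
  assumes Mf: "Mf \<in> reps"
  shows "Phi Q \<alpha> \<zeta> Mf ` ext_space Q \<alpha> \<zeta> = {Psi Mf y z | y z. True}"
proof (intro equalityI subsetI)
  fix \<xi> assume "\<xi> \<in> Phi Q \<alpha> \<zeta> Mf ` ext_space Q \<alpha> \<zeta>"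
  then show "\<xi> \<in> {Psi Mf y z | y z. True}" using Phi_eq_Psi[OF Mf] by auto
next
  fix \<xi> assume "\<xi> \<in> {Psi Mf y z | y z. True}"
  then obtain y z where \<xi>: "\<xi> = Psi Mf y z" by blast
  define x where "x = (\<lambda>u\<in>verts (ext_quiver Q \<zeta>). case u of None \<Rightarrow> vec 1 (\<lambda>_. z) | Some i \<Rightarrow> vec (\<alpha> i) (y i))"
  have x: "x \<in> ext_space Q \<alpha> \<zeta>"
    by (auto simp: x_def ext_space_def ext_dim_def split: option.split)
  have "Psi Mf (\<lambda>i j. x (Some i) $ j) (x None $ 0) \<pi> = Psi Mf y z \<pi>" for \<pi>
  proof (cases "\<pi> \<in> npaths")
    case True
    then obtain i where "i \<in> verts Q" "fst \<pi> = Some i" by (rule npaths_vert)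
    then show ?thesis using True by (auto simp: Psi_def x_def ext_quiver_def)
  qed (auto simp: Psi_def x_def ext_quiver_def)
  then have "Phi Q \<alpha> \<zeta> Mf x = \<xi>" using Phi_eq_Psi[OF Mf x] \<xi> by auto
  then show "\<xi> \<in> Phi Q \<alpha> \<zeta> Mf ` ext_space Q \<alpha> \<zeta>" using x by blast
qed

lemma Psi_add: "Psi Mf (\<lambda>i j. y i j + y' i j) (z + z') \<pi> = Psi Mf y z \<pi> + Psi Mf y' z' \<pi>"
  by (simp add: Psi_def sum.distrib distrib_left)

lemma Psi_scale: "Psi Mf (\<lambda>i j. c * y i j) (c * z) \<pi> = c * Psi Mf y z \<pi>"
  by (simp add: Psi_def sum_distrib_left mult.left_commute)

lemma Psi_sum: "Psi Mf (\<lambda>i j. \<Sum>b\<in>B. c b * y b i j) (\<Sum>b\<in>B. c b * z b) \<pi> = (\<Sum>b\<in>B. c b * Psi Mf (y b) (z b) \<pi>)"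
proof (induction B rule: infinite_finite_induct)
  case (insert b B)
  then show ?case using Psi_add[of Mf "\<lambda>i j. c b * y b i j"] Psi_scale[of Mf "c b"] by simp
qed (simp_all add: Psi_def)

text \<open>The dual form of the rows in \<open>A\<close> spanning at each vertex. For all of
  \<open>npaths\<close> it is stability; for a skeleton it is invertibility of the minors.\<close>

definition row_injective :: "('v, 'a, 'f::field) framed_rep \<Rightarrow> ('v, 'a) ext_path set \<Rightarrow> bool" where
  "row_injective Mf A \<longleftrightarrow> (\<forall>i\<in>verts Q. \<forall>y.
     (\<forall>\<pi>\<in>A. fst \<pi> = Some i \<longrightarrow> (\<Sum>j<\<alpha> i. path_row Mf \<pi> j * y j) = 0) \<longrightarrow> (\<forall>j<\<alpha> i. y j = 0))"

lemma row_injectiveD: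
  assumes "row_injective Mf A" "i \<in> verts Q"
    "\<And>\<pi>. \<pi> \<in> A \<Longrightarrow> fst \<pi> = Some i \<Longrightarrow> (\<Sum>j<\<alpha> i. path_row Mf \<pi> j * y j) = 0" "j < \<alpha> i"
  shows "y j = 0"
  using assms unfolding row_injective_def by blast

lemma row_injective_mono: "row_injective Mf A \<Longrightarrow> A \<subseteq> B \<Longrightarrow> row_injective Mf B"
  unfolding row_injective_def by blast

text \<open>Adjunction: \<open>\<tau> a\<close> evaluates \<open>y\<close> as \<tau> evaluates
  \<open>M_a y\<close>. This carries the inductions over paths in the stability criterion and in the
  existence of skeleta.\<close>

lemma path_row_mult_vec_arc:
  assumes "Mf \<in> reps" "a \<in> arcs Q" "(Some (head Q a), p) \<in> npaths"
  shows "(\<Sum>j<\<alpha> (tail Q a). path_row Mf (Some (tail Q a), Inl a # p) j * y j) =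
    (\<Sum>l<\<alpha> (head Q a). path_row Mf (Some (head Q a), p) l * (\<Sum>j<\<alpha> (tail Q a). fst Mf a $$ (l, j) * y j))"
proof -
  have "(\<Sum>j<\<alpha> (tail Q a). path_row Mf (Some (tail Q a), Inl a # p) j * y j) =
    (\<Sum>j<\<alpha> (tail Q a). \<Sum>l<\<alpha> (head Q a). path_row Mf (Some (head Q a), p) l * fst Mf a $$ (l, j) * y j)"
    using path_row_arc[OF assms] by (simp add: sum_distrib_right)
  also have "\<dots> = (\<Sum>l<\<alpha> (head Q a). \<Sum>j<\<alpha> (tail Q a). path_row Mf (Some (head Q a), p) l * fst Mf a $$ (l, j) * y j)"
    by (rule sum.swap)
  finally show ?thesis by (simp add: sum_distrib_left mult.assoc)
qed

section \<open>Stability in terms of rows\<close>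

lemma mat_mult_vec_index:
  assumes "A \<in> carrier_mat m n" "x \<in> carrier_vec n" "l < m"
  shows "(A *\<^sub>v x) $ l = (\<Sum>j<n. A $$ (l, j) * x $ j)"
  using assms by (auto simp: scalar_prod_def atLeast0LessThan)

lemma stable_pairs_alt:
  "Mf \<in> stables \<longleftrightarrow> Mf \<in> reps \<and>
     (\<forall>N. subrepresentation Q \<alpha> (fst Mf) N \<longrightarrow> (\<forall>i\<in>verts Q. N i \<subseteq> mat_kernel (snd Mf i)) \<longrightarrow>
        (\<forall>i\<in>verts Q. N i = {0\<^sub>v (\<alpha> i)}))"
  unfolding stable_pairs_def by (cases Mf) (simp, blast)

text \<open>The common zeros of the rows of all paths form the largest subrepresentation contained
  in the kernels of the framing maps: they are such a subrepresentation, and any other one is killed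
  by every path, by induction on the path.\<close>

lemma stable_pairs_iff:
  fixes Mf :: "('v, 'a, 'f::field) framed_rep"
  shows "Mf \<in> stables \<longleftrightarrow> Mf \<in> reps \<and> row_injective Mf npaths"
proof (intro iffI conjI)
  assume st: "Mf \<in> stables"
  then show Mf: "Mf \<in> reps" by (auto simp: stable_pairs_def)
  define N where "N i = {x \<in> carrier_vec (\<alpha> i). \<forall>\<pi>\<in>npaths. fst \<pi> = Some i \<longrightarrow> (\<Sum>j<\<alpha> i. path_row Mf \<pi> j * x $ j) = 0}" for i
  have "subrepresentation Q \<alpha> (fst Mf) N"
    unfolding subrepresentation_def subspace_module_vec_iff
  proof (intro conjI ballI allI)
    fix a x assume a: "a \<in> arcs Q" and x: "x \<in> N (tail Q a)"
    then have xc: "x \<in> carrier_vec (\<alpha> (tail Q a))" by (simp add: N_def)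
    note M = framed_reps_fst[OF Mf a]
    have "(\<Sum>l<\<alpha> (head Q a). path_row Mf \<pi> l * (fst Mf a *\<^sub>v x) $ l) = 0"
      if \<pi>: "\<pi> \<in> npaths" "fst \<pi> = Some (head Q a)" for \<pi>
    proof -
      obtain p where p: "\<pi> = (Some (head Q a), p)" using \<pi>(2) by (cases \<pi>) auto
      have "(Some (tail Q a), Inl a # p) \<in> npaths" using a \<pi> p by (simp add: npaths_Inl)
      then have "(\<Sum>j<\<alpha> (tail Q a). path_row Mf (Some (tail Q a), Inl a # p) j * x $ j) = 0"
        using x by (simp add: N_def)
      then show ?thesis
        using path_row_mult_vec_arc[OF Mf a, of p "\<lambda>j. x $ j"] \<pi> p mat_mult_vec_index[OF M xc] by simp
    qed
    then show "fst Mf a *\<^sub>v x \<in> N (head Q a)" using M xc by (auto simp: N_def)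
  next
    fix i show "0\<^sub>v (\<alpha> i) \<in> N i" by (simp add: N_def)
    fix v assume v: "v \<in> N i"
    show "c \<cdot>\<^sub>v v \<in> N i" for c
    proof -
      have "(\<Sum>j<\<alpha> i. path_row Mf \<pi> j * (c \<cdot>\<^sub>v v) $ j) = c * (\<Sum>j<\<alpha> i. path_row Mf \<pi> j * v $ j)" for \<pi>
        using v unfolding sum_distrib_left by (intro sum.cong refl) (auto simp: N_def)
      then show ?thesis using v by (auto simp: N_def)
    qed
    fix w assume w: "w \<in> N i"
    have "(\<Sum>j<\<alpha> i. path_row Mf \<pi> j * (v + w) $ j) = (\<Sum>j<\<alpha> i. path_row Mf \<pi> j * v $ j) + (\<Sum>j<\<alpha> i. path_row Mf \<pi> j * w $ j)" for \<pi>
    proof -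
      have "(\<Sum>j<\<alpha> i. path_row Mf \<pi> j * (v + w) $ j) = (\<Sum>j<\<alpha> i. path_row Mf \<pi> j * v $ j + path_row Mf \<pi> j * w $ j)"
        using v w by (intro sum.cong refl) (auto simp: N_def distrib_left)
      then show ?thesis by (simp add: sum.distrib)
    qed
    then show "v + w \<in> N i" using v w by (auto simp: N_def)
  qed (auto simp: N_def)
  moreover have "N i \<subseteq> mat_kernel (snd Mf i)" if i: "i \<in> verts Q" for i
  proof
    fix x assume x: "x \<in> N i"
    note f = framed_reps_snd[OF Mf i]
    have xc: "x \<in> carrier_vec (\<alpha> i)" using x by (simp add: N_def)
    have "(snd Mf i *\<^sub>v x) $ q = 0" if q: "q < \<zeta> i" for q
    proof -
      have "(Some i, [Inr (i, q)]) \<in> npaths" using i q by (simp add: npaths_Inr)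
      then have "(\<Sum>j<\<alpha> i. path_row Mf (Some i, [Inr (i, q)]) j * x $ j) = 0" using x by (simp add: N_def)
      then show ?thesis using path_row_frame[OF Mf i q] mat_mult_vec_index[OF f xc q] by simp
    qed
    then have "snd Mf i *\<^sub>v x = 0\<^sub>v (\<zeta> i)" using f by (intro eq_vecI) auto
    then show "x \<in> mat_kernel (snd Mf i)" using f xc by (intro mat_kernelI) auto
  qed
  ultimately have N0: "N i = {0\<^sub>v (\<alpha> i)}" if "i \<in> verts Q" for i
    using st that unfolding stable_pairs_alt by blast
  show "row_injective Mf npaths"
    unfolding row_injective_def
  proof (intro ballI allI impI)
    fix i y j assume i: "i \<in> verts Q" and j: "j < \<alpha> i"
      and y: "\<forall>\<pi>\<in>npaths. fst \<pi> = Some i \<longrightarrow> (\<Sum>j<\<alpha> i. path_row Mf \<pi> j * y j) = 0"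
    then have "vec (\<alpha> i) y \<in> N i" by (auto simp: N_def)
    then have "vec (\<alpha> i) y = 0\<^sub>v (\<alpha> i)" using N0[OF i] by simp
    then show "y j = 0" using j by (metis index_vec index_zero_vec(1))
  qed
next
  assume A: "Mf \<in> reps \<and> row_injective Mf npaths"
  then have Mf: "Mf \<in> reps" and inj: "row_injective Mf npaths" by auto
  have "N i = {0\<^sub>v (\<alpha> i)}"
    if N: "subrepresentation Q \<alpha> (fst Mf) N" and ker: "\<forall>i\<in>verts Q. N i \<subseteq> mat_kernel (snd Mf i)"
      and i: "i \<in> verts Q" for N i
  proof -
    have sub: "N i \<subseteq> carrier_vec (\<alpha> i)" "0\<^sub>v (\<alpha> i) \<in> N i" if "i \<in> verts Q" for i
      using N that by (auto simp: subrepresentation_def subspace_module_vec_iff)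
    \<comment> \<open>The vector varies in the induction, because an arrow \<open>a\<close> replaces
      \<open>x\<close> by \<open>M_a x\<close>, which lies in \<open>N\<close> at the head of
      \<open>a\<close>.\<close>
    have van: "x \<in> N (the (fst \<pi>)) \<Longrightarrow> (\<Sum>j<\<alpha> (the (fst \<pi>)). path_row Mf \<pi> j * x $ j) = 0"
      if "\<pi> \<in> npaths" for \<pi> x
      using that
    proof (induction arbitrary: x rule: npaths_induct)
      case (frame i q)
      then have "x \<in> mat_kernel (snd Mf i)" using ker by auto
      then have x: "x \<in> carrier_vec (\<alpha> i)" "snd Mf i *\<^sub>v x = 0\<^sub>v (\<zeta> i)"
        using mat_kernelD[OF framed_reps_snd[OF Mf frame(1)]] by auto
      then have "(snd Mf i *\<^sub>v x) $ q = 0" using frame by simp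
      then show ?case
        using mat_mult_vec_index[OF framed_reps_snd[OF Mf frame(1)] x(1) frame(2)] path_row_frame[OF Mf frame(1,2)]
        by simp
    next
      case (arc a p)
      have x: "x \<in> carrier_vec (\<alpha> (tail Q a))" using sub[of "tail Q a"] arc by auto
      have "fst Mf a *\<^sub>v x \<in> N (head Q a)" using N arc by (auto simp: subrepresentation_def)
      then have "(\<Sum>l<\<alpha> (head Q a). path_row Mf (Some (head Q a), p) l * (fst Mf a *\<^sub>v x) $ l) = 0"
        using arc.IH by simp
      then show ?case
        using path_row_mult_vec_arc[OF Mf arc(1,2), of "\<lambda>j. x $ j"] mat_mult_vec_index[OF framed_reps_fst[OF Mf arc(1)] x]
        by simp
    qed
    have "x = 0\<^sub>v (\<alpha> i)" if x: "x \<in> N i" for x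
    proof -
      have "x $ j = 0" if "j < \<alpha> i" for j
        by (rule row_injectiveD[OF inj i _ that]) (use van x in force)
      then show ?thesis using sub(1)[OF i] x by (intro eq_vecI) auto
    qed
    then show ?thesis using sub(2)[OF i] by blast
  qed
  then show "Mf \<in> stables" using Mf unfolding stable_pairs_alt by blast
qed

section \<open>Skeleta\<close>

definition paths_at :: "('v, 'a) ext_path set \<Rightarrow> 'v \<Rightarrow> ('v, 'a) ext_path set" where
  "paths_at S i = {\<pi> \<in> S. fst \<pi> = Some i}"

text \<open>Only arrows of \<open>Q\<close> are stripped: a path of \<open>npaths\<close> starting
  with a framing arrow consists of that arrow alone, and stripping it leaves \<open>e_inf\<close>,
  which is exempt.\<close>

definition suffix_closed :: "('v, 'a) ext_path set \<Rightarrow> bool" where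
  "suffix_closed S \<longleftrightarrow> (\<forall>a p. (Some (tail Q a), Inl a # p) \<in> S \<longrightarrow> (Some (head Q a), p) \<in> S)"

text \<open>Mentions neither a representation nor a field; \<open>J_skeleta_eq\<close> shows that
  these are the J-skeleta over every field.\<close>

definition skel :: "('v, 'a) ext_path set \<Rightarrow> bool" where
  "skel S \<longleftrightarrow> S \<subseteq> npaths \<and> finite S \<and> suffix_closed S \<and> (\<forall>i\<in>verts Q. card (paths_at S i) = \<alpha> i)"

text \<open>The enumeration is chosen for \<open>S\<close> once, not for each pair, so that the
  minors of different pairs and frames have their rows in the same order.\<close>

definition path_nth :: "('v, 'a) ext_path set \<Rightarrow> 'v \<Rightarrow> nat \<Rightarrow> ('v, 'a) ext_path" where
  "path_nth S i = (SOME e. bij_betw e {..<card (paths_at S i)} (paths_at S i))"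

definition path_idx :: "('v, 'a) ext_path set \<Rightarrow> 'v \<Rightarrow> ('v, 'a) ext_path \<Rightarrow> nat" where
  "path_idx S i = inv_into {..<\<alpha> i} (path_nth S i)"

definition row_mat :: "('v, 'a) ext_path set \<Rightarrow> ('v, 'a, 'f::field) framed_rep \<Rightarrow> 'v \<Rightarrow> 'f mat" where
  "row_mat S Mf i = mat (\<alpha> i) (\<alpha> i) (\<lambda>(r, s). path_row Mf (path_nth S i r) s)"

lemma row_mat_carrier [simp]: "row_mat S Mf i \<in> carrier_mat (\<alpha> i) (\<alpha> i)"
  by (simp add: row_mat_def)

lemma skelD:
  assumes "skel S"
  shows "S \<subseteq> npaths" "finite S" "suffix_closed S" "i \<in> verts Q \<Longrightarrow> card (paths_at S i) = \<alpha> i"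
  using assms by (auto simp: skel_def)

lemma finite_paths_at [simp]: "finite S \<Longrightarrow> finite (paths_at S i)"
  by (simp add: paths_at_def)

lemma path_nth_bij:
  assumes "skel S" "i \<in> verts Q"
  shows "bij_betw (path_nth S i) {..<\<alpha> i} (paths_at S i)"
proof -
  have "\<exists>e. bij_betw e {..<card (paths_at S i)} (paths_at S i)"
    using ex_bij_betw_nat_finite[of "paths_at S i"] skelD(2)[OF assms(1)] by (auto simp: atLeast0LessThan)
  then show ?thesis
    unfolding path_nth_def using someI_ex skelD(4)[OF assms] by metis
qed

lemma path_nth_in:
  assumes "skel S" "i \<in> verts Q" "r < \<alpha> i"
  shows "path_nth S i r \<in> S" "fst (path_nth S i r) = Some i" "path_nth S i r \<in> npaths"
  using bij_betwE[OF path_nth_bij[OF assms(1,2)]] assms(3) skelD(1)[OF assms(1)] by (auto simp: paths_at_def)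

lemma path_idx_path_nth:
  assumes "skel S" "i \<in> verts Q" "r < \<alpha> i"
  shows "path_idx S i (path_nth S i r) = r"
  using bij_betw_imp_inj_on[OF path_nth_bij[OF assms(1,2)]] assms(3) by (simp add: path_idx_def)

lemma path_nth_inj: "skel S \<Longrightarrow> i \<in> verts Q \<Longrightarrow> r < \<alpha> i \<Longrightarrow> r' < \<alpha> i \<Longrightarrow> path_nth S i r = path_nth S i r' \<longleftrightarrow> r = r'"
  using path_idx_path_nth by metis

lemma path_nth_path_idx:
  assumes "skel S" "i \<in> verts Q" "\<pi> \<in> S" "fst \<pi> = Some i"
  shows "path_idx S i \<pi> < \<alpha> i" "path_nth S i (path_idx S i \<pi>) = \<pi>"
proof -
  have "\<pi> \<in> path_nth S i ` {..<\<alpha> i}"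
    using path_nth_bij[OF assms(1,2)] assms(3,4) by (simp add: bij_betw_def paths_at_def)
  from inv_into_into[OF this] f_inv_into_f[OF this]
  show "path_idx S i \<pi> < \<alpha> i" "path_nth S i (path_idx S i \<pi>) = \<pi>" by (simp_all add: path_idx_def)
qed

lemma row_mat_mult_vec:
  assumes "r < \<alpha> i" "v \<in> carrier_vec (\<alpha> i)"
  shows "(row_mat S Mf i *\<^sub>v v) $ r = (\<Sum>j<\<alpha> i. path_row Mf (path_nth S i r) j * v $ j)"
  using mat_mult_vec_index[OF row_mat_carrier assms(2,1), of S Mf] assms by (simp add: row_mat_def)

lemma det_row_mat_iff:
  fixes Mf :: "('v, 'a, 'f::field) framed_rep"
  assumes S: "skel S"
  shows "(\<forall>i\<in>verts Q. det (row_mat S Mf i) \<noteq> 0) \<longleftrightarrow> row_injective Mf S"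
proof
  assume d: "\<forall>i\<in>verts Q. det (row_mat S Mf i) \<noteq> 0"
  show "row_injective Mf S" unfolding row_injective_def
  proof (intro ballI allI impI)
    fix i y j assume i: "i \<in> verts Q" and j: "j < \<alpha> i"
      and y: "\<forall>\<pi>\<in>S. fst \<pi> = Some i \<longrightarrow> (\<Sum>j<\<alpha> i. path_row Mf \<pi> j * y j) = 0"
    have "row_mat S Mf i *\<^sub>v vec (\<alpha> i) y = 0\<^sub>v (\<alpha> i)"
    proof (rule eq_vecI)
      fix r assume "r < dim_vec (0\<^sub>v (\<alpha> i) ::  'f vec)"
      then have r: "r < \<alpha> i" by simp
      then show "(row_mat S Mf i *\<^sub>v vec (\<alpha> i) y) $ r = 0\<^sub>v (\<alpha> i) $ r"
        using row_mat_mult_vec[OF r, of "vec (\<alpha> i) y"] y path_nth_in[OF S i r] by simp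
    qed (simp add: row_mat_def)
    then have "vec (\<alpha> i) y = 0\<^sub>v (\<alpha> i)"
      using d i det_0_iff_vec_prod_zero_field[OF row_mat_carrier] vec_carrier by blast
    then show "y j = 0" using j by (metis index_vec index_zero_vec(1))
  qed
next
  assume inj: "row_injective Mf S"
  show "\<forall>i\<in>verts Q. det (row_mat S Mf i) \<noteq> 0"
  proof (intro ballI notI)
    fix i assume i: "i \<in> verts Q" and "det (row_mat S Mf i) = 0"
    then obtain v where v: "v \<in> carrier_vec (\<alpha> i)" "v \<noteq> 0\<^sub>v (\<alpha> i)" "row_mat S Mf i *\<^sub>v v = 0\<^sub>v (\<alpha> i)"
      using det_0_iff_vec_prod_zero_field[OF row_mat_carrier] by blast
    have "v $ j = 0" if j: "j < \<alpha> i" for j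
    proof (rule row_injectiveD[OF inj i _ j])
      fix \<pi> assume \<pi>: "\<pi> \<in> S" "fst \<pi> = Some i"
      show "(\<Sum>j<\<alpha> i. path_row Mf \<pi> j * v $ j) = 0"
        using row_mat_mult_vec[OF path_nth_path_idx(1)[OF S i \<pi>] v(1), of S Mf] v(3) path_nth_path_idx[OF S i \<pi>] by simp
    qed
    then have "v = 0\<^sub>v (\<alpha> i)" using v(1) by (intro eq_vecI) auto
    then show False using v(2) by simp
  qed
qed

lemma path_row_minv:
  assumes S: "skel S" and i: "i \<in> verts Q" and d: "det (row_mat S Mf i) \<noteq> 0" and r: "r < \<alpha> i" "r' < \<alpha> i"
  shows "(\<Sum>s<\<alpha> i. path_row Mf (path_nth S i r) s * minv (row_mat S Mf i) $$ (s, r')) = (if r = r' then 1 else 0)"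
proof -
  have "(row_mat S Mf i * minv (row_mat S Mf i)) $$ (r, r') = (\<Sum>s<\<alpha> i. row_mat S Mf i $$ (r, s) * minv (row_mat S Mf i) $$ (s, r'))"
    using mat_index_mult[OF row_mat_carrier minv_carrier[OF row_mat_carrier] r] .
  then show ?thesis using minv_right[OF row_mat_carrier d] r by (simp add: row_mat_def)
qed

section \<open>Counting independent and separating rows\<close>

definition row_indep :: "('v, 'a, 'f::field) framed_rep \<Rightarrow> ('v, 'a) ext_path set \<Rightarrow> 'v \<Rightarrow> bool" where
  "row_indep Mf A i \<longleftrightarrow> (\<forall>F c. finite F \<longrightarrow> F \<subseteq> A \<longrightarrow>
     (\<forall>j<\<alpha> i. (\<Sum>\<pi>\<in>F. c \<pi> * path_row Mf \<pi> j) = 0) \<longrightarrow> (\<forall>\<pi>\<in>F. c \<pi> = 0))"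

text \<open>More than \<open>\<alpha> i\<close> vectors of length \<open>\<alpha> i\<close> are
  dependent. Finiteness has to be derived here, since a J-skeleton is not finite by
  definition.\<close>

lemma card_row_indep:
  assumes "row_indep Mf A i"
  shows "finite A" "card A \<le> \<alpha> i"
proof -
  have False if F: "finite F" "F \<subseteq> A" "\<alpha> i < card F" for F
  proof -
    obtain c where "\<exists>\<pi>\<in>F. c \<pi> \<noteq> 0" "\<forall>j\<in>{..<\<alpha> i}. (\<Sum>\<pi>\<in>F. c \<pi> * path_row Mf \<pi> j) = 0"
      using exists_null_combination[OF F(1) finite_lessThan, of "\<alpha> i" "path_row Mf"] F(3) by auto
    then show False using assms F(1,2) unfolding row_indep_def by blast
  qed
  note no = this
  show "finite A"
  proof (rule ccontr)
    assume "infinite A"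
    then obtain F where "F \<subseteq> A" "finite F" "card F = Suc (\<alpha> i)"
      using infinite_arbitrarily_large by blast
    then show False using no by force
  qed
  then show "card A \<le> \<alpha> i" using no[of A] by force
qed

lemma card_row_injective:
  assumes inj: "row_injective Mf S" and i: "i \<in> verts Q" and fin: "finite (paths_at S i)"
  shows "\<alpha> i \<le> card (paths_at S i)"
proof (rule ccontr)
  assume "\<not> ?thesis"
  then have "card (paths_at S i) < card {..<\<alpha> i}" by simp
  then obtain c where c: "\<exists>j\<in>{..<\<alpha> i}. c j \<noteq> 0" "\<forall>\<pi>\<in>paths_at S i. (\<Sum>j<\<alpha> i. c j * path_row Mf \<pi> j) = 0"
    using exists_null_combination[OF finite_lessThan fin, of "\<alpha> i" "\<lambda>j \<pi>. path_row Mf \<pi> j"] by blast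
  have "c j = 0" if "j < \<alpha> i" for j
    by (rule row_injectiveD[OF inj i _ that]) (use c(2) in \<open>auto simp: paths_at_def mult.commute\<close>)
  then show False using c(1) by auto
qed

section \<open>J-skeleta as combinatorial skeleta\<close>

lemma finite_by_paths_at:
  assumes "S \<subseteq> npaths" "\<And>i. i \<in> verts Q \<Longrightarrow> finite (paths_at S i)"
  shows "finite S"
proof -
  have "S \<subseteq> (\<Union>i\<in>verts Q. paths_at S i)"
    using assms(1) by (auto simp: paths_at_def elim!: npaths_vert)
  then show ?thesis using assms(2) by (meson finite_UN finite_quiver(1) finite_subset)
qed

text \<open>Independence of the restrictions gives at most \<open>\<alpha> i\<close> paths at
  \<open>i\<close>. Generation of the dual writes each coordinate functional through paths of
  \<open>S\<close> and \<open>e_inf\<close>, so a vector killed by \<open>S\<close> is zero and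
  there are at least \<open>\<alpha> i\<close> paths.\<close>

lemma J_skeleton_imp_skel:
  fixes Mf :: "('v, 'a, 'f::field) framed_rep"
  assumes st: "Mf \<in> stables" and J: "J_skeleton Q \<alpha> \<zeta> Mf S"
  shows "skel S \<and> row_injective Mf S"
proof -
  have Mf: "Mf \<in> reps" and inj: "row_injective Mf npaths"
    using st stable_pairs_iff[of Mf] by auto
  define W where "W = {Psi Mf y z | y z. True}"
  have sub: "S \<subseteq> npaths" using J by (auto simp: J_skeleton_def npaths_def)
  have basis: "restrictions_basis_of_dual W (insert e_inf S)"
    using J by (simp add: J_skeleton_def Phi_image[OF Mf] W_def)
  note basis1 = basis[unfolded restrictions_basis_of_dual_def, THEN conjunct1, rule_format]
    and basis2 = basis[unfolded restrictions_basis_of_dual_def, THEN conjunct2, rule_format]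
  have indep: "row_indep Mf (paths_at S i) i" if i: "i \<in> verts Q" for i
    unfolding row_indep_def
  proof (intro allI impI)
    fix F c assume F: "finite F" "F \<subseteq> paths_at S i" and 0: "\<forall>j<\<alpha> i. (\<Sum>\<pi>\<in>F. c \<pi> * path_row Mf \<pi> j) = 0"
    have "(\<Sum>\<pi>\<in>F. c \<pi> * Psi Mf y z \<pi>) = 0" for y z
    proof -
      have "Psi Mf y z \<pi> = (\<Sum>j<\<alpha> i. path_row Mf \<pi> j * y i j)" if "\<pi> \<in> F" for \<pi>
        using that F sub by (auto simp: Psi_def paths_at_def)
      then have "(\<Sum>\<pi>\<in>F. c \<pi> * Psi Mf y z \<pi>) = (\<Sum>\<pi>\<in>F. \<Sum>j<\<alpha> i. c \<pi> * path_row Mf \<pi> j * y i j)"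
        by (simp add: sum_distrib_left mult.assoc)
      also have "\<dots> = (\<Sum>j<\<alpha> i. \<Sum>\<pi>\<in>F. c \<pi> * path_row Mf \<pi> j * y i j)" by (rule sum.swap)
      also have "\<dots> = (\<Sum>j<\<alpha> i. (\<Sum>\<pi>\<in>F. c \<pi> * path_row Mf \<pi> j) * y i j)" by (simp add: sum_distrib_right)
      also have "\<dots> = 0" using 0 by simp
      finally show ?thesis .
    qed
    then have "\<forall>\<xi>\<in>W. (\<Sum>\<pi>\<in>F. c \<pi> * \<xi> \<pi>) = 0" by (auto simp: W_def)
    moreover have "F \<subseteq> insert e_inf S" using F(2) by (auto simp: paths_at_def)
    ultimately show "\<forall>\<pi>\<in>F. c \<pi> = 0"
      using basis1[of F c] F(1) by blast
  qed
  have "finite S" using finite_by_paths_at[OF sub] card_row_indep(1)[OF indep] by blast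
  have injS: "row_injective Mf S" unfolding row_injective_def
  proof (intro ballI allI impI)
    fix i y j assume i: "i \<in> verts Q" and j: "j < \<alpha> i"
      and y: "\<forall>\<pi>\<in>S. fst \<pi> = Some i \<longrightarrow> (\<Sum>j<\<alpha> i. path_row Mf \<pi> j * y j) = 0"
    \<comment> \<open>The functional reading off coordinate \<open>j\<close> at \<open>i\<close>. It
      is well defined on \<open>W\<close> because the map to J of a stable pair is
      injective.\<close>
    define \<phi> where "\<phi> \<xi> = (SOME w. \<exists>y z. \<xi> = Psi Mf y z \<and> w = y i j)" for \<xi>
    have \<phi>: "\<phi> (Psi Mf y z) = y i j" for y z
    proof -
      have "w = y i j" if "Psi Mf y z = Psi Mf y' z'" "w = y' i j" for w y' z'
      proof -
        have "(\<lambda>j. y i j - y' i j) j = 0"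
        proof (rule row_injectiveD[OF inj i _ j])
          fix \<pi> assume \<pi>: "\<pi> \<in> npaths" "fst \<pi> = Some i"
          then show "(\<Sum>j<\<alpha> i. path_row Mf \<pi> j * (y i j - y' i j)) = 0"
            using fun_cong[OF that(1), of \<pi>] by (simp add: Psi_def right_diff_distrib sum_subtractf)
        qed
        then show ?thesis using that(2) by simp
      qed
      then show ?thesis unfolding \<phi>_def by (intro some_equality) blast+
    qed
    have "linear_functional_on W \<phi>"
      unfolding linear_functional_on_def
    proof (intro conjI ballI allI)
      fix \<xi> \<eta> assume "\<xi> \<in> W" "\<eta> \<in> W"
      then obtain y z y' z' where "\<xi> = Psi Mf y z" "\<eta> = Psi Mf y' z'" by (auto simp: W_def)
      then show "\<phi> (\<lambda>\<pi>. \<xi> \<pi> + \<eta> \<pi>) = \<phi> \<xi> + \<phi> \<eta>"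
        using \<phi>[of "\<lambda>i j. y i j + y' i j" "z + z'"] by (simp add: \<phi> Psi_add[abs_def, symmetric])
    next
      fix c \<xi> assume "\<xi> \<in> W"
      then obtain y z where "\<xi> = Psi Mf y z" by (auto simp: W_def)
      then show "\<phi> (\<lambda>\<pi>. c * \<xi> \<pi>) = c * \<phi> \<xi>"
        using \<phi>[of "\<lambda>i j. c * y i j" "c * z"] by (simp add: \<phi> Psi_scale[abs_def, symmetric])
    qed
    then obtain F c where F: "finite F" "F \<subseteq> insert e_inf S" "\<forall>\<xi>\<in>W. \<phi> \<xi> = (\<Sum>\<pi>\<in>F. c \<pi> * \<xi> \<pi>)"
      using basis2[of \<phi>] by blast
    \<comment> \<open>\<open>y\<close> at the vertex \<open>i\<close>, zero at all other vertices
      and at infinity: every path of \<open>F\<close>, including \<open>e_inf\<close>, vanishes on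
      it.\<close>
    define y' where "y' = (\<lambda>k. if k = i then y else (\<lambda>_. 0))"
    have "Psi Mf y' 0 \<pi> = 0" if \<pi>: "\<pi> \<in> F" for \<pi>
    proof (cases "\<pi> = e_inf")
      case False
      then have "\<pi> \<in> S" using \<pi> F(2) by blast
      then show ?thesis using y sub by (auto simp: Psi_def y'_def elim!: npaths_vert)
    qed (simp add: Psi_def)
    moreover have "Psi Mf y' 0 \<in> W" by (auto simp: W_def)
    ultimately have "\<phi> (Psi Mf y' 0) = 0" using F(3) by simp
    then show "y j = 0" by (simp add: \<phi> y'_def)
  qed
  have "card (paths_at S i) = \<alpha> i" if "i \<in> verts Q" for i
    using card_row_indep[OF indep[OF that]] card_row_injective[OF injS that] by force
  moreover have "suffix_closed S"
    unfolding suffix_closed_def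
  proof (intro allI impI)
    fix a p assume "(Some (tail Q a), Inl a # p) \<in> S"
    then show "(Some (head Q a), p) \<in> S"
      using J[unfolded J_skeleton_def, THEN conjunct2, THEN conjunct2, rule_format,
          of "Some (tail Q a)" "Inl a" p]
      by (simp add: e_inf_def ext_quiver_def)
  qed
  ultimately show ?thesis using sub \<open>finite S\<close> injS by (simp add: skel_def)
qed

lemma linear_functional_sum:
  fixes w :: "'b \<Rightarrow> 'p \<Rightarrow> 'f::field"
  assumes \<phi>: "linear_functional_on W \<phi>" and fin: "finite B" and W: "\<And>b. b \<in> B \<Longrightarrow> w b \<in> W"
    and W0: "(\<lambda>_. 0) \<in> W" and Wadd: "\<And>\<xi> \<eta>. \<xi> \<in> W \<Longrightarrow> \<eta> \<in> W \<Longrightarrow> (\<lambda>\<pi>. \<xi> \<pi> + \<eta> \<pi>) \<in> W"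
    and Wscale: "\<And>c \<xi>. \<xi> \<in> W \<Longrightarrow> (\<lambda>\<pi>. c * \<xi> \<pi>) \<in> W"
  shows "(\<lambda>\<pi>. \<Sum>b\<in>B. c b * w b \<pi>) \<in> W \<and> \<phi> (\<lambda>\<pi>. \<Sum>b\<in>B. c b * w b \<pi>) = (\<Sum>b\<in>B. c b * \<phi> (w b))"
  using fin W
proof (induction B)
  case empty
  show ?case
    using W0 \<phi>[unfolded linear_functional_on_def, THEN conjunct2, THEN spec, THEN bspec, OF W0, of 0]
    by simp
next
  case (insert b B)
  have 1: "(\<lambda>\<pi>. c b * w b \<pi>) \<in> W" using Wscale insert.prems by blast
  have 2: "\<phi> (\<lambda>\<pi>. c b * w b \<pi>) = c b * \<phi> (w b)"
    using \<phi>[unfolded linear_functional_on_def, THEN conjunct2, THEN spec, THEN bspec, of "w b" "c b"]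
      insert.prems by blast
  have 3: "(\<lambda>\<pi>. \<Sum>b\<in>B. c b * w b \<pi>) \<in> W"
    "\<phi> (\<lambda>\<pi>. \<Sum>b\<in>B. c b * w b \<pi>) = (\<Sum>b\<in>B. c b * \<phi> (w b))"
    using insert by auto
  have "\<phi> (\<lambda>\<pi>. c b * w b \<pi> + (\<Sum>b\<in>B. c b * w b \<pi>)) =
      \<phi> (\<lambda>\<pi>. c b * w b \<pi>) + \<phi> (\<lambda>\<pi>. \<Sum>b\<in>B. c b * w b \<pi>)"
    using \<phi>[unfolded linear_functional_on_def, THEN conjunct1, THEN bspec, THEN bspec, OF 1 3(1)] .
  then show ?case using Wadd[OF 1 3(1)] 2 3(2) insert.hyps by simp
qed

text \<open>The columns of the inverse minors give elements of \<open>W\<close> dual to the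
  evaluations in \<open>insert e_inf S\<close>. Duality yields independence; since \<open>S\<close>
  separates \<open>W\<close> at the vertices of \<open>Q\<close>, the dual elements also generate
  \<open>W\<close>, hence the evaluations generate its dual.\<close>

lemma skel_imp_J_skeleton:
  fixes Mf :: "('v, 'a, 'f::field) framed_rep"
  assumes Mf: "Mf \<in> reps" and S: "skel S" and injS: "row_injective Mf S"
  shows "J_skeleton Q \<alpha> \<zeta> Mf S"
proof -
  define W where "W = {Psi Mf y z | y z. True}"
  have sub: "S \<subseteq> npaths" using skelD[OF S] by blast
  have d: "det (row_mat S Mf i) \<noteq> 0" if "i \<in> verts Q" for i using injS det_row_mat_iff[OF S] that by blast
  \<comment> \<open>The column of the inverse minor at the position of \<pi>. For
    \<open>e_inf\<close> it is zero at all vertices of \<open>Q\<close>, and \<open>w\<close> puts a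
    1 at infinity instead.\<close>
  define Y where "Y \<pi> i s = (if fst \<pi> = Some i then minv (row_mat S Mf i) $$ (s, path_idx S i \<pi>) else 0)" for \<pi> i s
  define w where "w \<pi> = Psi Mf (Y \<pi>) (if \<pi> = e_inf then 1 else 0)" for \<pi>
  let ?B = "insert e_inf S"
  have dual: "w \<pi> \<pi>' = (if \<pi> = \<pi>' then 1 else 0)" if \<pi>: "\<pi> \<in> ?B" "\<pi>' \<in> ?B" for \<pi> \<pi>'
  proof (cases "\<pi>' = e_inf")
    case False
    then have \<pi>'S: "\<pi>' \<in> S" "\<pi>' \<in> npaths" using \<pi> sub by auto
    then obtain i where i: "i \<in> verts Q" "fst \<pi>' = Some i" by (elim npaths_vert)
    show ?thesis
    proof (cases "fst \<pi> = Some i")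
      case True
      then have \<pi>S: "\<pi> \<in> S" using \<pi>(1) by (auto simp: e_inf_def)
      note e = path_nth_path_idx[OF S i(1) \<pi>S True] and e' = path_nth_path_idx[OF S i(1) \<pi>'S(1) i(2)]
      have "w \<pi> \<pi>' = (\<Sum>s<\<alpha> i. path_row Mf \<pi>' s * minv (row_mat S Mf i) $$ (s, path_idx S i \<pi>))"
        using \<pi>'S(2) i(2) True by (simp add: w_def Psi_def Y_def)
      also have "\<dots> = (if path_idx S i \<pi>' = path_idx S i \<pi> then 1 else 0)"
        using path_row_minv[OF S i(1) d[OF i(1)] e'(1) e(1)] unfolding e'(2) .
      also have "path_idx S i \<pi>' = path_idx S i \<pi> \<longleftrightarrow> \<pi> = \<pi>'" using e(2) e'(2) by metis
      finally show ?thesis .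
    next
      case F: False
      then have "\<pi> \<noteq> \<pi>'" using i(2) by auto
      then show ?thesis using F i(2) \<pi>'S(2) by (simp add: w_def Psi_def Y_def)
    qed
  qed (auto simp: w_def Psi_def)
  have WI: "Psi Mf y z \<in> W" for y z by (auto simp: W_def)
  then have wW: "w \<pi> \<in> W" for \<pi> by (simp add: w_def)
  have a: "\<forall>\<pi>\<in>F. c \<pi> = 0"
    if F: "finite F" "F \<subseteq> ?B" and 0: "\<forall>\<xi>\<in>W. (\<Sum>\<pi>\<in>F. c \<pi> * \<xi> \<pi>) = 0" for F c
  proof
    fix \<pi>0 assume \<pi>0: "\<pi>0 \<in> F"
    have "(\<Sum>\<pi>\<in>F. c \<pi> * w \<pi>0 \<pi>) = (\<Sum>\<pi>\<in>F. if \<pi> = \<pi>0 then c \<pi> else 0)"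
    proof (intro sum.cong refl)
      fix \<pi> assume "\<pi> \<in> F"
      then have "\<pi> \<in> ?B" "\<pi>0 \<in> ?B" using \<pi>0 F(2) by blast+
      then show "c \<pi> * w \<pi>0 \<pi> = (if \<pi> = \<pi>0 then c \<pi> else 0)" using dual[of \<pi>0 \<pi>] by simp
    qed
    also have "\<dots> = c \<pi>0" using \<pi>0 F(1) by simp
    finally show "c \<pi>0 = 0" using 0 wW by simp
  qed
  have b: "\<exists>F c. finite F \<and> F \<subseteq> ?B \<and> (\<forall>\<xi>\<in>W. \<phi> \<xi> = (\<Sum>\<pi>\<in>F. c \<pi> * \<xi> \<pi>))"
    if \<phi>: "linear_functional_on W \<phi>" for \<phi>
  proof (intro exI conjI ballI)
    show fin: "finite ?B" using skelD(2)[OF S] by simp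
    show "?B \<subseteq> ?B" ..
    fix \<xi> assume "\<xi> \<in> W"
    then obtain y z where \<xi>: "\<xi> = Psi Mf y z" by (auto simp: W_def)
    \<comment> \<open>Coefficients of \<xi> in the dual family: its values on
      \<open>insert e_inf S\<close>. The combination agrees with \<xi> on these paths, and then
      everywhere, because \<open>S\<close> separates.\<close>
    define y' where "y' i j = (\<Sum>\<pi>\<in>?B. \<xi> \<pi> * Y \<pi> i j)" for i j
    define z' where "z' = (\<Sum>\<pi>\<in>?B. \<xi> \<pi> * (if \<pi> = e_inf then 1 else 0))"
    have comb: "Psi Mf y' z' = (\<lambda>\<pi>'. \<Sum>\<pi>\<in>?B. \<xi> \<pi> * w \<pi> \<pi>')"
      unfolding y'_def z'_def w_def by (intro ext Psi_sum)
    have onB: "(\<Sum>\<pi>\<in>?B. \<xi> \<pi> * w \<pi> \<pi>') = \<xi> \<pi>'" if \<pi>': "\<pi>' \<in> ?B" for \<pi>'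
    proof -
      have "(\<Sum>\<pi>\<in>?B. \<xi> \<pi> * w \<pi> \<pi>') = (\<Sum>\<pi>\<in>?B. if \<pi> = \<pi>' then \<xi> \<pi> else 0)"
      proof (intro sum.cong refl)
        fix \<pi> assume "\<pi> \<in> ?B"
        then show "\<xi> \<pi> * w \<pi> \<pi>' = (if \<pi> = \<pi>' then \<xi> \<pi> else 0)" using dual[OF _ \<pi>', of \<pi>] by simp
      qed
      then show ?thesis using \<pi>' fin by simp
    qed
    have yy: "y' i j = y i j" if i: "i \<in> verts Q" and j: "j < \<alpha> i" for i j
    proof -
      have "(\<lambda>j. y' i j - y i j) j = 0"
      proof (rule row_injectiveD[OF injS i _ j])
        fix \<pi> assume \<pi>: "\<pi> \<in> S" "fst \<pi> = Some i"
        then have "Psi Mf y' z' \<pi> = Psi Mf y z \<pi>" using onB[of \<pi>] comb \<xi> by simp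
        then show "(\<Sum>j<\<alpha> i. path_row Mf \<pi> j * (y' i j - y i j)) = 0"
          using \<pi> sub by (auto simp: Psi_def right_diff_distrib sum_subtractf)
      qed
      then show ?thesis by simp
    qed
    have "Psi Mf y' z' \<pi> = \<xi> \<pi>" for \<pi>
    proof (cases "\<pi> \<in> npaths")
      case True
      then obtain i where "i \<in> verts Q" "fst \<pi> = Some i" by (rule npaths_vert)
      then show ?thesis using True yy by (simp add: Psi_def \<xi>)
    next
      case False
      show ?thesis
      proof (cases "\<pi> = e_inf")
        case True
        then show ?thesis using onB[of e_inf] fun_cong[OF comb, of e_inf] by simp
      next
        case F: False
        have "Psi Mf y' z' \<pi> = 0" "Psi Mf y z \<pi> = 0" using False F by (simp_all add: Psi_def)
        then show ?thesis by (simp add: \<xi>)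
      qed
    qed
    then have \<xi>': "\<xi> = (\<lambda>\<pi>'. \<Sum>\<pi>\<in>?B. \<xi> \<pi> * w \<pi> \<pi>')" using comb by auto
    have "\<phi> (\<lambda>\<pi>'. \<Sum>\<pi>\<in>?B. \<xi> \<pi> * w \<pi> \<pi>') = (\<Sum>\<pi>\<in>?B. \<xi> \<pi> * \<phi> (w \<pi>))"
    proof (rule linear_functional_sum[OF \<phi> fin wW, THEN conjunct2])
      have "Psi Mf (\<lambda>_ _. 0) 0 = (\<lambda>_. 0)" by (auto simp: Psi_def)
      then show "(\<lambda>_. 0) \<in> W" using WI[of "\<lambda>_ _. 0" 0] by simp
      show "(\<lambda>\<pi>. \<xi> \<pi> + \<eta> \<pi>) \<in> W" if \<xi>\<eta>: "\<xi> \<in> W" "\<eta> \<in> W" for \<xi> \<eta>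
      proof -
        obtain y z y' z' where "\<xi> = Psi Mf y z" "\<eta> = Psi Mf y' z'" using \<xi>\<eta> by (auto simp: W_def)
        then have "(\<lambda>\<pi>. \<xi> \<pi> + \<eta> \<pi>) = Psi Mf (\<lambda>i j. y i j + y' i j) (z + z')"
          by (intro ext) (simp add: Psi_add)
        then show ?thesis using WI by simp
      qed
      show "(\<lambda>\<pi>. c * \<xi> \<pi>) \<in> W" if \<xi>: "\<xi> \<in> W" for c \<xi>
      proof -
        obtain y z where "\<xi> = Psi Mf y z" using \<xi> by (auto simp: W_def)
        then have "(\<lambda>\<pi>. c * \<xi> \<pi>) = Psi Mf (\<lambda>i j. c * y i j) (c * z)"
          by (intro ext) (simp add: Psi_scale)
        then show ?thesis using WI by simp
      qed
    qed
    then show "\<phi> \<xi> = (\<Sum>\<pi>\<in>?B. \<phi> (w \<pi>) * \<xi> \<pi>)" using \<xi>' by (simp add: mult.commute)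
  qed
  have "restrictions_basis_of_dual W ?B"
    unfolding restrictions_basis_of_dual_def
    by (intro conjI allI impI, rule a, assumption+, rule b, assumption)
  moreover have "(head (ext_quiver Q \<zeta>) b, p) \<in> S"
    if "(u, b # p) \<in> S" "(head (ext_quiver Q \<zeta>) b, p) \<noteq> e_inf" for u b p
  proof -
    have n: "(u, b # p) \<in> npaths" using that(1) sub by blast
    show ?thesis
    proof (cases b)
      case (Inl a)
      then show ?thesis
        using that n skelD(3)[OF S] by (auto simp: npaths_Inl suffix_closed_def ext_quiver_def)
    next
      case (Inr iq)
      then show ?thesis using that n by (cases iq) (auto simp: npaths_Inr ext_quiver_def e_inf_def)
    qed
  qed
  ultimately show ?thesis
    using sub unfolding J_skeleton_def Phi_image[OF Mf] W_def by (auto simp: npaths_def)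
qed

text \<open>Stability comes for free: a vector killed by all paths is killed by those of
  \<open>S\<close>.\<close>

lemma stable_with_skeleton_eq:
  assumes "skel S"
  shows "cell S =
    {Mf \<in> reps. \<forall>i\<in>verts Q. det (row_mat S Mf i) \<noteq> 0}"
proof -
  have "Mf \<in> cell S \<longleftrightarrow> Mf \<in> reps \<and> row_injective Mf S" for Mf
  proof
    assume "Mf \<in> cell S"
    then have "Mf \<in> stables" "J_skeleton Q \<alpha> \<zeta> Mf S"
      by (simp_all add: stable_with_skeleton_def)
    then show "Mf \<in> reps \<and> row_injective Mf S"
      using J_skeleton_imp_skel[of Mf S] stable_pairs_iff[of Mf] by simp
  next
    assume A: "Mf \<in> reps \<and> row_injective Mf S"
    then have "row_injective Mf npaths" using row_injective_mono skelD(1)[OF assms] by blast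
    then show "Mf \<in> cell S"
      using A skel_imp_J_skeleton[of Mf S] assms stable_pairs_iff[of Mf]
      by (simp add: stable_with_skeleton_def)
  qed
  then show ?thesis unfolding det_row_mat_iff[OF assms] by blast
qed

section \<open>Existence of a skeleton\<close>

lemma row_null_if_dependent:
  assumes S: "row_indep Mf (paths_at S i) i" and \<pi>: "fst \<pi> = Some i"
    and dep: "\<not> row_indep Mf (paths_at (insert \<pi> S) i) i"
    and y: "\<And>\<tau>. \<tau> \<in> S \<Longrightarrow> fst \<tau> = Some i \<Longrightarrow> (\<Sum>j<\<alpha> i. path_row Mf \<tau> j * y j) = 0"
  shows "(\<Sum>j<\<alpha> i. path_row Mf \<pi> j * y j) = 0"
proof -
  have paths_at: "paths_at (insert \<pi> S) i = insert \<pi> (paths_at S i)" using \<pi> by (auto simp: paths_at_def)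
  obtain F c \<tau> where F: "finite F" "F \<subseteq> insert \<pi> (paths_at S i)"
    "\<forall>j<\<alpha> i. (\<Sum>\<pi>\<in>F. c \<pi> * path_row Mf \<pi> j) = 0" "\<tau> \<in> F" "c \<tau> \<noteq> 0"
    using dep unfolding row_indep_def paths_at by blast
  \<comment> \<open>Otherwise the relation would already hold among the rows of \<open>S\<close>.
    With a nonzero coefficient at \<pi> it can be solved for the row of \<pi>.\<close>
  have \<pi>F: "\<pi> \<in> F \<and> c \<pi> \<noteq> 0"
  proof (rule ccontr)
    assume neg: "\<not> (\<pi> \<in> F \<and> c \<pi> \<noteq> 0)"
    have "(\<Sum>\<pi>\<in>F - {\<pi>}. c \<pi> * path_row Mf \<pi> j) = (\<Sum>\<pi>\<in>F. c \<pi> * path_row Mf \<pi> j)" for j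
      using neg F(1) by (intro sum.mono_neutral_left) auto
    then have "\<forall>j<\<alpha> i. (\<Sum>\<pi>\<in>F - {\<pi>}. c \<pi> * path_row Mf \<pi> j) = 0" using F(3) by simp
    then have "\<forall>\<tau>\<in>F - {\<pi>}. c \<tau> = 0"
      using S F(1,2) unfolding row_indep_def by blast
    then show False using F(4,5) neg by blast
  qed
  have "0 = (\<Sum>j<\<alpha> i. (\<Sum>\<pi>\<in>F. c \<pi> * path_row Mf \<pi> j) * y j)" using F(3) by simp
  also have "\<dots> = (\<Sum>j<\<alpha> i. \<Sum>\<pi>\<in>F. c \<pi> * (path_row Mf \<pi> j * y j))"
    by (simp add: sum_distrib_right mult.assoc)
  also have "\<dots> = (\<Sum>\<pi>\<in>F. \<Sum>j<\<alpha> i. c \<pi> * (path_row Mf \<pi> j * y j))" by (rule sum.swap)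
  also have "\<dots> = (\<Sum>\<pi>\<in>F. c \<pi> * (\<Sum>j<\<alpha> i. path_row Mf \<pi> j * y j))" by (simp add: sum_distrib_left)
  also have "\<dots> = c \<pi> * (\<Sum>j<\<alpha> i. path_row Mf \<pi> j * y j) + (\<Sum>\<pi>\<in>F - {\<pi>}. c \<pi> * (\<Sum>j<\<alpha> i. path_row Mf \<pi> j * y j))"
    using sum.remove[OF F(1) conjunct1[OF \<pi>F]] by blast
  also have "(\<Sum>\<pi>\<in>F - {\<pi>}. c \<pi> * (\<Sum>j<\<alpha> i. path_row Mf \<pi> j * y j)) = 0"
    using F(2) y by (intro sum.neutral) (auto simp: paths_at_def)
  finally show ?thesis using \<pi>F by simp
qed

text \<open>
  Take a suffix-closed set of paths with independent rows of maximal cardinality. By maximality, the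
  row of every path extending it by one arrow is dependent, so by induction on the length every path
  vanishes where the paths of the set vanish, which is 0 for a stable pair.
\<close>

lemma exists_skel:
  assumes st: "Mf \<in> stables"
  shows "\<exists>S. skel S \<and> row_injective Mf S"
proof -
  have Mf: "Mf \<in> reps" and inj: "row_injective Mf npaths"
    using st stable_pairs_iff[of Mf] by auto
  define good where "good S \<longleftrightarrow> S \<subseteq> npaths \<and> suffix_closed S \<and> (\<forall>i\<in>verts Q. row_indep Mf (paths_at S i) i)" for S
  have good_fin: "finite S" if "good S" for S
    using that finite_by_paths_at[of S] card_row_indep(1) unfolding good_def by blast
  have bound: "card S \<le> (\<Sum>i\<in>verts Q. \<alpha> i)" if "good S" for S
  proof -
    have "S = (\<Union>i\<in>verts Q. paths_at S i)"
      using that by (auto simp: good_def paths_at_def elim!: npaths_vert)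
    then have "card S \<le> (\<Sum>i\<in>verts Q. card (paths_at S i))" using card_UN_le[of "verts Q" "paths_at S"] by simp
    also have "\<dots> \<le> (\<Sum>i\<in>verts Q. \<alpha> i)"
      using that card_row_indep(2) unfolding good_def by (intro sum_mono) blast
    finally show ?thesis .
  qed
  have "good {}" by (simp add: good_def suffix_closed_def paths_at_def row_indep_def)
  moreover have "\<forall>S. good S \<longrightarrow> card S < Suc (\<Sum>i\<in>verts Q. \<alpha> i)"
    using bound le_imp_less_Suc by blast
  ultimately have "\<exists>S. good S \<and> (\<forall>T. good T \<longrightarrow> card T \<le> card S)" by (rule ex_has_greatest_nat)
  then obtain S where S: "good S" and max: "\<And>T. good T \<Longrightarrow> card T \<le> card S" by (elim exE conjE) simp
  \<comment> \<open>For \<pi> outside \<open>S\<close>, only independence can fail for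
    \<open>insert \<pi> S\<close>, and only at the vertex where \<pi> starts.\<close>
  have ext: "(\<Sum>j<\<alpha> i. path_row Mf \<pi> j * y j) = 0"
    if \<pi>: "\<pi> \<in> npaths" "fst \<pi> = Some i" "suffix_closed (insert \<pi> S)" and i: "i \<in> verts Q"
      and y: "\<And>\<tau>. \<tau> \<in> S \<Longrightarrow> fst \<tau> = Some i \<Longrightarrow> (\<Sum>j<\<alpha> i. path_row Mf \<tau> j * y j) = 0" for \<pi> i y
  proof (cases "\<pi> \<in> S")
    case True
    then show ?thesis using y \<pi>(2) by blast
  next
    case False
    then have "\<not> good (insert \<pi> S)" using max[of "insert \<pi> S"] good_fin[OF S] by auto
    then obtain k where k: "k \<in> verts Q" "\<not> row_indep Mf (paths_at (insert \<pi> S) k) k"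
      using S \<pi>(1,3) unfolding good_def by blast
    have "k = i"
    proof (rule ccontr)
      assume "k \<noteq> i"
      then have "paths_at (insert \<pi> S) k = paths_at S k" using \<pi>(2) by (auto simp: paths_at_def)
      then show False using k S by (auto simp: good_def)
    qed
    then show ?thesis
      using row_null_if_dependent[of Mf S i \<pi> y] k S \<pi>(2) y unfolding good_def by blast
  qed
  have null: "(\<And>\<tau>. \<tau> \<in> S \<Longrightarrow> fst \<tau> = fst \<pi> \<Longrightarrow> (\<Sum>j<\<alpha> (the (fst \<pi>)). path_row Mf \<tau> j * y j) = 0) \<Longrightarrow>
      (\<Sum>j<\<alpha> (the (fst \<pi>)). path_row Mf \<pi> j * y j) = 0"
    if "\<pi> \<in> npaths" for \<pi> y
    using that
  proof (induction arbitrary: y rule: npaths_induct)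
    case (frame i q)
    have "suffix_closed (insert (Some i, [Inr (i, q)]) S)"
      using S by (auto simp: good_def suffix_closed_def)
    then show ?case using frame ext[of "(Some i, [Inr (i, q)])" i y] by (simp add: npaths_Inr)
  next
    case (arc a p)
    \<comment> \<open>The image of \<open>y\<close> under \<open>M_a\<close>. Every \<tau> of
      \<open>S\<close> at the head of \<open>a\<close> kills it, because \<open>\<tau> a\<close> is
      a one-arrow extension of \<open>S\<close> and kills \<open>y\<close>; the induction hypothesis
      then applies to \<open>y'\<close>.\<close>
    define y' where "y' l = (\<Sum>j<\<alpha> (tail Q a). fst Mf a $$ (l, j) * y j)" for l
    have "(\<Sum>l<\<alpha> (head Q a). path_row Mf \<tau> l * y' l) = 0"
      if \<tau>: "\<tau> \<in> S" "fst \<tau> = Some (head Q a)" for \<tau>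
    proof -
      obtain p' where p': "\<tau> = (Some (head Q a), p')" using \<tau>(2) by (cases \<tau>) auto
      have n: "(Some (head Q a), p') \<in> npaths" using \<tau> S p' by (auto simp: good_def)
      have "suffix_closed (insert (Some (tail Q a), Inl a # p') S)"
        using S \<tau> p' by (auto simp: good_def suffix_closed_def)
      then have "(\<Sum>j<\<alpha> (tail Q a). path_row Mf (Some (tail Q a), Inl a # p') j * y j) = 0"
        using ext[of "(Some (tail Q a), Inl a # p')" "tail Q a" y] arc.prems arc.hyps(1) n
        by (simp add: npaths_Inl)
      then show ?thesis using path_row_mult_vec_arc[OF Mf arc.hyps(1) n] p' by (simp add: y'_def)
    qed
    then show ?case
      using arc.IH[of y'] path_row_mult_vec_arc[OF Mf arc.hyps(1,2)] by (simp add: y'_def)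
  qed
  have injS: "row_injective Mf S" unfolding row_injective_def
  proof (intro ballI allI impI)
    fix i y j assume i: "i \<in> verts Q" and j: "j < \<alpha> i"
      and y: "\<forall>\<pi>\<in>S. fst \<pi> = Some i \<longrightarrow> (\<Sum>j<\<alpha> i. path_row Mf \<pi> j * y j) = 0"
    show "y j = 0"
    proof (rule row_injectiveD[OF inj i _ j])
      fix \<pi> assume "\<pi> \<in> npaths" "fst \<pi> = Some i"
      then show "(\<Sum>j<\<alpha> i. path_row Mf \<pi> j * y j) = 0" using null[of \<pi> y] y by simp
    qed
  qed
  have "card (paths_at S i) = \<alpha> i" if i: "i \<in> verts Q" for i
    using card_row_indep(2)[of Mf "paths_at S i" i] card_row_injective[OF injS i] S good_fin[OF S] i
    by (simp add: good_def le_antisym)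
  then have "skel S" using S good_fin[OF S] by (simp add: skel_def good_def)
  then show ?thesis using injS by blast
qed

section \<open>Normal forms\<close>

text \<open>
  The rows of the matrices of a framed representation: \<open>Inl (a, l)\<close> is row \<open>l\<close> of \<open>M\<^sub>a\<close>, and
  \<open>Inr (i, q)\<close> is row \<open>q\<close> of \<open>f\<^sub>i\<close>. If the paths of the skeleton \<open>S\<close> are a basis dual to the standard
  basis, then each of these rows is the row of a path, namely \<open>row_path S\<close>; the rows whose path
  lies in \<open>S\<close> are then unit vectors, and the others can be chosen freely.
\<close>

definition rows :: "('a \<times> nat + 'v \<times> nat) set" where
  "rows = Inl ` (SIGMA a:arcs Q. {..<\<alpha> (head Q a)}) \<union> Inr ` (SIGMA i:verts Q. {..<\<zeta> i})"

definition row_vert :: "'a \<times> nat + 'v \<times> nat \<Rightarrow> 'v" where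
  "row_vert = case_sum (\<lambda>(a, l). tail Q a) fst"

definition row_path :: "('v, 'a) ext_path set \<Rightarrow> 'a \<times> nat + 'v \<times> nat \<Rightarrow> ('v, 'a) ext_path" where
  "row_path S = case_sum (\<lambda>(a, l). (Some (tail Q a), Inl a # snd (path_nth S (head Q a) l)))
     (\<lambda>(i, q). (Some i, [Inr (i, q)]))"

definition entry :: "('v, 'a, 'f) framed_rep \<Rightarrow> 'a \<times> nat + 'v \<times> nat \<Rightarrow> nat \<Rightarrow> 'f" where
  "entry Mf = case_sum (\<lambda>(a, l) s. fst Mf a $$ (l, s)) (\<lambda>(i, q) s. snd Mf i $$ (q, s))"

definition of_entries :: "('a \<times> nat + 'v \<times> nat \<Rightarrow> nat \<Rightarrow> 'f) \<Rightarrow> ('v, 'a, 'f) framed_rep" where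
  "of_entries e = (\<lambda>a\<in>arcs Q. mat (\<alpha> (head Q a)) (\<alpha> (tail Q a)) (\<lambda>(l, s). e (Inl (a, l)) s),
           \<lambda>i\<in>verts Q. mat (\<zeta> i) (\<alpha> i) (\<lambda>(q, s). e (Inr (i, q)) s))"

lemma rows_simps [simp]:
  "Inl (a, l) \<in> rows \<longleftrightarrow> a \<in> arcs Q \<and> l < \<alpha> (head Q a)"
  "Inr (i, q) \<in> rows \<longleftrightarrow> i \<in> verts Q \<and> q < \<zeta> i"
  "row_vert (Inl (a, l)) = tail Q a" "row_vert (Inr (i, q)) = i"
  "row_path S (Inl (a, l)) = (Some (tail Q a), Inl a # snd (path_nth S (head Q a) l))"
  "row_path S (Inr (i, q)) = (Some i, [Inr (i, q)])"
  "entry Mf (Inl (a, l)) s = fst Mf a $$ (l, s)" "entry Mf (Inr (i, q)) s = snd Mf i $$ (q, s)"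
  by (auto simp: rows_def row_vert_def row_path_def entry_def)

lemma rows_cases [consumes 1, case_names arc frame]:
  assumes "\<rho> \<in> rows"
  obtains a l where "\<rho> = Inl (a, l)" "a \<in> arcs Q" "l < \<alpha> (head Q a)"
    | i q where "\<rho> = Inr (i, q)" "i \<in> verts Q" "q < \<zeta> i"
  using assms by (auto simp: rows_def)

lemma finite_rows [simp]: "finite rows"
  by (simp add: rows_def)

lemma row_vert_in [simp]: "\<rho> \<in> rows \<Longrightarrow> row_vert \<rho> \<in> verts Q"
  by (elim rows_cases) auto

lemma fst_row_path [simp]: "fst (row_path S \<rho>) = Some (row_vert \<rho>)"
  by (simp add: row_path_def row_vert_def split: sum.split prod.split)

lemma path_nth_pair:
  assumes "skel S" "i \<in> verts Q" "r < \<alpha> i"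
  shows "(Some i, snd (path_nth S i r)) = path_nth S i r"
  using path_nth_in(2)[OF assms] by (metis prod.collapse)

lemma row_path_npaths:
  assumes S: "skel S" and "\<rho> \<in> rows"
  shows "row_path S \<rho> \<in> npaths"
  using assms(2)
proof (cases rule: rows_cases)
  case (arc a l)
  then have "(Some (head Q a), snd (path_nth S (head Q a) l)) \<in> npaths"
    using path_nth_in(3)[OF S, of "head Q a" l] path_nth_pair[OF S, of "head Q a" l] by simp
  then show ?thesis using arc by (simp add: npaths_Inl)
next
  case (frame i q)
  then show ?thesis by (simp add: npaths_Inr)
qed

text \<open>The first arrow and the rest of the path determine the row, since
  \<open>path_nth\<close> is injective at a vertex.\<close>

lemma inj_on_row_path:
  assumes S: "skel S"
  shows "inj_on (row_path S) rows"
proof (rule inj_onI)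
  fix \<rho> \<rho>' assume \<rho>: "\<rho> \<in> rows" "\<rho>' \<in> rows" and eq: "row_path S \<rho> = row_path S \<rho>'"
  from \<rho>(1) show "\<rho> = \<rho>'"
  proof (cases rule: rows_cases)
    case (arc a l)
    note 1 = arc
    from \<rho>(2) show ?thesis
    proof (cases rule: rows_cases)
      case (arc a' l')
      then have aa: "a' = a" and "snd (path_nth S (head Q a) l) = snd (path_nth S (head Q a) l')"
        using eq 1 by auto
      then have "path_nth S (head Q a) l = path_nth S (head Q a) l'"
        using path_nth_pair[OF S arc_ends(2)[OF 1(2)] 1(3)] path_nth_pair[OF S arc_ends(2)[OF 1(2)], of l'] arc(3) aa
        by metis
      then show ?thesis
        using path_nth_inj[OF S arc_ends(2)[OF 1(2)] 1(3), of l'] arc 1 aa by simp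
    next
      case (frame i q)
      then show ?thesis using eq 1 by simp
    qed
  next
    case (frame i q)
    note 1 = frame
    from \<rho>(2) show ?thesis
    proof (cases rule: rows_cases)
      case (arc a' l')
      then show ?thesis using eq 1 by simp
    next
      case (frame i' q')
      then show ?thesis using eq 1 by simp
    qed
  qed
qed

text \<open>Suffix closure: with \<open>\<tau> a\<close> also \<tau> lies in \<open>S\<close>, and
  its position \<open>l\<close> there names row \<open>l\<close> of \<open>M_a\<close>. Thus a
  skeleton prescribes exactly as many rows as it has paths.\<close>

lemma row_path_surj:
  assumes S: "skel S" and \<pi>: "\<pi> \<in> S"
  shows "\<exists>\<rho>\<in>rows. row_path S \<rho> = \<pi>"
proof -
  have "\<pi> \<in> npaths" using skelD(1)[OF S] \<pi> by blast
  then show ?thesis using \<pi>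
  proof (induction rule: npaths_induct)
    case (frame i q)
    then show ?case by (intro bexI[of _ "Inr (i, q)"]) auto
  next
    case (arc a p)
    then have "(Some (head Q a), p) \<in> S" using skelD(3)[OF S] by (auto simp: suffix_closed_def)
    from path_nth_path_idx[OF S arc_ends(2)[OF arc(1)] this] arc(1) show ?case
      by (intro bexI[of _ "Inl (a, path_idx S (head Q a) (Some (head Q a), p))"]) auto
  qed
qed

lemma of_entries_framed_reps [simp]: "of_entries e \<in> reps"
  by (auto simp: of_entries_def framed_reps_def)

lemma entry_of_entries: "\<rho> \<in> rows \<Longrightarrow> s < \<alpha> (row_vert \<rho>) \<Longrightarrow> entry (of_entries e) \<rho> s = e \<rho> s"
  by (elim rows_cases) (auto simp: of_entries_def)

lemma framed_rep_eqI:
  assumes M: "Mf \<in> reps" "Mf' \<in> reps"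
    and eq: "\<And>\<rho> s. \<rho> \<in> rows \<Longrightarrow> s < \<alpha> (row_vert \<rho>) \<Longrightarrow> entry Mf \<rho> s = entry Mf' \<rho> s"
  shows "Mf = Mf'"
proof (rule prod_eqI)
  have "fst Mf a = fst Mf' a" if a: "a \<in> arcs Q" for a
  proof (rule eq_matI)
    fix l s assume "l < dim_row (fst Mf' a)" "s < dim_col (fst Mf' a)"
    then show "fst Mf a $$ (l, s) = fst Mf' a $$ (l, s)"
      using framed_reps_fst[OF M(2) a] eq[of "Inl (a, l)" s] a by simp
  qed (use framed_reps_fst[OF M(1) a] framed_reps_fst[OF M(2) a] in auto)
  then show "fst Mf = fst Mf'"
    using M by (intro PiE_ext[of "fst Mf" "arcs Q"]) (auto simp: framed_reps_def)
  have "snd Mf i = snd Mf' i" if i: "i \<in> verts Q" for i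
  proof (rule eq_matI)
    fix l s assume "l < dim_row (snd Mf' i)" "s < dim_col (snd Mf' i)"
    then show "snd Mf i $$ (l, s) = snd Mf' i $$ (l, s)"
      using framed_reps_snd[OF M(2) i] eq[of "Inr (i, l)" s] i by simp
  qed (use framed_reps_snd[OF M(1) i] framed_reps_snd[OF M(2) i] in auto)
  then show "snd Mf = snd Mf'"
    using M by (intro PiE_ext[of "snd Mf" "verts Q"]) (auto simp: framed_reps_def)
qed

text \<open>When the minors are 1, the path at position \<open>l\<close> has the unit vector
  \<open>e_l\<close> as its row, and \<open>e_l M_a\<close> is row \<open>l\<close> of
  \<open>M_a\<close>.\<close>

lemma path_row_row_path_normal:
  assumes Mf: "Mf \<in> reps" and S: "skel S"
    and one: "\<And>i. i \<in> verts Q \<Longrightarrow> row_mat S Mf i = 1\<^sub>m (\<alpha> i)"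
    and \<rho>: "\<rho> \<in> rows" and s: "s < \<alpha> (row_vert \<rho>)"
  shows "path_row Mf (row_path S \<rho>) s = entry Mf \<rho> s"
  using \<rho>
proof (cases rule: rows_cases)
  case (arc a l)
  note h = arc_ends(2)[OF arc(2)]
  have "path_row Mf (path_nth S (head Q a) l) l' = (if l' = l then 1 else 0)" if "l' < \<alpha> (head Q a)" for l'
    using arg_cong[OF one[OF h], of "\<lambda>A. A $$ (l, l')"] that arc(3) by (auto simp: row_mat_def)
  moreover have "(Some (head Q a), snd (path_nth S (head Q a) l)) \<in> npaths"
    using path_nth_in(3)[OF S h arc(3)] path_nth_pair[OF S h arc(3)] by simp
  ultimately show ?thesis
    using path_row_arc[OF Mf arc(2), of "snd (path_nth S (head Q a) l)" s] path_nth_pair[OF S h arc(3)] s arc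
    by (simp add: if_distrib[of "\<lambda>x. x * _"] cong: if_cong)
next
  case (frame i q)
  then show ?thesis using path_row_frame[OF Mf frame(2,3)] s by simp
qed

section \<open>Free entries and the dimension of a chart\<close>

definition free_entries :: "('v, 'a) ext_path set \<Rightarrow> (('a \<times> nat + 'v \<times> nat) \<times> nat) set" where
  "free_entries S = (SIGMA \<rho>:{\<rho> \<in> rows. row_path S \<rho> \<notin> S}. {..<\<alpha> (row_vert \<rho>)})"

text \<open>All entries minus those of the prescribed rows. The subtraction does not truncate when a
  skeleton exists, because the second sum then counts a subset of what the first one counts. No
  skeleton enters, which gives one dimension for all charts.\<close>

definition chart_dim :: nat where
  "chart_dim = (\<Sum>\<rho>\<in>rows. \<alpha> (row_vert \<rho>)) - (\<Sum>i\<in>verts Q. \<alpha> i * \<alpha> i)"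

text \<open>The prescribed rows correspond to the paths of \<open>S\<close>; there are
  \<open>\<alpha> i\<close> of these at \<open>i\<close>, each fixing \<open>\<alpha> i\<close>
  entries.\<close>

lemma card_free_entries:
  assumes S: "skel S"
  shows "card (free_entries S) = chart_dim"
proof -
  have Sun: "S = (\<Union>i\<in>verts Q. paths_at S i)"
    using skelD(1)[OF S] by (auto simp: paths_at_def elim!: npaths_vert)
  have img: "row_path S ` {\<rho> \<in> rows. row_path S \<rho> \<in> S} = S"
  proof (intro equalityI subsetI)
    fix \<pi> assume \<pi>: "\<pi> \<in> S"
    then obtain \<rho> where "\<rho> \<in> rows" "row_path S \<rho> = \<pi>" using row_path_surj[OF S] by blast
    then show "\<pi> \<in> row_path S ` {\<rho> \<in> rows. row_path S \<rho> \<in> S}" using \<pi> by blast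
  qed auto
  have "(\<Sum>\<rho>\<in>{\<rho> \<in> rows. row_path S \<rho> \<in> S}. \<alpha> (row_vert \<rho>)) =
      (\<Sum>\<rho>\<in>{\<rho> \<in> rows. row_path S \<rho> \<in> S}. \<alpha> (the (fst (row_path S \<rho>))))" by simp
  also have "\<dots> = (\<Sum>\<pi>\<in>row_path S ` {\<rho> \<in> rows. row_path S \<rho> \<in> S}. \<alpha> (the (fst \<pi>)))"
    by (rule sum.reindex[symmetric, unfolded o_def]) (rule inj_on_subset[OF inj_on_row_path[OF S]], auto)
  also have "\<dots> = (\<Sum>\<pi>\<in>(\<Union>i\<in>verts Q. paths_at S i). \<alpha> (the (fst \<pi>)))" using img Sun by simp
  also have "\<dots> = (\<Sum>i\<in>verts Q. \<Sum>\<pi>\<in>paths_at S i. \<alpha> (the (fst \<pi>)))"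
    using skelD(2)[OF S] by (intro sum.UNION_disjoint) (auto simp: paths_at_def)
  also have "\<dots> = (\<Sum>i\<in>verts Q. \<Sum>\<pi>\<in>paths_at S i. \<alpha> i)"
    by (intro sum.cong refl) (simp add: paths_at_def)
  also have "\<dots> = (\<Sum>i\<in>verts Q. \<alpha> i * \<alpha> i)" using skelD(4)[OF S] by simp
  finally have 1: "(\<Sum>\<rho>\<in>{\<rho> \<in> rows. row_path S \<rho> \<in> S}. \<alpha> (row_vert \<rho>)) = (\<Sum>i\<in>verts Q. \<alpha> i * \<alpha> i)" .
  have "(\<Sum>\<rho>\<in>rows. \<alpha> (row_vert \<rho>)) =
      (\<Sum>\<rho>\<in>{\<rho> \<in> rows. row_path S \<rho> \<in> S}. \<alpha> (row_vert \<rho>)) + (\<Sum>\<rho>\<in>{\<rho> \<in> rows. row_path S \<rho> \<notin> S}. \<alpha> (row_vert \<rho>))"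
  proof -
    have "rows = {\<rho> \<in> rows. row_path S \<rho> \<in> S} \<union> {\<rho> \<in> rows. row_path S \<rho> \<notin> S}" by blast
    then have "(\<Sum>\<rho>\<in>rows. \<alpha> (row_vert \<rho>)) =
        (\<Sum>\<rho>\<in>{\<rho> \<in> rows. row_path S \<rho> \<in> S} \<union> {\<rho> \<in> rows. row_path S \<rho> \<notin> S}. \<alpha> (row_vert \<rho>))" by simp
    also have "\<dots> = (\<Sum>\<rho>\<in>{\<rho> \<in> rows. row_path S \<rho> \<in> S}. \<alpha> (row_vert \<rho>)) +
        (\<Sum>\<rho>\<in>{\<rho> \<in> rows. row_path S \<rho> \<notin> S}. \<alpha> (row_vert \<rho>))"
      by (intro sum.union_disjoint) auto
    finally show ?thesis .
  qed
  moreover have "card (free_entries S) = (\<Sum>\<rho>\<in>{\<rho> \<in> rows. row_path S \<rho> \<notin> S}. \<alpha> (row_vert \<rho>))"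
    by (simp add: free_entries_def)
  ultimately show ?thesis using 1 by (simp add: chart_dim_def)
qed

definition free_nth :: "('v, 'a) ext_path set \<Rightarrow> nat \<Rightarrow> ('a \<times> nat + 'v \<times> nat) \<times> nat" where
  "free_nth S = (SOME e. bij_betw e {..<chart_dim} (free_entries S))"

definition free_idx :: "('v, 'a) ext_path set \<Rightarrow> ('a \<times> nat + 'v \<times> nat) \<times> nat \<Rightarrow> nat" where
  "free_idx S = inv_into {..<chart_dim} (free_nth S)"

lemma free_nth_bij:
  assumes "skel S"
  shows "bij_betw (free_nth S) {..<chart_dim} (free_entries S)"
proof -
  have "finite (free_entries S)" by (auto simp: free_entries_def)
  then have "\<exists>e. bij_betw e {..<chart_dim} (free_entries S)"
    using ex_bij_betw_nat_finite[of "free_entries S"] card_free_entries[OF assms] by (simp add: atLeast0LessThan)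
  then show ?thesis unfolding free_nth_def by (rule someI_ex)
qed

lemma free_nth_free_idx:
  assumes "skel S" "k < chart_dim"
  shows "free_nth S k \<in> free_entries S" "free_idx S (free_nth S k) = k"
  using bij_betwE[OF free_nth_bij[OF assms(1)]] bij_betw_imp_inj_on[OF free_nth_bij[OF assms(1)]] assms(2)
  by (auto simp: free_idx_def)

lemma free_idx_free_nth:
  assumes "skel S" "x \<in> free_entries S"
  shows "free_idx S x < chart_dim" "free_nth S (free_idx S x) = x"
proof -
  have "x \<in> free_nth S ` {..<chart_dim}" using free_nth_bij[OF assms(1)] assms(2) by (simp add: bij_betw_def)
  from inv_into_into[OF this] f_inv_into_f[OF this]
  show "free_idx S x < chart_dim" "free_nth S (free_idx S x) = x" by (simp_all add: free_idx_def)
qed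

definition normal_form :: "('v, 'a) ext_path set \<Rightarrow> 'f::field vec \<Rightarrow> ('v, 'a, 'f) framed_rep" where
  "normal_form S v = of_entries (\<lambda>\<rho> s. if row_path S \<rho> \<in> S then if path_nth S (row_vert \<rho>) s = row_path S \<rho> then 1 else 0
     else v $ free_idx S (\<rho>, s))"

lemma normal_form_framed_reps [simp]: "normal_form S v \<in> reps"
  by (simp add: normal_form_def)

lemma entry_normal_form:
  "\<rho> \<in> rows \<Longrightarrow> s < \<alpha> (row_vert \<rho>) \<Longrightarrow> entry (normal_form S v) \<rho> s =
    (if row_path S \<rho> \<in> S then if path_nth S (row_vert \<rho>) s = row_path S \<rho> then 1 else 0 else v $ free_idx S (\<rho>, s))"
  by (simp add: normal_form_def entry_of_entries)

text \<open>Induction inside \<open>S\<close>, possible by suffix closure: \<tau> has a unit vector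
  as its row, so \<open>\<tau> a\<close> reads off a single row of \<open>M_a\<close>, and that row
  was prescribed to be the unit vector at the position of \<open>\<tau> a\<close>.\<close>

lemma path_row_normal_form:
  assumes S: "skel S" and \<pi>: "\<pi> \<in> S" and s: "s < \<alpha> (the (fst \<pi>))"
  shows "path_row (normal_form S v) \<pi> s = (if path_nth S (the (fst \<pi>)) s = \<pi> then 1 else 0)"
proof -
  have "\<pi> \<in> npaths" using skelD(1)[OF S] \<pi> by blast
  then show ?thesis using \<pi> s
  proof (induction arbitrary: s rule: npaths_induct)
    case (frame i q)
    then show ?case
      using path_row_frame[OF normal_form_framed_reps frame(1,2), of s S v] entry_normal_form[of "Inr (i, q)" s S v] by simp
  next
    case (arc a p)
    let ?\<tau> = "(Some (head Q a), p)"
    have \<tau>: "?\<tau> \<in> S" using skelD(3)[OF S] arc.prems(1) by (auto simp: suffix_closed_def)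
    define l where "l = path_idx S (head Q a) ?\<tau>"
    have l: "l < \<alpha> (head Q a)" "path_nth S (head Q a) l = ?\<tau>"
      using path_nth_path_idx[OF S arc_ends(2)[OF arc.hyps(1)] \<tau>] by (auto simp: l_def)
    have "path_row (normal_form S v) ?\<tau> l' = (if l' = l then 1 else 0)" if "l' < \<alpha> (head Q a)" for l'
      using arc.IH[OF \<tau>, of l'] that l path_nth_inj[OF S arc_ends(2)[OF arc.hyps(1)] that l(1)] by simp
    then have "path_row (normal_form S v) (Some (tail Q a), Inl a # p) s = fst (normal_form S v) a $$ (l, s)"
      using path_row_arc[OF normal_form_framed_reps arc.hyps(1,2), of s S v] arc.prems(2) l(1)
      by (simp add: if_distrib[of "\<lambda>x. x * _"] cong: if_cong)
    also have "\<dots> = entry (normal_form S v) (Inl (a, l)) s" by simp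
    finally show ?case
      using entry_normal_form[of "Inl (a, l)" s S v] arc.hyps(1) arc.prems l by simp
  qed
qed

lemma row_mat_normal_form:
  assumes S: "skel S" and i: "i \<in> verts Q"
  shows "row_mat S (normal_form S v) i = 1\<^sub>m (\<alpha> i)"
proof (rule eq_matI)
  fix r s assume "r < dim_row (1\<^sub>m (\<alpha> i) :: 'b mat)" "s < dim_col (1\<^sub>m (\<alpha> i) :: 'b mat)"
  then have rs: "r < \<alpha> i" "s < \<alpha> i" by auto
  then show "row_mat S (normal_form S v) i $$ (r, s) = 1\<^sub>m (\<alpha> i) $$ (r, s)"
    using path_row_normal_form[OF S path_nth_in(1)[OF S i rs(1)], of s v] path_nth_in(2)[OF S i rs(1)] path_nth_inj[OF S i rs]
    by (auto simp: row_mat_def)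
qed (simp_all add: row_mat_def)

lemma normal_form_in_chart: "skel S \<Longrightarrow> normal_form S v \<in> cell S"
  by (simp add: stable_with_skeleton_eq row_mat_normal_form)

text \<open>Over any field, the normal form with all free entries 0 realises a given combinatorial
  skeleton.\<close>

lemma J_skeleta_eq: "J_skeleta TYPE('f::field) Q \<alpha> \<zeta> = {S. skel S}"
proof (intro equalityI subsetI)
  fix S assume "S \<in> J_skeleta TYPE('f) Q \<alpha> \<zeta>"
  then obtain Mf :: "('v, 'a, 'f) framed_rep"
    where "Mf \<in> stables" "J_skeleton Q \<alpha> \<zeta> Mf S" by (auto simp: J_skeleta_def)
  from J_skeleton_imp_skel[OF this] show "S \<in> {S. skel S}" by simp
next
  fix S assume "S \<in> {S. skel S}"
  then have "(normal_form S (0\<^sub>v chart_dim) :: ('v, 'a, 'f) framed_rep) \<in> cell S"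
    by (simp add: normal_form_in_chart)
  then show "S \<in> J_skeleta TYPE('f) Q \<alpha> \<zeta>"
    unfolding J_skeleta_def stable_with_skeleton_def by blast
qed

lemma stable_pairs_eq_Union:
  "stables = (\<Union>S\<in>{S. skel S}. cell S)"
proof (intro equalityI subsetI)
  fix Mf assume st: "Mf \<in> stables"
  then obtain S where S: "skel S" "row_injective Mf S" using exists_skel by blast
  then have "Mf \<in> cell S"
    using st stable_pairs_iff[of Mf] det_row_mat_iff[OF S(1), of Mf] by (simp add: stable_with_skeleton_eq)
  then show "Mf \<in> (\<Union>S\<in>{S. skel S}. cell S)" using S(1) by blast
qed (auto simp: stable_with_skeleton_def)

section \<open>Exchange of path ends\<close>

lemma npaths_unique_vert: "(u, p) \<in> npaths \<Longrightarrow> (u', p) \<in> npaths \<Longrightarrow> u = u'"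
proof (cases p)
  case (Cons b p')
  then show "(u, p) \<in> npaths \<Longrightarrow> (u', p) \<in> npaths \<Longrightarrow> u = u'"
    by (cases b) (auto simp: npaths_Inl npaths_Inr)
qed simp

lemma suffix_closed_append:
  assumes "suffix_closed S" "S \<subseteq> npaths" "(u, l @ p) \<in> S" "p \<noteq> []"
  shows "\<exists>u'. (u', p) \<in> S"
  using assms(3)
proof (induction l arbitrary: u)
  case (Cons b l)
  have n: "(u, b # l @ p) \<in> npaths" using Cons.prems assms(2) by auto
  show ?case
  proof (cases b)
    case (Inl a)
    then show ?thesis
      using Cons n assms(1) by (auto simp: npaths_Inl suffix_closed_def)
  next
    case (Inr iq)
    then show ?thesis using n assms(4) by (cases iq) (auto simp: npaths_Inr)
  qed
qed auto

lemma npaths_replace_suffix: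
  assumes "(u, l @ p) \<in> npaths" "(v, p) \<in> npaths" "(v, p') \<in> npaths"
  shows "(u, l @ p') \<in> npaths"
  using assms(1)
proof (induction l arbitrary: u)
  case Nil
  then show ?case using npaths_unique_vert[OF _ assms(2)] assms(3) by auto
next
  case (Cons b l)
  show ?case
  proof (cases b)
    case (Inl a)
    then show ?thesis using Cons by (auto simp: npaths_Inl)
  next
    case (Inr iq)
    then show ?thesis using Cons.prems assms(2) by (cases iq) (auto simp: npaths_Inr)
  qed
qed

text \<open>
  If \<open>\<pi>\<close> is a path of \<open>S\<close> starting at \<open>i\<close>, replace the end \<open>\<pi>\<close> by the arrow \<open>f\<^sub>i\<^sub>q\<close> in all paths of \<open>S\<close> ending in \<open>\<pi>\<close>.
  This shows that \<open>f\<^sub>i\<^sub>q\<close> is among the coordinates of \<open>J\<close>-hat.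
\<close>

lemma framing_arrow_in_skel:
  assumes S: "skel S" and i: "i \<in> verts Q" and q: "q < \<zeta> i" and \<alpha>: "0 < \<alpha> i"
  shows "\<exists>S'. skel S' \<and> (Some i, [Inr (i, q)]) \<in> S'"
proof (cases "(Some i, [Inr (i, q)]) \<in> S")
  case False
  let ?f = "[Inr (i, q)] :: ('a + 'v \<times> nat) list"
  have fn: "(Some i, ?f) \<in> npaths" using i q by (simp add: npaths_Inr)
  \<comment> \<open>Any path of \<open>S\<close> starting at \<open>i\<close>; it exists because
    \<open>\<alpha> i\<close> is positive.\<close>
  obtain p0 where p0: "(Some i, p0) \<in> S"
    using path_nth_in[OF S i \<alpha>] by (metis prod.collapse)
  then have p0n: "(Some i, p0) \<in> npaths" and p0ne: "p0 \<noteq> []" using skelD(1)[OF S] by auto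
  \<comment> \<open>Lists are in the order of application, so the end of a path is the tail of its
    list; \<open>take\<close> recovers what comes before \<open>p0\<close>.\<close>
  define rep where "rep \<pi> = (if \<exists>l. snd \<pi> = l @ p0
    then (fst \<pi>, take (length (snd \<pi>) - length p0) (snd \<pi>) @ ?f) else \<pi>)"
    for \<pi> :: "('v, 'a) ext_path"
  have rep1: "rep (u, l @ p0) = (u, l @ ?f)" for u l by (auto simp: rep_def)
  have rep2: "rep \<pi> = \<pi>" if "\<nexists>l. snd \<pi> = l @ p0" for \<pi> using that by (simp add: rep_def)
  have fst_rep: "fst (rep \<pi>) = fst \<pi>" for \<pi> by (simp add: rep_def)
  \<comment> \<open>No replaced path lies in \<open>S\<close> already, since suffix closure would
    put the framing arrow itself there. This is what makes the replacement injective.\<close>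
  have no: "(u, l @ ?f) \<notin> S" for u l
  proof
    assume "(u, l @ ?f) \<in> S"
    then obtain u' where u': "(u', ?f) \<in> S"
      using suffix_closed_append[OF skelD(3,1)[OF S]] by blast
    then have "u' = Some i" using npaths_unique_vert[OF _ fn] skelD(1)[OF S] by blast
    then show False using u' False by simp
  qed
  have inj: "inj_on rep S"
  proof (rule inj_onI)
    fix \<pi> \<pi>' assume \<pi>: "\<pi> \<in> S" "\<pi>' \<in> S" "rep \<pi> = rep \<pi>'"
    obtain u p where up: "\<pi> = (u, p)" by (cases \<pi>)
    obtain u' p' where up': "\<pi>' = (u', p')" by (cases \<pi>')
    have u: "u = u'" using fst_rep[of \<pi>] fst_rep[of \<pi>'] \<pi>(3) up up' by simp
    show "\<pi> = \<pi>'"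
    proof (cases "\<exists>l. p = l @ p0")
      case True
      then obtain l where l: "p = l @ p0" by blast
      show ?thesis
      proof (cases "\<exists>l. p' = l @ p0")
        case True
        then obtain l' where l': "p' = l' @ p0" by blast
        then show ?thesis using \<pi>(3) rep1 up up' l u by simp
      next
        case F: False
        then have "\<pi>' = (u, l @ ?f)" using \<pi>(3) rep1 rep2[of \<pi>'] up up' l by simp
        then show ?thesis using no \<pi>(2) by simp
      qed
    next
      case F: False
      show ?thesis
      proof (cases "\<exists>l. p' = l @ p0")
        case True
        then obtain l' where l': "p' = l' @ p0" by blast
        then have "\<pi> = (u', l' @ ?f)" using \<pi>(3) rep1 rep2[of \<pi>] up up' F by simp
        then show ?thesis using no \<pi>(1) by simp
      next
        case F': False
        then show ?thesis using \<pi>(3) rep2[of \<pi>] rep2[of \<pi>'] up up' F by simp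
      qed
    qed
  qed
  have sub: "rep ` S \<subseteq> npaths"
  proof
    fix \<pi> assume "\<pi> \<in> rep ` S"
    then obtain u p where up: "(u, p) \<in> S" "\<pi> = rep (u, p)" by auto
    then have n: "(u, p) \<in> npaths" using skelD(1)[OF S] by blast
    show "\<pi> \<in> npaths"
    proof (cases "\<exists>l. p = l @ p0")
      case True
      then obtain l where l: "p = l @ p0" by blast
      then show ?thesis using npaths_replace_suffix[OF _ p0n fn, of u l] n up rep1 by simp
    next
      case F: False
      then show ?thesis using rep2[of "(u, p)"] up n by simp
    qed
  qed
  have closed: "suffix_closed (rep ` S)"
    unfolding suffix_closed_def
  proof (intro allI impI)
    fix a p' assume "(Some (tail Q a), Inl a # p') \<in> rep ` S"
    then obtain u p where up: "(u, p) \<in> S" "(Some (tail Q a), Inl a # p') = rep (u, p)" by auto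
    have u: "u = Some (tail Q a)" using fst_rep[of "(u, p)"] up(2)[symmetric] by simp
    show "(Some (head Q a), p') \<in> rep ` S"
    proof (cases "\<exists>l. p = l @ p0")
      case True
      then obtain l where l: "p = l @ p0" by blast
      then have "Inl a # p' = l @ ?f" using up(2) rep1 by simp
      \<comment> \<open>\<open>l\<close> is not empty, since \<open>a\<close> is not a framing
        arrow; so stripping \<open>a\<close> commutes with the replacement.\<close>
      then obtain l' where l': "l = Inl a # l'" "p' = l' @ ?f" by (cases l) auto
      then have "(Some (head Q a), l' @ p0) \<in> S"
        using up(1) u l skelD(3)[OF S] by (auto simp: suffix_closed_def)
      then show ?thesis using rep1 l'(2) by (metis image_eqI)
    next
      case F: False
      then have p: "p = Inl a # p'" using up(2) rep2[of "(u, p)"] by simp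
      then have h: "(Some (head Q a), p') \<in> S"
        using up(1) u skelD(3)[OF S] by (auto simp: suffix_closed_def)
      have "\<nexists>l. p' = l @ p0" using F p by (metis append_Cons)
      then show ?thesis using rep2[of "(Some (head Q a), p')"] h by (metis image_eqI snd_conv)
    qed
  qed
  have "card (paths_at (rep ` S) k) = \<alpha> k" if k: "k \<in> verts Q" for k
  proof -
    have "paths_at (rep ` S) k = rep ` paths_at S k" using fst_rep by (auto simp: paths_at_def)
    moreover have "inj_on rep (paths_at S k)" by (rule inj_on_subset[OF inj]) (auto simp: paths_at_def)
    ultimately show ?thesis using skelD(4)[OF S k] card_image by metis
  qed
  then have "skel (rep ` S)" using sub closed skelD(2)[OF S] by (simp add: skel_def)
  moreover have "(Some i, ?f) \<in> rep ` S" using rep1[of "Some i" "[]"] p0 by force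
  ultimately show ?thesis by blast
qed (use S in blast)

section \<open>The coordinates of J-hat\<close>

definition Gam_ext :: "('v, 'a) ext_path set" where
  "Gam_ext = \<Union>{S. skel S} \<union> {(Some (tail Q a), Inl a # p) | a p. a \<in> arcs Q \<and> (Some (head Q a), p) \<in> \<Union>{S. skel S}}"

definition Gam_at :: "'v \<Rightarrow> ('v, 'a) ext_path set" where
  "Gam_at i = {\<pi> \<in> Gam_ext. fst \<pi> = Some i}"

text \<open>The index set is defined by skeleta over the ground field but serves for coordinates
  over its algebraic closure; the skeleta being the same, this makes no difference.\<close>

lemma Gam_tilde_eq: "Gam_tilde TYPE('f::field) Q \<alpha> \<zeta> = Gam_ext"
  by (simp add: Gam_tilde_def Gam_def J_skeleta_eq Gam_ext_def)

lemma Gam_ext_npaths: "Gam_ext \<subseteq> npaths"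
proof -
  have "\<Union>{S. skel S} \<subseteq> npaths" using skelD(1) by blast
  then show ?thesis by (auto simp: Gam_ext_def npaths_Inl)
qed

lemma GiD: "\<pi> \<in> Gam_at i \<Longrightarrow> \<pi> \<in> npaths" "\<pi> \<in> Gam_at i \<Longrightarrow> fst \<pi> = Some i"
  using Gam_ext_npaths by (auto simp: Gam_at_def)

lemma path_nth_Gam_at: "skel S \<Longrightarrow> i \<in> verts Q \<Longrightarrow> r < \<alpha> i \<Longrightarrow> path_nth S i r \<in> Gam_at i"
  using path_nth_in[of S i r] by (auto simp: Gam_at_def Gam_ext_def)

text \<open>Makes the free entries readable from the coordinates of J-hat. The exchange of path ends
  needs a path at the vertex, hence the positive dimension; a row of length 0 has no entries to be
  read.\<close>

lemma row_path_Gam_at: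
  assumes S: "skel S" and \<rho>: "\<rho> \<in> rows" and \<alpha>: "0 < \<alpha> (row_vert \<rho>)"
  shows "row_path S \<rho> \<in> Gam_at (row_vert \<rho>)"
  using \<rho>
proof (cases rule: rows_cases)
  case (arc a l)
  note h = arc_ends(2)[OF arc(2)]
  have "(Some (head Q a), snd (path_nth S (head Q a) l)) \<in> S"
    using path_nth_in(1)[OF S h arc(3)] path_nth_pair[OF S h arc(3)] by simp
  then show ?thesis using arc S by (auto simp: Gam_at_def Gam_ext_def)
next
  case (frame i q)
  then show ?thesis using framing_arrow_in_skel[OF S frame(2,3)] \<alpha> by (auto simp: Gam_at_def Gam_ext_def)
qed

section \<open>The group action on a chart\<close>

text \<open>The row as a matrix, so that associativity of matrix products is available.\<close>

definition path_vec :: "('v, 'a, 'f::field) framed_rep \<Rightarrow> ('v, 'a) ext_path \<Rightarrow> 'f mat" where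
  "path_vec Mf \<pi> = mat 1 (\<alpha> (the (fst \<pi>))) (\<lambda>(_, l). path_row Mf \<pi> l)"

lemma path_vec_carrier [simp]: "path_vec Mf \<pi> \<in> carrier_mat 1 (\<alpha> (the (fst \<pi>)))"
  by (simp add: path_vec_def)

lemma path_vec_frame:
  assumes "Mf \<in> reps" "i \<in> verts Q" "q < \<zeta> i"
  shows "path_vec Mf (Some i, [Inr (i, q)]) = mat 1 (\<alpha> i) (\<lambda>(_, l). snd Mf i $$ (q, l))"
  using path_row_frame[OF assms] by (intro eq_matI) (auto simp: path_vec_def)

lemma path_vec_arc:
  assumes "Mf \<in> reps" "a \<in> arcs Q" "(Some (head Q a), p) \<in> npaths"
  shows "path_vec Mf (Some (tail Q a), Inl a # p) = path_vec Mf (Some (head Q a), p) * fst Mf a"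
proof (rule eq_matI)
  note M = framed_reps_fst[OF assms(1,2)]
  fix r j assume "r < dim_row (path_vec Mf (Some (head Q a), p) * fst Mf a)"
    "j < dim_col (path_vec Mf (Some (head Q a), p) * fst Mf a)"
  then have r: "r = 0" and j: "j < \<alpha> (tail Q a)" using M by (auto simp: path_vec_def)
  have "(path_vec Mf (Some (head Q a), p) * fst Mf a) $$ (0, j) =
      (\<Sum>l<\<alpha> (head Q a). path_vec Mf (Some (head Q a), p) $$ (0, l) * fst Mf a $$ (l, j))"
    using mat_index_mult[OF path_vec_carrier, of "fst Mf a"] M j by simp
  then show "path_vec Mf (Some (tail Q a), Inl a # p) $$ (r, j) = (path_vec Mf (Some (head Q a), p) * fst Mf a) $$ (r, j)"
    using path_row_arc[OF assms j] j r by (simp add: path_vec_def)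
qed (use framed_reps_fst[OF assms(1,2)] in \<open>auto simp: path_vec_def\<close>)

lemma GL_iff: "g \<in> GL Q \<alpha> \<longleftrightarrow> g \<in> extensional (verts Q) \<and>
    (\<forall>i\<in>verts Q. g i \<in> carrier_mat (\<alpha> i) (\<alpha> i) \<and> det (g i) \<noteq> (0::'f::field))"
  by (auto simp: GL_def PiE_iff invertible_mat_iff_det)

lemma GL_D:
  assumes "g \<in> GL Q \<alpha>" "i \<in> verts Q"
  shows "g i \<in> carrier_mat (\<alpha> i) (\<alpha> i)" "det (g i) \<noteq> (0::'f::field)"
  using assms by (auto simp: GL_iff)

lemma GL_act_apply:
  assumes "g \<in> GL Q \<alpha>"
  shows "a \<in> arcs Q \<Longrightarrow> fst (GL_act Q g Mf) a = g (head Q a) * fst Mf a * minv (g (tail Q a))"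
    and "i \<in> verts Q \<Longrightarrow> snd (GL_act Q g Mf) i = snd Mf i * minv (g i)"
  using the_mat_inverse[OF GL_D[OF assms]] by (auto simp: GL_act_def split_beta)

lemma GL_act_framed_reps:
  assumes g: "g \<in> GL Q \<alpha>" and Mf: "Mf \<in> reps"
  shows "GL_act Q g Mf \<in> reps"
proof -
  have "fst (GL_act Q g Mf) a \<in> carrier_mat (\<alpha> (head Q a)) (\<alpha> (tail Q a))" if a: "a \<in> arcs Q" for a
    unfolding GL_act_apply(1)[OF g a]
    by (rule mult_carrier_mat[OF mult_carrier_mat[OF GL_D(1)[OF g arc_ends(2)[OF a]] framed_reps_fst[OF Mf a]]
          minv_carrier[OF GL_D(1)[OF g arc_ends(1)[OF a]]]])
  moreover have "snd (GL_act Q g Mf) i \<in> carrier_mat (\<zeta> i) (\<alpha> i)" if i: "i \<in> verts Q" for i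
    unfolding GL_act_apply(2)[OF g i]
    by (rule mult_carrier_mat[OF framed_reps_snd[OF Mf i] minv_carrier[OF GL_D(1)[OF g i]]])
  moreover have "fst (GL_act Q g Mf) \<in> extensional (arcs Q)" "snd (GL_act Q g Mf) \<in> extensional (verts Q)"
    by (auto simp: GL_act_def split_beta)
  ultimately show ?thesis by (simp add: framed_reps_def mem_Times_iff PiE_iff)
qed

text \<open>The group elements cancel at every inner vertex of the path and act trivially at
  infinity, so only the inverse at the tail survives.\<close>

lemma path_vec_GL_act:
  assumes g: "g \<in> GL Q \<alpha>" and Mf: "Mf \<in> reps" and \<pi>: "\<pi> \<in> npaths"
  shows "path_vec (GL_act Q g Mf) \<pi> = path_vec Mf \<pi> * minv (g (the (fst \<pi>)))"
  using \<pi>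
proof (induction rule: npaths_induct)
  case (frame i q)
  note c = GL_D(1)[OF g frame(1)]
  note f = framed_reps_snd[OF Mf frame(1)]
  have R: "mat 1 (\<alpha> i) (\<lambda>(_, l). snd Mf i $$ (q, l)) \<in> carrier_mat 1 (\<alpha> i)" by simp
  show ?case
    unfolding path_vec_frame[OF GL_act_framed_reps[OF g Mf] frame] path_vec_frame[OF Mf frame] option.sel fst_conv
      GL_act_apply(2)[OF g frame(1)]
  proof (rule eq_matI)
    fix r j assume "r < dim_row (mat 1 (\<alpha> i) (\<lambda>(_, l). snd Mf i $$ (q, l)) * minv (g i))"
      "j < dim_col (mat 1 (\<alpha> i) (\<lambda>(_, l). snd Mf i $$ (q, l)) * minv (g i))"
    then have r: "r = 0" and j: "j < \<alpha> i" using minv_carrier[OF c] by auto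
    show "mat 1 (\<alpha> i) (\<lambda>(_, l). (snd Mf i * minv (g i)) $$ (q, l)) $$ (r, j) =
        (mat 1 (\<alpha> i) (\<lambda>(_, l). snd Mf i $$ (q, l)) * minv (g i)) $$ (r, j)"
      using mat_index_mult[OF f minv_carrier[OF c] frame(2) j] mat_index_mult[OF R minv_carrier[OF c] _ j, of 0] r j
      by simp
  qed (use minv_carrier[OF c] in auto)
next
  case (arc a p)
  note h = GL_D[OF g arc_ends(2)[OF arc.hyps(1)]] and t = GL_D[OF g arc_ends(1)[OF arc.hyps(1)]]
  note M = framed_reps_fst[OF Mf arc.hyps(1)]
  let ?P = "path_vec Mf (Some (head Q a), p)"
  have P: "?P \<in> carrier_mat 1 (\<alpha> (head Q a))" using path_vec_carrier[of Mf "(Some (head Q a), p)"] by simp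
  have "?P * minv (g (head Q a)) * (g (head Q a) * fst Mf a * minv (g (tail Q a))) =
      ?P * (minv (g (head Q a)) * g (head Q a)) * fst Mf a * minv (g (tail Q a))"
    using P M minv_carrier[OF h(1)] minv_carrier[OF t(1)] h(1)
    by (simp add: assoc_mult_mat[of _ 1 "\<alpha> (head Q a)" _ "\<alpha> (head Q a)" _ "\<alpha> (head Q a)"]
        assoc_mult_mat[of _ 1 "\<alpha> (head Q a)" _ "\<alpha> (head Q a)" _ "\<alpha> (tail Q a)"]
        assoc_mult_mat[of _ 1 "\<alpha> (head Q a)" _ "\<alpha> (tail Q a)" _ "\<alpha> (tail Q a)"]
        assoc_mult_mat[of _ "\<alpha> (head Q a)" "\<alpha> (head Q a)" _ "\<alpha> (head Q a)" _ "\<alpha> (tail Q a)"]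
        assoc_mult_mat[of _ "\<alpha> (head Q a)" "\<alpha> (head Q a)" _ "\<alpha> (tail Q a)" _ "\<alpha> (tail Q a)"]
        mult_carrier_mat[of _ _ "\<alpha> (head Q a)" _ "\<alpha> (head Q a)"]
        mult_carrier_mat[of _ _ "\<alpha> (head Q a)" _ "\<alpha> (tail Q a)"]
        mult_carrier_mat[of _ _ "\<alpha> (tail Q a)" _ "\<alpha> (tail Q a)"])
  also have "\<dots> = ?P * fst Mf a * minv (g (tail Q a))"
    using P by (simp add: minv_left[OF h])
  finally show ?case
    using arc.IH by (simp add: path_vec_arc[OF GL_act_framed_reps[OF g Mf] arc.hyps] path_vec_arc[OF Mf arc.hyps]
        GL_act_apply(1)[OF g arc.hyps(1)])
qed

lemma path_row_GL_act:
  assumes g: "g \<in> GL Q \<alpha>" and Mf: "Mf \<in> reps" and \<pi>: "\<pi> \<in> npaths"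
    and i: "fst \<pi> = Some i" and j: "j < \<alpha> i"
  shows "path_row (GL_act Q g Mf) \<pi> j = (\<Sum>l<\<alpha> i. path_row Mf \<pi> l * minv (g i) $$ (l, j))"
proof -
  have iv: "i \<in> verts Q" using \<pi> i by (elim npaths_vert) simp
  have P: "path_vec Mf \<pi> \<in> carrier_mat 1 (\<alpha> i)" using path_vec_carrier[of Mf \<pi>] i by simp
  have "path_row (GL_act Q g Mf) \<pi> j = path_vec (GL_act Q g Mf) \<pi> $$ (0, j)" using i j by (simp add: path_vec_def)
  also have "\<dots> = (path_vec Mf \<pi> * minv (g i)) $$ (0, j)" using path_vec_GL_act[OF g Mf \<pi>] i by simp
  also have "\<dots> = (\<Sum>l<\<alpha> i. path_vec Mf \<pi> $$ (0, l) * minv (g i) $$ (l, j))"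
    using mat_index_mult[OF P minv_carrier[OF GL_D(1)[OF g iv]] _ j, of 0] by simp
  also have "\<dots> = (\<Sum>l<\<alpha> i. path_row Mf \<pi> l * minv (g i) $$ (l, j))" using i by (simp add: path_vec_def)
  finally show ?thesis .
qed

lemma row_mat_GL_act:
  assumes g: "g \<in> GL Q \<alpha>" and Mf: "Mf \<in> reps" and S: "skel S" and i: "i \<in> verts Q"
  shows "row_mat S (GL_act Q g Mf) i = row_mat S Mf i * minv (g i)"
proof (rule eq_matI)
  note c = minv_carrier[OF GL_D(1)[OF g i]]
  fix r j assume "r < dim_row (row_mat S Mf i * minv (g i))" "j < dim_col (row_mat S Mf i * minv (g i))"
  then have rj: "r < \<alpha> i" "j < \<alpha> i" using c by (auto simp: row_mat_def)
  show "row_mat S (GL_act Q g Mf) i $$ (r, j) = (row_mat S Mf i * minv (g i)) $$ (r, j)"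
    using mat_index_mult[OF row_mat_carrier c rj, of S Mf] rj
      path_row_GL_act[OF g Mf path_nth_in(3)[OF S i rj(1)] path_nth_in(2)[OF S i rj(1)] rj(2)]
    by (simp add: row_mat_def)
qed (use minv_carrier[OF GL_D(1)[OF g i]] in \<open>auto simp: row_mat_def\<close>)

text \<open>Used to return from a normal form to the pair it came from, and to reverse an inclusion
  between spans.\<close>

lemma GL_act_inverse:
  assumes g: "g \<in> GL Q \<alpha>" and Mf: "Mf \<in> reps"
  shows "(\<lambda>i\<in>verts Q. minv (g i)) \<in> GL Q \<alpha>"
    and "GL_act Q (\<lambda>i\<in>verts Q. minv (g i)) (GL_act Q g Mf) = Mf"
proof -
  show g': "(\<lambda>i\<in>verts Q. minv (g i)) \<in> GL Q \<alpha>"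
    using GL_D[OF g] det_minv[OF GL_D[OF g]] by (auto simp: GL_iff)
  note gM = GL_act_framed_reps[OF g Mf]
  note ggM = GL_act_framed_reps[OF g' gM]
  show "GL_act Q (\<lambda>i\<in>verts Q. minv (g i)) (GL_act Q g Mf) = Mf"
  proof (rule prod_eqI)
    have "fst (GL_act Q (\<lambda>i\<in>verts Q. minv (g i)) (GL_act Q g Mf)) a = fst Mf a" if a: "a \<in> arcs Q" for a
    proof -
      note h = GL_D[OF g arc_ends(2)[OF a]] and t = GL_D[OF g arc_ends(1)[OF a]]
      note hc = minv_carrier[OF h(1)] and tc = minv_carrier[OF t(1)]
      note M = framed_reps_fst[OF Mf a]
      have "minv (g (head Q a)) * (g (head Q a) * fst Mf a * minv (g (tail Q a))) * g (tail Q a) =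
          (minv (g (head Q a)) * g (head Q a)) * fst Mf a * (minv (g (tail Q a)) * g (tail Q a))"
        using M h(1) t(1) hc tc
        by (simp add: assoc_mult_mat[of _ "\<alpha> (head Q a)" "\<alpha> (head Q a)" _ "\<alpha> (head Q a)" _ "\<alpha> (tail Q a)"]
            assoc_mult_mat[of _ "\<alpha> (head Q a)" "\<alpha> (head Q a)" _ "\<alpha> (tail Q a)" _ "\<alpha> (tail Q a)"]
            assoc_mult_mat[of _ "\<alpha> (head Q a)" "\<alpha> (tail Q a)" _ "\<alpha> (tail Q a)" _ "\<alpha> (tail Q a)"]
            mult_carrier_mat[of _ _ "\<alpha> (head Q a)" _ "\<alpha> (head Q a)"]
            mult_carrier_mat[of _ _ "\<alpha> (head Q a)" _ "\<alpha> (tail Q a)"]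
            mult_carrier_mat[of _ _ "\<alpha> (tail Q a)" _ "\<alpha> (tail Q a)"])
      also have "\<dots> = fst Mf a" using M by (simp add: minv_left[OF h] minv_left[OF t])
      finally show ?thesis
        using a by (simp add: GL_act_apply(1)[OF g' a] GL_act_apply(1)[OF g a] minv_minv[OF t])
    qed
    then show "fst (GL_act Q (\<lambda>i\<in>verts Q. minv (g i)) (GL_act Q g Mf)) = fst Mf"
      using Mf ggM by (intro PiE_ext[of _ "arcs Q" _ "fst Mf"]) (auto simp: framed_reps_def)
    have "snd (GL_act Q (\<lambda>i\<in>verts Q. minv (g i)) (GL_act Q g Mf)) i = snd Mf i" if i: "i \<in> verts Q" for i
    proof -
      note gi = GL_D[OF g i]
      note f = framed_reps_snd[OF Mf i]
      have "snd Mf i * minv (g i) * g i = snd Mf i"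
        using assoc_mult_mat[OF f minv_carrier[OF gi(1)] gi(1)] f by (simp add: minv_left[OF gi])
      then show ?thesis
        using i by (simp add: GL_act_apply(2)[OF g' i] GL_act_apply(2)[OF g i] minv_minv[OF gi])
    qed
    then show "snd (GL_act Q (\<lambda>i\<in>verts Q. minv (g i)) (GL_act Q g Mf)) = snd Mf"
      using Mf ggM by (intro PiE_ext[of _ "verts Q" _ "snd Mf"]) (auto simp: framed_reps_def)
  qed
qed

section \<open>Frames normalised at a skeleton\<close>

definition minor :: "('v, 'a) ext_path set \<Rightarrow> (('v, 'a, 'f::field) frame_fun) \<Rightarrow> 'v \<Rightarrow> 'f mat" where
  "minor S b i = mat (\<alpha> i) (\<alpha> i) (\<lambda>(r, j). b i j (path_nth S i r))"

text \<open>
  A frame \<open>b\<close> is multiplied on the right by the inverse of its \<open>S\<close>-minor; this depends on the span of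
  \<open>b\<close> only.
\<close>

definition normed :: "('v, 'a) ext_path set \<Rightarrow> (('v, 'a, 'f::field) frame_fun) \<Rightarrow>
    'v \<Rightarrow> ('v, 'a) ext_path \<Rightarrow> nat \<Rightarrow> 'f" where
  "normed S b i \<pi> s = (\<Sum>j<\<alpha> i. b i j \<pi> * minv (minor S b i) $$ (j, s))"

definition free_coords :: "('v, 'a) ext_path set \<Rightarrow> (('v, 'a, 'f::field) frame_fun) \<Rightarrow> 'f vec" where
  "free_coords S b = vec chart_dim (\<lambda>k. normed S b (row_vert (fst (free_nth S k))) (row_path S (fst (free_nth S k))) (snd (free_nth S k)))"

text \<open>The \<open>j\<close>-th vector at \<open>i\<close> is the image in J-hat of the
  \<open>j\<close>-th standard basis vector, so the frame spans the image of the space at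
  \<open>i\<close>. Off the index sets the values are fixed by restriction, as \<open>frames\<close>
  demands.\<close>

definition frame_of :: "('v, 'a, 'f::field) framed_rep \<Rightarrow> ('v, 'a, 'f) frame_fun" where
  "frame_of Mf = (\<lambda>i\<in>verts Q. \<lambda>j\<in>{..<\<alpha> i}. \<lambda>\<pi>\<in>Gam_at i. path_row Mf \<pi> j)"

lemma minor_carrier [simp]: "minor S b i \<in> carrier_mat (\<alpha> i) (\<alpha> i)"
  by (simp add: minor_def)

lemma free_coords_carrier [simp]: "free_coords S b \<in> carrier_vec chart_dim"
  by (simp add: free_coords_def)

lemma frame_of_apply [simp]: "i \<in> verts Q \<Longrightarrow> j < \<alpha> i \<Longrightarrow> \<pi> \<in> Gam_at i \<Longrightarrow> frame_of Mf i j \<pi> = path_row Mf \<pi> j"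
  by (simp add: frame_of_def)

lemma minor_frame_of:
  assumes "skel S" "i \<in> verts Q"
  shows "minor S (frame_of Mf) i = row_mat S Mf i"
  using path_nth_Gam_at[OF assms] assms(2) by (intro eq_matI) (auto simp: minor_def row_mat_def)

lemma free_entries_Gam_at:
  assumes S: "skel S" and x: "x \<in> free_entries S"
  shows "row_vert (fst x) \<in> verts Q" "row_path S (fst x) \<in> Gam_at (row_vert (fst x))" "snd x < \<alpha> (row_vert (fst x))"
    "fst x \<in> rows" "row_path S (fst x) \<notin> S"
proof -
  obtain \<rho> s where "x = (\<rho>, s)" "\<rho> \<in> rows" "row_path S \<rho> \<notin> S" "s < \<alpha> (row_vert \<rho>)"
    using x by (auto simp: free_entries_def)
  then show "row_vert (fst x) \<in> verts Q" "row_path S (fst x) \<in> Gam_at (row_vert (fst x))" "snd x < \<alpha> (row_vert (fst x))"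
    "fst x \<in> rows" "row_path S (fst x) \<notin> S"
    using row_path_Gam_at[OF S, of \<rho>] by auto
qed

lemma normed_matrix:
  assumes "s < \<alpha> i"
  shows "normed S b i \<pi> s = (mat 1 (\<alpha> i) (\<lambda>(_, j). b i j \<pi>) * minv (minor S b i)) $$ (0, s)"
  using mat_index_mult[of "mat 1 (\<alpha> i) (\<lambda>(_, j). b i j \<pi>)" 1 "\<alpha> i" "minv (minor S b i)" "\<alpha> i" 0 s] assms
  by (simp add: normed_def)

text \<open>A change of basis \<open>h\<close> multiplies rows and minors alike, and
  \<open>(R h) (B h)^-1 = R B^-1\<close>.\<close>

lemma normed_change:
  assumes S: "skel S" and i: "i \<in> verts Q" and h: "h \<in> carrier_mat (\<alpha> i) (\<alpha> i)"
    and b': "\<And>j \<pi>. j < \<alpha> i \<Longrightarrow> \<pi> \<in> Gam_at i \<Longrightarrow> b' i j \<pi> = (\<Sum>l<\<alpha> i. b i l \<pi> * h $$ (l, j))"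
  shows "minor S b' i = minor S b i * h"
    and "det (minor S b' i) \<noteq> 0 \<Longrightarrow> \<pi> \<in> Gam_at i \<Longrightarrow> s < \<alpha> i \<Longrightarrow> normed S b' i \<pi> s = normed S b i \<pi> s"
proof -
  show B: "minor S b' i = minor S b i * h"
  proof (rule eq_matI)
    fix r j assume "r < dim_row (minor S b i * h)" "j < dim_col (minor S b i * h)"
    then have rj: "r < \<alpha> i" "j < \<alpha> i" using h by (auto simp: minor_def)
    show "minor S b' i $$ (r, j) = (minor S b i * h) $$ (r, j)"
      using mat_index_mult[OF minor_carrier h rj, of S b] rj b'[OF rj(2) path_nth_Gam_at[OF S i rj(1)]]
      by (simp add: minor_def)
  qed (use h in \<open>auto simp: minor_def\<close>)
  assume d: "det (minor S b' i) \<noteq> 0" and \<pi>: "\<pi> \<in> Gam_at i" and s: "s < \<alpha> i"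
  have d': "det (minor S b i) \<noteq> 0" "det h \<noteq> 0" using d det_mult[OF minor_carrier h, of S b] B by auto
  let ?R = "mat 1 (\<alpha> i) (\<lambda>(_, j). b i j \<pi>)"
  have R: "?R \<in> carrier_mat 1 (\<alpha> i)" by simp
  have "mat 1 (\<alpha> i) (\<lambda>(_, j). b' i j \<pi>) = ?R * h"
  proof (rule eq_matI)
    fix r j assume "r < dim_row (?R * h)" "j < dim_col (?R * h)"
    then have r: "r = 0" and j: "j < \<alpha> i" using h by auto
    show "mat 1 (\<alpha> i) (\<lambda>(_, j). b' i j \<pi>) $$ (r, j) = (?R * h) $$ (r, j)"
      using mat_index_mult[OF R h _ j, of 0] r j b'[OF j \<pi>] by simp
  qed (use h in auto)
  then have "mat 1 (\<alpha> i) (\<lambda>(_, j). b' i j \<pi>) * minv (minor S b' i) = ?R * h * (minv h * minv (minor S b i))"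
    unfolding B by (simp add: minv_mult[OF minor_carrier h d'])
  also have "\<dots> = ?R * (h * minv h) * minv (minor S b i)"
    using h minv_carrier[OF h] minv_carrier[OF minor_carrier, of S b i] R
    by (simp add: assoc_mult_mat[of _ 1 "\<alpha> i" _ "\<alpha> i" _ "\<alpha> i"] assoc_mult_mat[of _ "\<alpha> i" "\<alpha> i" _ "\<alpha> i" _ "\<alpha> i"]
        mult_carrier_mat[of _ _ "\<alpha> i" _ "\<alpha> i"])
  also have "\<dots> = ?R * minv (minor S b i)" using right_mult_one_mat[OF R] by (simp add: minv_right[OF h d'(2)])
  finally show "normed S b' i \<pi> s = normed S b i \<pi> s" using normed_matrix[OF s] by metis
qed

lemma free_coords_cong:
  assumes S: "skel S"
    and "\<And>i \<pi> s. i \<in> verts Q \<Longrightarrow> \<pi> \<in> Gam_at i \<Longrightarrow> s < \<alpha> i \<Longrightarrow> normed S b i \<pi> s = normed S b' i \<pi> s"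
  shows "free_coords S b = free_coords S b'"
  using assms(2) free_entries_Gam_at(1-3)[OF S free_nth_free_idx(1)[OF S]] by (intro eq_vecI) (simp_all add: free_coords_def)

lemma frame_of_GL_act:
  assumes g: "g \<in> GL Q \<alpha>" and Mf: "Mf \<in> reps" and i: "i \<in> verts Q"
    and j: "j < \<alpha> i" and \<pi>: "\<pi> \<in> Gam_at i"
  shows "frame_of (GL_act Q g Mf) i j \<pi> = (\<Sum>l<\<alpha> i. frame_of Mf i l \<pi> * minv (g i) $$ (l, j))"
  using path_row_GL_act[OF g Mf GiD[OF \<pi>] j] i j \<pi> by simp

lemma free_coords_frame_of_GL_act:
  assumes g: "g \<in> GL Q \<alpha>" and S: "skel S" and Mf: "Mf \<in> cell S"
  shows "GL_act Q g Mf \<in> cell S"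
    and "free_coords S (frame_of (GL_act Q g Mf)) = free_coords S (frame_of Mf)"
proof -
  have M: "Mf \<in> reps" and d: "\<And>i. i \<in> verts Q \<Longrightarrow> det (row_mat S Mf i) \<noteq> 0"
    using Mf by (auto simp: stable_with_skeleton_eq[OF S])
  have d': "det (row_mat S (GL_act Q g Mf) i) \<noteq> 0" if i: "i \<in> verts Q" for i
    unfolding row_mat_GL_act[OF g M S i] det_mult[OF row_mat_carrier minv_carrier[OF GL_D(1)[OF g i]]]
    using d[OF i] det_minv[OF GL_D[OF g i]] by simp
  then show "GL_act Q g Mf \<in> cell S"
    using GL_act_framed_reps[OF g M] by (simp add: stable_with_skeleton_eq[OF S])
  show "free_coords S (frame_of (GL_act Q g Mf)) = free_coords S (frame_of Mf)"
  proof (rule free_coords_cong[OF S])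
    fix i \<pi> s assume i: "i \<in> verts Q" and \<pi>: "\<pi> \<in> Gam_at i" and s: "s < \<alpha> i"
    have "det (minor S (frame_of (GL_act Q g Mf)) i) \<noteq> 0" using d'[OF i] minor_frame_of[OF S i] by metis
    then show "normed S (frame_of (GL_act Q g Mf)) i \<pi> s = normed S (frame_of Mf) i \<pi> s"
      by (rule normed_change(2)[OF S i minv_carrier[OF GL_D(1)[OF g i]], rotated 1])
        (use \<pi> s frame_of_GL_act[OF g M i] in blast)+
  qed
qed

lemma normed_normal:
  assumes "minor S b i = 1\<^sub>m (\<alpha> i)" "s < \<alpha> i"
  shows "normed S b i \<pi> s = b i s \<pi>"
proof -
  have "normed S b i \<pi> s = (\<Sum>j<\<alpha> i. if j = s then b i j \<pi> else 0)"
    using assms unfolding normed_def by (intro sum.cong refl) auto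
  then show ?thesis using assms(2) by simp
qed

lemma free_coords_frame_of_normal_form:
  assumes S: "skel S" and v: "v \<in> carrier_vec chart_dim"
  shows "free_coords S (frame_of (normal_form S v)) = v"
proof (rule eq_vecI)
  fix k assume "k < dim_vec v"
  then have k: "k < chart_dim" using v by simp
  define \<rho> s where "\<rho> = fst (free_nth S k)" and "s = snd (free_nth S k)"
  have fk: "free_nth S k = (\<rho>, s)" by (simp add: \<rho>_def s_def)
  note fr = free_entries_Gam_at[OF S free_nth_free_idx(1)[OF S k], folded \<rho>_def s_def]
  have "free_coords S (frame_of (normal_form S v)) $ k = normed S (frame_of (normal_form S v)) (row_vert \<rho>) (row_path S \<rho>) s"
    using k by (simp add: free_coords_def \<rho>_def s_def)
  also have "\<dots> = path_row (normal_form S v) (row_path S \<rho>) s"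
  proof -
    have "minor S (frame_of (normal_form S v)) (row_vert \<rho>) = 1\<^sub>m (\<alpha> (row_vert \<rho>))"
      using minor_frame_of[OF S fr(1), of "normal_form S v"] row_mat_normal_form[OF S fr(1), of v] by simp
    from normed_normal[OF this fr(3), of "row_path S \<rho>"] show ?thesis using fr(1-3) by simp
  qed
  also have "\<dots> = entry (normal_form S v) \<rho> s"
    by (rule path_row_row_path_normal[OF normal_form_framed_reps S row_mat_normal_form[OF S] fr(4,3)])
  also have "\<dots> = v $ k" using fr entry_normal_form[OF fr(4,3), of S v] free_nth_free_idx(2)[OF S k] fk by simp
  finally show "free_coords S (frame_of (normal_form S v)) $ k = v $ k" .
qed (use v in simp)

section \<open>Normalisation of a pair in a chart\<close>

definition chart_group :: "('v, 'a) ext_path set \<Rightarrow> ('v, 'a, 'f::field) framed_rep \<Rightarrow> 'v \<Rightarrow> 'f mat" where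
  "chart_group S Mf = (\<lambda>i\<in>verts Q. row_mat S Mf i)"

lemma chart_group_GL:
  assumes "skel S" "Mf \<in> cell S"
  shows "chart_group S Mf \<in> GL Q \<alpha>"
  using assms by (auto simp: chart_group_def GL_iff stable_with_skeleton_eq)

text \<open>After the action the minors are 1, so all entries are rows of paths: unit vectors for
  the paths in \<open>S\<close>, and otherwise the old row times the inverse minor, which is what
  \<open>free_coords\<close> records.\<close>

lemma chart_normalize:
  assumes S: "skel S" and Mf: "Mf \<in> cell S"
  shows "GL_act Q (chart_group S Mf) Mf = normal_form S (free_coords S (frame_of Mf))"
proof -
  let ?g = "chart_group S Mf" and ?M = "GL_act Q (chart_group S Mf) Mf"
  have M: "Mf \<in> reps" and d: "\<And>i. i \<in> verts Q \<Longrightarrow> det (row_mat S Mf i) \<noteq> 0"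
    using Mf by (auto simp: stable_with_skeleton_eq[OF S])
  have g: "?g \<in> GL Q \<alpha>" by (rule chart_group_GL[OF assms])
  have gi: "?g i = row_mat S Mf i" if "i \<in> verts Q" for i using that by (simp add: chart_group_def)
  have one: "row_mat S ?M i = 1\<^sub>m (\<alpha> i)" if i: "i \<in> verts Q" for i
    unfolding row_mat_GL_act[OF g M S i] gi[OF i] by (rule minv_right[OF row_mat_carrier d[OF i]])
  note gM = GL_act_framed_reps[OF g M]
  show ?thesis
  proof (rule framed_rep_eqI[OF gM normal_form_framed_reps])
    fix \<rho> s assume \<rho>: "\<rho> \<in> rows" and s: "s < \<alpha> (row_vert \<rho>)"
    have e: "entry ?M \<rho> s = path_row ?M (row_path S \<rho>) s"
      by (rule path_row_row_path_normal[OF gM S one \<rho> s, symmetric])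
    show "entry ?M \<rho> s = entry (normal_form S (free_coords S (frame_of Mf))) \<rho> s"
    proof (cases "row_path S \<rho> \<in> S")
      case True
      define r where "r = path_idx S (row_vert \<rho>) (row_path S \<rho>)"
      have r: "r < \<alpha> (row_vert \<rho>)" "path_nth S (row_vert \<rho>) r = row_path S \<rho>"
        using path_nth_path_idx[OF S row_vert_in[OF \<rho>] True fst_row_path] by (auto simp: r_def)
      have "path_row ?M (row_path S \<rho>) s = row_mat S ?M (row_vert \<rho>) $$ (r, s)" using r s by (simp add: row_mat_def)
      then show ?thesis
        using e one[OF row_vert_in[OF \<rho>]] r s True path_nth_inj[OF S row_vert_in[OF \<rho>] s r(1)]
        by (auto simp: entry_normal_form[OF \<rho> s])
    next
      case False
      then have x: "(\<rho>, s) \<in> free_entries S" using \<rho> s by (simp add: free_entries_def)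
      note fr = free_entries_Gam_at[OF S x]
      have "path_row ?M (row_path S \<rho>) s = normed S (frame_of Mf) (row_vert \<rho>) (row_path S \<rho>) s"
        using path_row_GL_act[OF g M row_path_npaths[OF S \<rho>] fst_row_path s] fr gi[OF row_vert_in[OF \<rho>]]
        by (simp add: normed_def minor_frame_of[OF S row_vert_in[OF \<rho>]])
      also have "\<dots> = free_coords S (frame_of Mf) $ free_idx S (\<rho>, s)"
        using free_idx_free_nth[OF S x] by (simp add: free_coords_def)
      finally show ?thesis using e False by (simp add: entry_normal_form[OF \<rho> s])
    qed
  qed
qed

end

section \<open>Charts of the space of stable pairs\<close>

lemma kfun_compose:
  assumes f: "kfun P' C' f" and P: "\<And>x. x \<in> P \<Longrightarrow> \<phi> x \<in> P'"
    and C: "\<And>c. c \<in> C' \<Longrightarrow> kfun P C (\<lambda>x. c (\<phi> x))"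
  shows "kfun P C (\<lambda>x. f (\<phi> x))"
proof -
  have "kreg (zariski P' C') P' f" using f by (simp add: kreg_zariski zariski_open_whole)
  moreover have "kmorphism (zariski P C) (zariski P' C') \<phi>"
    by (rule kmorphism_zariski) (use P C in blast)+
  ultimately have "kreg (zariski P C) (kpreimage (zariski P C) \<phi> P') (f \<circ> \<phi>)"
    by (rule kmorphism_kreg[rotated])
  moreover have "kpreimage (zariski P C) \<phi> P' = P" using P by (auto simp: kpreimage_def)
  ultimately show ?thesis by (simp add: kreg_zariski o_def)
qed

context framed_quiver
begin

lemma Rep_coords_eq:
  "(coords :: (('v, 'a, 'k::field alg_closure) framed_rep \<Rightarrow> 'k alg_closure) set) =
     {\<lambda>Mf. entry Mf \<rho> s | \<rho> s. \<rho> \<in> rows \<and> s < \<alpha> (row_vert \<rho>)}"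
proof (intro equalityI subsetI)
  fix c :: "('v, 'a, 'k alg_closure) framed_rep \<Rightarrow> 'k alg_closure"
  assume "c \<in> coords"
  then consider a r s where "c = (\<lambda>(M, f). M a $$ (r, s))" "a \<in> arcs Q" "r < \<alpha> (head Q a)" "s < \<alpha> (tail Q a)"
    | i r s where "c = (\<lambda>(M, f). f i $$ (r, s))" "i \<in> verts Q" "r < \<zeta> i" "s < \<alpha> i"
    unfolding Rep_coords_def by blast
  then show "c \<in> {\<lambda>Mf. entry Mf \<rho> s | \<rho> s. \<rho> \<in> rows \<and> s < \<alpha> (row_vert \<rho>)}"
  proof cases
    case 1
    then have "c = (\<lambda>Mf. entry Mf (Inl (a, r)) s)" by (auto simp: split_beta)
    then show ?thesis using 1 by (intro CollectI exI[of _ "Inl (a, r)"] exI[of _ s]) simp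
  next
    case 2
    then have "c = (\<lambda>Mf. entry Mf (Inr (i, r)) s)" by (auto simp: split_beta)
    then show ?thesis using 2 by (intro CollectI exI[of _ "Inr (i, r)"] exI[of _ s]) simp
  qed
next
  fix c :: "('v, 'a, 'k alg_closure) framed_rep \<Rightarrow> 'k alg_closure"
  assume "c \<in> {\<lambda>Mf. entry Mf \<rho> s | \<rho> s. \<rho> \<in> rows \<and> s < \<alpha> (row_vert \<rho>)}"
  then obtain \<rho> s where c: "c = (\<lambda>Mf. entry Mf \<rho> s)" "s < \<alpha> (row_vert \<rho>)" and \<rho>: "\<rho> \<in> rows" by blast
  from \<rho> show "c \<in> coords"
  proof (cases rule: rows_cases)
    case (arc a l)
    then have "c = (\<lambda>(M, f). M a $$ (l, s))" using c(1) by auto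
    then show ?thesis using arc c(2) unfolding Rep_coords_def by auto
  next
    case (frame i l)
    then have "c = (\<lambda>(M, f). f i $$ (l, s))" using c(1) by auto
    then show ?thesis using frame c(2) unfolding Rep_coords_def by auto
  qed
qed

lemma kfun_entry: "\<rho> \<in> rows \<Longrightarrow> s < \<alpha> (row_vert \<rho>) \<Longrightarrow> kfun P coords (\<lambda>Mf. entry Mf \<rho> s)"
  unfolding Rep_coords_eq by (rule kfun_coord) blast

lemma kfun_path_row:
  assumes P: "P \<subseteq> reps" and \<pi>: "\<pi> \<in> npaths" and j: "j < \<alpha> (the (fst \<pi>))"
  shows "kfun P coords (\<lambda>Mf. path_row Mf \<pi> j)"
  using \<pi> j
proof (induction arbitrary: j rule: npaths_induct)
  case (frame i q)
  have eq: "path_row Mf (Some i, [Inr (i, q)]) j = entry Mf (Inr (i, q)) j" if "Mf \<in> P" for Mf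
    using path_row_frame[of Mf i q j] that P frame by auto
  show ?case
    using kfun_entry[of "Inr (i, q)" j P] frame by (subst kfun_cong[OF eq]) auto
next
  case (arc a p)
  have eq: "path_row Mf (Some (tail Q a), Inl a # p) j =
      (\<Sum>l<\<alpha> (head Q a). path_row Mf (Some (head Q a), p) l * entry Mf (Inl (a, l)) j)" if "Mf \<in> P" for Mf
    using path_row_arc[of Mf a p j] that P arc by auto
  have "kfun P coords (\<lambda>Mf. \<Sum>l<\<alpha> (head Q a). path_row Mf (Some (head Q a), p) l * entry Mf (Inl (a, l)) j)"
    using arc by (intro kfun_sum kfun_mult kfun_entry arc.IH) auto
  then show ?case by (subst kfun_cong[OF eq])
qed

lemma stable_subset: "stables \<subseteq> reps"
  using stable_pairs_iff by blast

lemma chart_subset: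
  "cell S \<subseteq> stables" "cell S \<subseteq> reps"
  using stable_subset by (auto simp: stable_with_skeleton_def)

lemma stable_space_eq: "stable_space Q \<alpha> \<zeta> = zariski stables coords"
  unfolding stable_space_def Rep_space_def by (rule ksubspace_zariski[OF stable_subset])

lemma kfun_row_mat:
  assumes "P \<subseteq> reps" "skel S" "i \<in> verts Q" "r < \<alpha> i" "j < \<alpha> i"
  shows "kfun P coords (\<lambda>Mf. row_mat S Mf i $$ (r, j))"
  using kfun_path_row[OF assms(1) path_nth_in(3)[OF assms(2-4)], of j] path_nth_in(2)[OF assms(2-4)] assms(4,5)
  by (simp add: row_mat_def)

lemma zariski_open_chart:
  assumes S: "skel S"
  shows "zariski_open stables coords
    (cell S :: ('v, 'a, 'k::field alg_closure) framed_rep set)"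
proof -
  let ?d = "\<lambda>Mf :: ('v, 'a, 'k alg_closure) framed_rep. \<Prod>i\<in>verts Q. det (row_mat S Mf i)"
  have "kfun stables coords ?d"
    using kfun_det[OF row_mat_carrier kfun_row_mat[OF stable_subset S]] by (intro kfun_prod)
  from zariski_open_kfun_neq_0[OF this]
  have "zariski_open stables coords {Mf \<in> stables. ?d Mf \<noteq> 0}" .
  moreover have "{Mf \<in> stables. ?d Mf \<noteq> 0} = cell S"
    using chart_subset(1)[of S] stable_subset by (auto simp: stable_with_skeleton_eq[OF S])
  ultimately show ?thesis by simp
qed

section \<open>Frames in J-hat as a quasi-affine space\<close>

definition frame_pts :: "(('v, 'a, 'f::field) frame_fun) set" where
  "frame_pts = frames (verts Q) \<alpha> Gam_at"

definition frame_coords :: "((('v, 'a, 'f) frame_fun) \<Rightarrow> 'f) set" where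
  "frame_coords = {\<lambda>b. b i j \<gamma> | i j \<gamma>. i \<in> verts Q \<and> j < \<alpha> i \<and> \<gamma> \<in> Gam_at i}"

definition spans :: "(('v, 'a, 'f::field) frame_fun) \<Rightarrow> 'v \<Rightarrow> (('v, 'a) ext_path \<Rightarrow> 'f) set" where
  "spans = frame_span (verts Q) \<alpha> Gam_at"

definition frame_chart :: "('v, 'a) ext_path set \<Rightarrow> (('v, 'a, 'f::field) frame_fun) set" where
  "frame_chart S = {b \<in> frame_pts. \<forall>i\<in>verts Q. det (minor S b i) \<noteq> 0}"

lemma frame_space_eq: "frame_space (verts Q) \<alpha> Gam_at = zariski frame_pts frame_coords"
  by (simp add: frame_space_def frame_pts_def frame_coords_def)

lemma frame_chart_subset: "frame_chart S \<subseteq> frame_pts"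
  by (auto simp: frame_chart_def)

text \<open>Independence is already visible at the coordinates belonging to one skeleton of the
  pair, all of which lie in \<open>Gam_at\<close>.\<close>

lemma frame_of_frame_pts:
  assumes "Mf \<in> stables"
  shows "frame_of Mf \<in> frame_pts"
  unfolding frame_pts_def frames_def
proof (intro CollectI conjI ballI allI impI)
  show "frame_of Mf \<in> (\<Pi>\<^sub>E i\<in>verts Q. \<Pi>\<^sub>E j\<in>{..<\<alpha> i}. Gam_at i \<rightarrow>\<^sub>E UNIV)"
    by (auto simp: frame_of_def)
  fix i c j assume i: "i \<in> verts Q" and c: "\<forall>\<gamma>\<in>Gam_at i. (\<Sum>j<\<alpha> i. c j * frame_of Mf i j \<gamma>) = 0" and j: "j < \<alpha> i"
  obtain S where S: "skel S" "row_injective Mf S" using exists_skel[OF assms] by blast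
  show "c j = 0"
  proof (rule row_injectiveD[OF S(2) i _ j])
    fix \<pi> assume "\<pi> \<in> S" "fst \<pi> = Some i"
    then have "\<pi> \<in> Gam_at i" using S(1) by (auto simp: Gam_at_def Gam_ext_def)
    then show "(\<Sum>j<\<alpha> i. path_row Mf \<pi> j * c j) = 0" using c i by (simp add: mult.commute)
  qed
qed

lemma frame_of_frame_chart:
  assumes "skel S"
  shows "Mf \<in> stables \<Longrightarrow> frame_of Mf \<in> frame_chart S \<longleftrightarrow> Mf \<in> cell S"
  using frame_of_frame_pts[of Mf] stable_subset minor_frame_of[OF assms, of _ Mf]
  by (auto simp: frame_chart_def stable_with_skeleton_eq[OF assms])

lemma kmorphism_frame_of:
  "kmorphism (zariski stables coords) (zariski frame_pts frame_coords) frame_of"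
proof (rule kmorphism_zariski)
  fix c :: "(('v, 'a, 'b alg_closure) frame_fun) \<Rightarrow> 'b alg_closure"
  assume "c \<in> frame_coords"
  then obtain i j \<gamma> where c: "c = (\<lambda>b. b i j \<gamma>)" "i \<in> verts Q" "j < \<alpha> i" "\<gamma> \<in> Gam_at i"
    by (auto simp: frame_coords_def)
  then show "kfun stables coords (\<lambda>x. c (frame_of x))"
    using kfun_path_row[OF stable_subset GiD(1)[OF c(4)], of j] GiD(2)[OF c(4)] by simp
qed (rule frame_of_frame_pts)

lemma kfun_frame_coord: "i \<in> verts Q \<Longrightarrow> j < \<alpha> i \<Longrightarrow> \<gamma> \<in> Gam_at i \<Longrightarrow> kfun P frame_coords (\<lambda>b. b i j \<gamma>)"
  by (rule kfun_coord) (unfold frame_coords_def, blast)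

lemma kfun_minor:
  assumes "skel S" "i \<in> verts Q" "r < \<alpha> i" "j < \<alpha> i"
  shows "kfun P frame_coords (\<lambda>b. minor S b i $$ (r, j))"
  using kfun_frame_coord[OF assms(2,4) path_nth_Gam_at[OF assms(1-3)]] assms(3,4) by (simp add: minor_def)

lemma zariski_open_frame_chart:
  assumes S: "skel S"
  shows "zariski_open frame_pts frame_coords (frame_chart S :: (('v, 'a, 'k::field alg_closure) frame_fun) set)"
proof -
  have "kfun frame_pts frame_coords (\<lambda>b :: ('v, 'a, 'k alg_closure) frame_fun. \<Prod>i\<in>verts Q. det (minor S b i))"
    using kfun_det[OF minor_carrier kfun_minor[OF S]] by (intro kfun_prod)
  from zariski_open_kfun_neq_0[OF this] show ?thesis
    by (simp add: frame_chart_def)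
qed

lemma kfun_normed:
  assumes S: "skel S" and i: "i \<in> verts Q" and \<pi>: "\<pi> \<in> Gam_at i" and s: "s < \<alpha> i"
  shows "kfun (frame_chart S) frame_coords (\<lambda>b. normed S b i \<pi> s)"
  unfolding normed_def
proof (intro kfun_sum kfun_mult)
  fix j assume "j \<in> {..<\<alpha> i}"
  then have j: "j < \<alpha> i" by simp
  show "kfun (frame_chart S) frame_coords (\<lambda>b. b i j \<pi>)" by (rule kfun_frame_coord[OF i j \<pi>])
  show "kfun (frame_chart S) frame_coords (\<lambda>b. minv (minor S b i) $$ (j, s))"
    by (rule kfun_minv[OF minor_carrier _ kfun_minor[OF S i] j s]) (use i in \<open>auto simp: frame_chart_def\<close>)
qed

lemma kfun_free_coords:
  assumes S: "skel S" and k: "k < chart_dim"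
  shows "kfun (frame_chart S) frame_coords (\<lambda>b. free_coords S b $ k)"
  using kfun_normed[OF S free_entries_Gam_at(1-3)[OF S free_nth_free_idx(1)[OF S k]]] k by (simp add: free_coords_def)

lemma kmorphism_free_coords: "skel S \<Longrightarrow> kmorphism (zariski (frame_chart S) frame_coords) (affine_space chart_dim) (free_coords S)"
  unfolding affine_space_def by (rule kmorphism_zariski) (auto simp: affine_coords_def kfun_free_coords)

section \<open>The product structure of a chart\<close>

lemma normal_form_stable: "skel S \<Longrightarrow> normal_form S v \<in> stables"
  using normal_form_in_chart chart_subset by blast

lemma kmorphism_normal_form:
  assumes S: "skel S"
  shows "kmorphism (affine_space chart_dim) (zariski stables coords) (normal_form S)"
  unfolding affine_space_def
proof (rule kmorphism_zariski)
  fix c :: "('v, 'a, 'b alg_closure) framed_rep \<Rightarrow> 'b alg_closure"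
  assume "c \<in> coords"
  then obtain \<rho> s where c: "c = (\<lambda>Mf. entry Mf \<rho> s)" "\<rho> \<in> rows" "s < \<alpha> (row_vert \<rho>)"
    unfolding Rep_coords_eq by blast
  show "kfun (carrier_vec chart_dim) (affine_coords chart_dim) (\<lambda>x. c (normal_form S x))"
  proof (cases "row_path S \<rho> \<in> S")
    case True
    then show ?thesis by (simp add: c entry_normal_form kfun_0 kfun_1)
  next
    case False
    then have "free_idx S (\<rho>, s) < chart_dim" using c free_idx_free_nth(1)[OF S, of "(\<rho>, s)"] by (simp add: free_entries_def)
    then have "kfun (carrier_vec chart_dim) (affine_coords chart_dim) (\<lambda>v. v $ free_idx S (\<rho>, s))"
      by (intro kfun_coord) (auto simp: affine_coords_def)
    then show ?thesis using False by (simp add: c entry_normal_form)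
  qed
qed (rule normal_form_stable[OF S])

lemma zariski_open_subspace:
  assumes "zariski_open P C U"
  shows "ksubspace (zariski P C) U = zariski U C"
    "openin (ktop (zariski P C)) U"
  using assms by (auto intro!: ksubspace_zariski simp: zariski_open_def)

lemma kmorphism_free_coords_frame_of:
  assumes S: "skel S"
  shows "kmorphism (zariski (cell S) coords) (affine_space chart_dim) (free_coords S \<circ> frame_of)"
proof (rule kmorphism_comp[OF _ kmorphism_free_coords[OF S]], rule kmorphism_zariski)
  fix c :: "(('v, 'a, 'b alg_closure) frame_fun) \<Rightarrow> 'b alg_closure"
  assume "c \<in> frame_coords"
  then obtain i j \<gamma> where c: "c = (\<lambda>b. b i j \<gamma>)" "i \<in> verts Q" "j < \<alpha> i" "\<gamma> \<in> Gam_at i"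
    by (auto simp: frame_coords_def)
  then show "kfun (cell S) coords (\<lambda>x. c (frame_of x))"
    using kfun_path_row[OF chart_subset(2) GiD(1)[OF c(4)], of j] GiD(2)[OF c(4)] by simp
next
  show "frame_of Mf \<in> frame_chart S" if "Mf \<in> cell S" for Mf
    using frame_of_frame_chart[OF S, of Mf] that chart_subset(1) by blast
qed

text \<open>Normal forms have minors 1, so moving one by \<open>g\<close> gives minors
  \<open>g^-1\<close>. The inverse map therefore recovers \<open>g\<close> by inverting the minors
  and \<open>v\<close> as the invariant free coordinates.\<close>

lemma kiso_chart:
  assumes S: "skel S"
  shows "kiso (GL_times_affine Q \<alpha> chart_dim) (zariski (cell S) coords)
    (\<lambda>(g, v). GL_act Q g (normal_form S v) :: ('v, 'a, 'k::field alg_closure) framed_rep)"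
proof -
  let ?C = "(\<lambda>c. c \<circ> fst) ` GL_coords Q \<alpha> \<union> (\<lambda>c. c \<circ> snd) ` affine_coords chart_dim ::
    (('v \<Rightarrow> 'k alg_closure mat) \<times> 'k alg_closure vec \<Rightarrow> 'k alg_closure) set"
  let ?P = "GL Q \<alpha> \<times> carrier_vec chart_dim :: (('v \<Rightarrow> 'k alg_closure mat) \<times> 'k alg_closure vec) set"
  let ?\<phi> = "\<lambda>(g, v). GL_act Q g (normal_form S v) :: ('v, 'a, 'k alg_closure) framed_rep"
  let ?\<chi> = "\<lambda>Mf :: ('v, 'a, 'k alg_closure) framed_rep. (\<lambda>i\<in>verts Q. minv (row_mat S Mf i), free_coords S (frame_of Mf))"
  have kg: "kfun ?P ?C (\<lambda>x. fst x i $$ (r, s))" if "i \<in> verts Q" "r < \<alpha> i" "s < \<alpha> i" for i r s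
  proof -
    have "(\<lambda>g. g i $$ (r, s)) \<in> (GL_coords Q \<alpha> :: (('v \<Rightarrow> 'k alg_closure mat) \<Rightarrow> 'k alg_closure) set)"
      using that by (auto simp: GL_coords_def)
    then have "(\<lambda>g. g i $$ (r, s)) \<circ> fst \<in> ?C" by blast
    from kfun_coord[OF this] show ?thesis by (simp add: o_def)
  qed
  have kgi: "kfun ?P ?C (\<lambda>x. minv (fst x i) $$ (r, s))" if "i \<in> verts Q" "r < \<alpha> i" "s < \<alpha> i" for i r s
    using that by (intro kfun_minv[where n = "\<alpha> i"] kg) (auto simp: GL_iff)
  \<comment> \<open>Entries of the normal form are regular on affine space and are pulled back along
    the projection \<open>snd\<close>.\<close>
  have kv: "kfun ?P ?C (\<lambda>x. entry (normal_form S (snd x)) \<rho> s)" if "\<rho> \<in> rows" "s < \<alpha> (row_vert \<rho>)" for \<rho> s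
  proof (rule kfun_compose[where f = "\<lambda>Mf. entry Mf \<rho> s" and \<phi> = "\<lambda>x. normal_form S (snd x)"])
    show "kfun stables coords (\<lambda>Mf. entry Mf \<rho> s)" by (rule kfun_entry[OF that])
    show "normal_form S (snd x) \<in> stables" if "x \<in> ?P" for x by (rule normal_form_stable[OF S])
    fix c :: "('v, 'a, 'k alg_closure) framed_rep \<Rightarrow> 'k alg_closure"
    assume "c \<in> coords"
    then have c: "kreg (zariski stables coords) stables c"
      by (simp add: kreg_zariski kfun_coord zariski_open_whole)
    have pre: "kpreimage (affine_space chart_dim :: (_, 'k) k_space) (normal_form S) stables = carrier_vec chart_dim"
      using normal_form_stable[OF S] by (auto simp: kpreimage_def affine_space_def)
    have "kfun (carrier_vec chart_dim) (affine_coords chart_dim) (\<lambda>v. c (normal_form S v))"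
      using kmorphism_kreg[OF kmorphism_normal_form[OF S] c] unfolding pre
      by (simp add: affine_space_def kreg_zariski o_def)
    then show "kfun ?P ?C (\<lambda>x. c (normal_form S (snd x)))"
    proof (rule kfun_compose[where f = "\<lambda>v. c (normal_form S v)" and \<phi> = snd])
      fix d :: "'k alg_closure vec \<Rightarrow> 'k alg_closure" assume "d \<in> affine_coords chart_dim"
      then have "d \<circ> snd \<in> ?C" by blast
      from kfun_coord[OF this] show "kfun ?P ?C (\<lambda>x. d (snd x))" by (simp add: o_def)
    qed auto
  qed
  have kent: "kfun ?P ?C (\<lambda>x. entry (?\<phi> x) \<rho> s)" if \<rho>: "\<rho> \<in> rows" and s: "s < \<alpha> (row_vert \<rho>)" for \<rho> s
    using \<rho>
  proof (cases rule: rows_cases)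
    case (arc a l)
    note h = arc_ends(2)[OF arc(2)] and t = arc_ends(1)[OF arc(2)]
    have cM: "fst (normal_form S (snd x)) a \<in> carrier_mat (\<alpha> (head Q a)) (\<alpha> (tail Q a))" for x :: "'z \<times> 'k alg_closure vec"
      by (rule framed_reps_fst[OF normal_form_framed_reps arc(2)])
    have "kfun ?P ?C (\<lambda>x. (fst x (head Q a) * fst (normal_form S (snd x)) a * minv (fst x (tail Q a))) $$ (l, s))"
    proof (rule kfun_mat_mult[where m = "\<alpha> (head Q a)" and n = "\<alpha> (tail Q a)" and p = "\<alpha> (tail Q a)"])
      show "kfun ?P ?C (\<lambda>x. (fst x (head Q a) * fst (normal_form S (snd x)) a) $$ (r, j))"
        if "r < \<alpha> (head Q a)" "j < \<alpha> (tail Q a)" for r j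
      proof (rule kfun_mat_mult[where m = "\<alpha> (head Q a)" and n = "\<alpha> (head Q a)" and p = "\<alpha> (tail Q a)"])
        show "kfun ?P ?C (\<lambda>x. fst (normal_form S (snd x)) a $$ (i, j))" if "i < \<alpha> (head Q a)" "j < \<alpha> (tail Q a)" for i j
          using kv[of "Inl (a, i)" j] arc(2) that by simp
      qed (use kg[OF h] h cM that in \<open>auto simp: GL_iff\<close>)
    qed (use kgi[OF t] h t cM s arc(1,3) in \<open>auto simp: GL_iff intro!: mult_carrier_mat[OF _ cM] minv_carrier\<close>)
    moreover have "entry (?\<phi> x) \<rho> s = (fst x (head Q a) * fst (normal_form S (snd x)) a * minv (fst x (tail Q a))) $$ (l, s)"
      if "x \<in> ?P" for x
      using that arc(1) by (auto simp: split_beta GL_act_apply(1)[OF _ arc(2)])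
    ultimately show ?thesis by (subst kfun_cong)
  next
    case (frame i r)
    have cf: "snd (normal_form S (snd x)) i \<in> carrier_mat (\<zeta> i) (\<alpha> i)" for x :: "'z \<times> 'k alg_closure vec"
      by (rule framed_reps_snd[OF normal_form_framed_reps frame(2)])
    have "kfun ?P ?C (\<lambda>x. (snd (normal_form S (snd x)) i * minv (fst x i)) $$ (r, s))"
    proof (rule kfun_mat_mult[where m = "\<zeta> i" and n = "\<alpha> i" and p = "\<alpha> i"])
      show "kfun ?P ?C (\<lambda>x. snd (normal_form S (snd x)) i $$ (r, j))" if "r < \<zeta> i" "j < \<alpha> i" for r j
        using kv[of "Inr (i, r)" j] frame(2) that by simp
    qed (use kgi[OF frame(2)] cf s frame in \<open>auto simp: GL_iff intro!: minv_carrier\<close>)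
    moreover have "entry (?\<phi> x) \<rho> s = (snd (normal_form S (snd x)) i * minv (fst x i)) $$ (r, s)" if "x \<in> ?P" for x
      using that frame(1) by (auto simp: split_beta GL_act_apply(2)[OF _ frame(2)])
    ultimately show ?thesis by (subst kfun_cong)
  qed
  have \<phi>in: "?\<phi> x \<in> cell S" if "x \<in> ?P" for x
    using that free_coords_frame_of_GL_act(1)[OF _ S normal_form_in_chart[OF S]] by (auto simp: split_beta)
  have \<phi>: "kmorphism (zariski ?P ?C) (zariski (cell S) coords) ?\<phi>"
  proof (rule kmorphism_zariski)
    show "kfun ?P ?C (\<lambda>x. c (?\<phi> x))" if "c \<in> coords" for c
      using that kent unfolding Rep_coords_eq by blast
  qed (rule \<phi>in)
  have d: "det (row_mat S Mf i) \<noteq> 0" if "Mf \<in> cell S" "i \<in> verts Q"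
    for Mf :: "('v, 'a, 'k alg_closure) framed_rep" and i
    using that by (auto simp: stable_with_skeleton_eq[OF S])
  have \<chi>: "kmorphism (zariski (cell S) coords) (zariski ?P ?C) ?\<chi>"
  proof (rule kmorphism_zariski)
    show "?\<chi> Mf \<in> ?P" if "Mf \<in> cell S" for Mf
      using d[OF that] det_minv[OF row_mat_carrier d[OF that]] by (auto simp: GL_iff)
    fix c assume "c \<in> ?C"
    then show "kfun (cell S) coords (\<lambda>Mf. c (?\<chi> Mf))"
    proof
      assume "c \<in> (\<lambda>c. c \<circ> fst) ` GL_coords Q \<alpha>"
      then obtain i r s where c: "c = (\<lambda>g. g i $$ (r, s)) \<circ> fst" "i \<in> verts Q" "r < \<alpha> i" "s < \<alpha> i"
        by (auto simp: GL_coords_def)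
      have "kfun (cell S) coords
          (\<lambda>Mf :: ('v, 'a, 'k alg_closure) framed_rep. minv (row_mat S Mf i) $$ (r, s))"
        by (intro kfun_minv[where n = "\<alpha> i"] kfun_row_mat[OF chart_subset(2) S c(2)] row_mat_carrier d[OF _ c(2)] c(3,4))
      then show ?thesis using c by simp
    next
      assume "c \<in> (\<lambda>c. c \<circ> snd) ` affine_coords chart_dim"
      then obtain k where c: "c = (\<lambda>v. v $ k) \<circ> snd" "k < chart_dim" by (auto simp: affine_coords_def)
      have "kreg (affine_space chart_dim :: (_, 'k) k_space) (carrier_vec chart_dim) (\<lambda>v. v $ k)"
        unfolding affine_space_def kreg_zariski using c(2)
        by (auto simp: affine_coords_def zariski_open_whole intro!: kfun_coord)
      from kmorphism_kreg[OF kmorphism_free_coords_frame_of[OF S] this]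
      have "kfun (kpreimage (zariski (cell S) coords) (free_coords S \<circ> frame_of) (carrier_vec chart_dim))
          coords (\<lambda>Mf :: ('v, 'a, 'k alg_closure) framed_rep. free_coords S (frame_of Mf) $ k)"
        by (simp add: kreg_zariski o_def)
      moreover have "kpreimage (zariski (cell S) coords) (free_coords S \<circ> frame_of) (carrier_vec chart_dim)
          = (cell S :: ('v, 'a, 'k alg_closure) framed_rep set)"
        by (auto simp: kpreimage_def)
      ultimately show ?thesis using c by simp
    qed
  qed
  show ?thesis
    unfolding GL_times_affine_def
  proof (rule kisoI[OF ksheaf_zariski \<phi> \<chi>])
    fix x assume "x \<in> kpts (zariski ?P ?C)"
    then obtain g v where x: "x = (g, v)" and g: "g \<in> GL Q \<alpha>" and v: "v \<in> carrier_vec chart_dim" by auto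
    have "(\<lambda>i\<in>verts Q. minv (row_mat S (GL_act Q g (normal_form S v)) i)) = g"
    proof
      fix i
      show "(\<lambda>i\<in>verts Q. minv (row_mat S (GL_act Q g (normal_form S v)) i)) i = g i"
      proof (cases "i \<in> verts Q")
        case True
        note gi = GL_D[OF g True]
        have "row_mat S (GL_act Q g (normal_form S v)) i = minv (g i)"
          using left_mult_one_mat[OF minv_carrier[OF gi(1)]]
          by (simp add: row_mat_GL_act[OF g normal_form_framed_reps S True] row_mat_normal_form[OF S True])
        then show ?thesis using True by (simp add: minv_minv[OF gi])
      next
        case False
        then show ?thesis using g by (auto simp: GL_iff extensional_def)
      qed
    qed
    then show "?\<chi> (?\<phi> x) = x"
      using free_coords_frame_of_GL_act(2)[OF g S normal_form_in_chart[OF S]] free_coords_frame_of_normal_form[OF S v] by (simp add: x)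
  next
    fix Mf :: "('v, 'a, 'k alg_closure) framed_rep"
    assume "Mf \<in> kpts (zariski (cell S) coords)"
    then have Mf: "Mf \<in> cell S" by simp
    have g: "chart_group S Mf \<in> GL Q \<alpha>" by (rule chart_group_GL[OF S Mf])
    \<comment> \<open>The group component is the inverse of \<open>chart_group\<close>, so applying
      it undoes the normalisation.\<close>
    have "(\<lambda>i\<in>verts Q. minv (row_mat S Mf i)) = (\<lambda>i\<in>verts Q. minv (chart_group S Mf i))"
      by (rule restrict_ext) (simp add: chart_group_def)
    then show "?\<phi> (?\<chi> Mf) = Mf"
      using GL_act_inverse(2)[OF g, of Mf] Mf chart_subset(2) chart_normalize[OF S Mf] by auto
  qed
qed

section \<open>Charts of the Grassmannian\<close>

lemma spans_apply: "i \<in> verts Q \<Longrightarrow> spans b i = {(\<lambda>\<gamma>\<in>Gam_at i. \<Sum>j<\<alpha> i. c j * b i j \<gamma>) | c. True}"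
  by (simp add: spans_def frame_span_def)

lemma spans_subset:
  assumes i: "i \<in> verts Q"
    and b': "\<And>j \<gamma>. j < \<alpha> i \<Longrightarrow> \<gamma> \<in> Gam_at i \<Longrightarrow> b' i j \<gamma> = (\<Sum>l<\<alpha> i. b i l \<gamma> * h $$ (l, j))"
  shows "spans b' i \<subseteq> spans b i"
proof
  fix w assume "w \<in> spans b' i"
  then obtain c where w: "w = (\<lambda>\<gamma>\<in>Gam_at i. \<Sum>j<\<alpha> i. c j * b' i j \<gamma>)" by (auto simp: spans_apply[OF i])
  define c' where "c' l = (\<Sum>j<\<alpha> i. h $$ (l, j) * c j)" for l
  have "(\<Sum>j<\<alpha> i. c j * b' i j \<gamma>) = (\<Sum>l<\<alpha> i. c' l * b i l \<gamma>)" if \<gamma>: "\<gamma> \<in> Gam_at i" for \<gamma>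
  proof -
    have "(\<Sum>j<\<alpha> i. c j * b' i j \<gamma>) = (\<Sum>j<\<alpha> i. \<Sum>l<\<alpha> i. h $$ (l, j) * c j * b i l \<gamma>)"
      using b'[OF _ \<gamma>] by (intro sum.cong refl) (simp add: sum_distrib_left mult_ac)
    also have "\<dots> = (\<Sum>l<\<alpha> i. \<Sum>j<\<alpha> i. h $$ (l, j) * c j * b i l \<gamma>)" by (rule sum.swap)
    finally show ?thesis by (simp add: c'_def sum_distrib_right)
  qed
  then have "w = (\<lambda>\<gamma>\<in>Gam_at i. \<Sum>l<\<alpha> i. c' l * b i l \<gamma>)" unfolding w by (intro restrict_ext) simp
  then show "w \<in> spans b i" unfolding spans_apply[OF i] by blast
qed

lemma spans_eqI:
  assumes "\<And>i. i \<in> verts Q \<Longrightarrow> spans b i = spans b' i"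
  shows "spans b = spans b'"
proof
  fix i show "spans b i = spans b' i" using assms by (cases "i \<in> verts Q") (auto simp: spans_def frame_span_def)
qed

lemma frame_pts_D: "b \<in> frame_pts \<Longrightarrow> i \<in> verts Q \<Longrightarrow> j < \<alpha> i \<Longrightarrow> b i j \<in> extensional (Gam_at i)"
  unfolding frame_pts_def frames_def by (auto dest!: PiE_mem simp: PiE_def)

text \<open>Each vector of \<open>b'\<close> lies in its own span, hence in that of
  \<open>b\<close>, and the coefficients form the columns of \<open>h\<close>. Extensionality of
  frames identifies the vector with the restricted combination found in the span.\<close>

lemma spans_eq_change:
  assumes b': "b' \<in> frame_pts" and eq: "spans b = spans b'" and i: "i \<in> verts Q"
  obtains h where "h \<in> carrier_mat (\<alpha> i) (\<alpha> i)"
    "\<And>j \<gamma>. j < \<alpha> i \<Longrightarrow> \<gamma> \<in> Gam_at i \<Longrightarrow> b' i j \<gamma> = (\<Sum>l<\<alpha> i. b i l \<gamma> * h $$ (l, j))"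
proof -
  have ex: "\<exists>c. \<forall>\<gamma>\<in>Gam_at i. b' i j \<gamma> = (\<Sum>l<\<alpha> i. c l * b i l \<gamma>)" if j: "j < \<alpha> i" for j
  proof -
    have sel: "(\<Sum>l<\<alpha> i. (if l = j then 1 else 0) * b' i l \<gamma>) = b' i j \<gamma>" for \<gamma>
      using j by (simp add: if_distrib[of "\<lambda>x. x * _"] cong: if_cong)
    have "b' i j = (\<lambda>\<gamma>\<in>Gam_at i. \<Sum>l<\<alpha> i. (if l = j then 1 else 0) * b' i l \<gamma>)"
    proof
      fix \<gamma>
      show "b' i j \<gamma> = (\<lambda>\<gamma>\<in>Gam_at i. \<Sum>l<\<alpha> i. (if l = j then 1 else 0) * b' i l \<gamma>) \<gamma>"
        using extensional_arb[OF frame_pts_D[OF b' i j]] sel by simp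
    qed
    then have "b' i j \<in> spans b' i"
      unfolding spans_apply[OF i] by (intro CollectI exI[of _ "\<lambda>l. if l = j then 1 else 0"] conjI TrueI)
    then have "b' i j \<in> spans b i" using eq by simp
    then obtain c where "b' i j = (\<lambda>\<gamma>\<in>Gam_at i. \<Sum>l<\<alpha> i. c l * b i l \<gamma>)" by (auto simp: spans_apply[OF i])
    then show ?thesis by auto
  qed
  then have "\<forall>j. \<exists>c. j < \<alpha> i \<longrightarrow> (\<forall>\<gamma>\<in>Gam_at i. b' i j \<gamma> = (\<Sum>l<\<alpha> i. c l * b i l \<gamma>))" by blast
  from choice[OF this] obtain c
    where c: "\<forall>j. j < \<alpha> i \<longrightarrow> (\<forall>\<gamma>\<in>Gam_at i. b' i j \<gamma> = (\<Sum>l<\<alpha> i. c j l * b i l \<gamma>))" by blast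
  show thesis
  proof (rule that)
    show "mat (\<alpha> i) (\<alpha> i) (\<lambda>(l, j). c j l) \<in> carrier_mat (\<alpha> i) (\<alpha> i)" by simp
    show "b' i j \<gamma> = (\<Sum>l<\<alpha> i. b i l \<gamma> * mat (\<alpha> i) (\<alpha> i) (\<lambda>(l, j). c j l) $$ (l, j))"
      if "j < \<alpha> i" "\<gamma> \<in> Gam_at i" for j \<gamma>
      using c that by (simp add: mult.commute)
  qed
qed

lemma frame_chart_saturated:
  assumes S: "skel S" and b: "b \<in> frame_chart S" and b': "b' \<in> frame_pts" and eq: "spans b = spans b'"
  shows "b' \<in> frame_chart S" and "i \<in> verts Q \<Longrightarrow> \<pi> \<in> Gam_at i \<Longrightarrow> s < \<alpha> i \<Longrightarrow> normed S b' i \<pi> s = normed S b i \<pi> s"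
    and "free_coords S b' = free_coords S b"
proof -
  have d: "det (minor S b' i) \<noteq> 0" if i: "i \<in> verts Q" for i
  proof -
    \<comment> \<open>Here \<open>b\<close> is expressed through \<open>b'\<close>: the determinant
      of its minor is then a multiple of that for \<open>b'\<close>, which is thereby nonzero
      without inverting \<open>h\<close>.\<close>
    obtain h where h: "h \<in> carrier_mat (\<alpha> i) (\<alpha> i)"
      "\<And>j \<gamma>. j < \<alpha> i \<Longrightarrow> \<gamma> \<in> Gam_at i \<Longrightarrow> b i j \<gamma> = (\<Sum>l<\<alpha> i. b' i l \<gamma> * h $$ (l, j))"
      using spans_eq_change[OF subsetD[OF frame_chart_subset b] eq[symmetric] i] by metis
    have "minor S b i = minor S b' i * h" 
      by (rule normed_change(1)[OF S i h(1)]) (rule h(2))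
    then have "det (minor S b i) = det (minor S b' i) * det h" using det_mult[OF minor_carrier h(1)] by simp
    then show ?thesis using b i by (auto simp: frame_chart_def)
  qed
  then show "b' \<in> frame_chart S" using b' by (simp add: frame_chart_def)
  have n: "normed S b' i \<pi> s = normed S b i \<pi> s" if i: "i \<in> verts Q" and \<pi>: "\<pi> \<in> Gam_at i" and s: "s < \<alpha> i" for i \<pi> s
  proof -
    obtain h where h: "h \<in> carrier_mat (\<alpha> i) (\<alpha> i)"
      "\<And>j \<gamma>. j < \<alpha> i \<Longrightarrow> \<gamma> \<in> Gam_at i \<Longrightarrow> b' i j \<gamma> = (\<Sum>l<\<alpha> i. b i l \<gamma> * h $$ (l, j))"
      using spans_eq_change[OF b' eq i] by metis
    show ?thesis 
      by (rule normed_change(2)[OF S i h(1) _ d[OF i] \<pi> s]) (rule h(2))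
  qed
  then show "i \<in> verts Q \<Longrightarrow> \<pi> \<in> Gam_at i \<Longrightarrow> s < \<alpha> i \<Longrightarrow> normed S b' i \<pi> s = normed S b i \<pi> s" .
  show "free_coords S b' = free_coords S b" by (rule free_coords_cong[OF S n])
qed

lemma spans_frame_of_GL_act:
  assumes g: "g \<in> GL Q \<alpha>" and Mf: "Mf \<in> reps"
  shows "spans (frame_of (GL_act Q g Mf)) = spans (frame_of Mf)"
proof -
  have sub: "spans (frame_of (GL_act Q g Mf)) i \<subseteq> spans (frame_of Mf) i"
    if g: "g \<in> GL Q \<alpha>" and Mf: "Mf \<in> reps" and i: "i \<in> verts Q"
    for g i and Mf :: "('v, 'a, 'b) framed_rep"
    by (rule spans_subset[OF i, where h = "minv (g i)"]) (rule frame_of_GL_act[OF g Mf i])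
  show ?thesis
  proof (rule spans_eqI, rule equalityI)
    fix i assume i: "i \<in> verts Q"
    show "spans (frame_of (GL_act Q g Mf)) i \<subseteq> spans (frame_of Mf) i" by (rule sub[OF g Mf i])
    \<comment> \<open>The inclusion just proved, applied to the inverse element and the moved
      pair.\<close>
    show "spans (frame_of Mf) i \<subseteq> spans (frame_of (GL_act Q g Mf)) i"
      using sub[OF GL_act_inverse(1)[OF g Mf] GL_act_framed_reps[OF g Mf] i]
      unfolding GL_act_inverse(2)[OF g Mf] .
  qed
qed

text \<open>The only candidate, up to the action, for a pair whose image is spanned by
  \<open>b\<close>. It is defined on the whole frame chart, whether or not such a pair
  exists.\<close>

definition renorm :: "('v, 'a) ext_path set \<Rightarrow> (('v, 'a, 'f::field) frame_fun) \<Rightarrow> ('v, 'a, 'f) framed_rep" where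
  "renorm S b = normal_form S (free_coords S b)"

text \<open>
  Equations in the chart of \<open>S\<close> of the Grassmannian for the image of the quotient.
\<close>

definition normal_eqs :: "('v, 'a) ext_path set \<Rightarrow> (('v, 'a, 'f::field) frame_fun) \<Rightarrow> bool" where
  "normal_eqs S b \<longleftrightarrow> (\<forall>i\<in>verts Q. \<forall>\<pi>\<in>Gam_at i. \<forall>s<\<alpha> i. path_row (renorm S b) \<pi> s = normed S b i \<pi> s)"

lemma renorm_frame_of:
  assumes S: "skel S" and Mf: "Mf \<in> cell S"
  shows "renorm S (frame_of Mf) = GL_act Q (chart_group S Mf) Mf"
  by (simp add: renorm_def chart_normalize[OF assms])

lemma normal_eqs_frame_of:
  assumes S: "skel S" and Mf: "Mf \<in> cell S"
  shows "normal_eqs S (frame_of Mf)"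
  unfolding normal_eqs_def
proof (intro ballI allI impI)
  fix i \<pi> s assume i: "i \<in> verts Q" and \<pi>: "\<pi> \<in> Gam_at i" and s: "s < \<alpha> i"
  have g: "chart_group S Mf \<in> GL Q \<alpha>" by (rule chart_group_GL[OF assms])
  have M: "Mf \<in> reps" using Mf chart_subset(2) by blast
  show "path_row (renorm S (frame_of Mf)) \<pi> s = normed S (frame_of Mf) i \<pi> s"
    using path_row_GL_act[OF g M GiD[OF \<pi>] s] i \<pi>
    by (simp add: renorm_frame_of[OF assms] normed_def minor_frame_of[OF S i] chart_group_def)
qed

text \<open>The equations say that the frame of the candidate is \<open>b\<close> times its inverse
  minor; multiplication by the minor gives back \<open>b\<close>, so each frame is a combination of
  the other.\<close>

lemma spans_frame_of_renorm:
  assumes S: "skel S" and b: "b \<in> frame_chart S" and eqs: "normal_eqs S b"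
  shows "spans (frame_of (renorm S b)) = spans b"
proof (rule spans_eqI, rule equalityI)
  fix i assume i: "i \<in> verts Q"
  have d: "det (minor S b i) \<noteq> 0" using b i by (simp add: frame_chart_def)
  have e: "frame_of (renorm S b) i s \<pi> = (\<Sum>j<\<alpha> i. b i j \<pi> * minv (minor S b i) $$ (j, s))"
    if "s < \<alpha> i" "\<pi> \<in> Gam_at i" for s \<pi>
    using eqs that i by (simp add: normal_eqs_def normed_def)
  show "spans (frame_of (renorm S b)) i \<subseteq> spans b i" 
    by (rule spans_subset[OF i, where h = "minv (minor S b i)"]) (rule e)
  show "spans b i \<subseteq> spans (frame_of (renorm S b)) i"
  proof (rule spans_subset[OF i, where h = "minor S b i"])
    fix j \<pi> assume j: "j < \<alpha> i" and \<pi>: "\<pi> \<in> Gam_at i"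
    let ?R = "mat 1 (\<alpha> i) (\<lambda>(_, l). b i l \<pi>)" and ?B = "minor S b i"
    have R: "?R \<in> carrier_mat 1 (\<alpha> i)" and iB: "minv ?B \<in> carrier_mat (\<alpha> i) (\<alpha> i)"
      and RB: "?R * minv ?B \<in> carrier_mat 1 (\<alpha> i)" by (auto intro!: mult_carrier_mat)
    have "?R * minv ?B * ?B = ?R"
      using assoc_mult_mat[OF R iB minor_carrier, of S b] right_mult_one_mat[OF R]
      by (simp add: minv_left[OF minor_carrier d])
    then have "b i j \<pi> = (?R * minv ?B * ?B) $$ (0, j)" using j by simp
    also have "\<dots> = (\<Sum>l<\<alpha> i. (?R * minv ?B) $$ (0, l) * ?B $$ (l, j))"
      by (rule mat_index_mult[OF RB minor_carrier _ j]) simp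
    also have "\<dots> = (\<Sum>l<\<alpha> i. frame_of (renorm S b) i l \<pi> * ?B $$ (l, j))"
      using e[OF _ \<pi>] normed_matrix[of _ i S b \<pi>] by (intro sum.cong refl) (simp add: normed_def)
    finally show "b i j \<pi> = (\<Sum>l<\<alpha> i. frame_of (renorm S b) i l \<pi> * ?B $$ (l, j))" .
  qed
qed

section \<open>The product of Grassmannians\<close>

definition Gr :: "('v \<Rightarrow> (('v, 'a) ext_path \<Rightarrow> 'k alg_closure) set, 'k::field) k_space" where
  "Gr = grassmannian (verts Q) \<alpha> Gam_at"

lemma Gr_J_hat_eq: "(Gr_J_hat Q \<alpha> \<zeta> :: (_, 'k::field) k_space) = Gr"
proof -
  have "(\<lambda>i. {\<pi> \<in> Gam_tilde TYPE('k) Q \<alpha> \<zeta>. fst \<pi> = Some i}) = Gam_at"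
    by (rule ext) (simp add: Gam_at_def Gam_tilde_eq)
  then show ?thesis by (simp add: Gr_J_hat_def Gr_def)
qed

lemma openin_Gr: "openin (ktop Gr) U \<longleftrightarrow> U \<subseteq> spans ` frame_pts \<and> zariski_open frame_pts frame_coords {b \<in> frame_pts. spans b \<in> U}"
  unfolding Gr_def openin_grassmannian frame_space_eq
  by (simp add: frame_pts_def[symmetric] spans_def[symmetric] kpreimage_def)

lemma kreg_Gr: "kreg Gr U f \<longleftrightarrow> openin (ktop Gr) U \<and> kreg (zariski frame_pts frame_coords) {b \<in> frame_pts. spans b \<in> U} (f \<circ> spans)"
  unfolding Gr_def openin_grassmannian frame_space_eq
  by (simp add: grassmannian_def Let_def frame_space_eq kpreimage_def frame_pts_def[symmetric] spans_def[symmetric])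

lemma kpts_Gr: "kpts (Gr :: (_, 'k::field) k_space) = spans ` frame_pts"
proof
  show "kpts (Gr :: (_, 'k) k_space) \<subseteq> spans ` frame_pts"
    using openin_topspace[of "ktop (Gr :: (_, 'k) k_space)"] openin_Gr by blast
  have "{b \<in> frame_pts. spans b \<in> spans ` frame_pts} = (frame_pts :: (('v, 'a, 'k alg_closure) frame_fun) set)" by auto
  then have "openin (ktop (Gr :: (_, 'k) k_space)) (spans ` frame_pts)"
    by (simp add: openin_Gr zariski_open_whole)
  then show "spans ` frame_pts \<subseteq> kpts (Gr :: (_, 'k) k_space)" by (rule openin_subset)
qed

lemma kmorphism_spans: "kmorphism (zariski frame_pts frame_coords) Gr spans"
  by (rule kmorphismI) (auto simp: kpts_Gr openin_Gr kreg_Gr kpreimage_def)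

text \<open>To be used with properties \<open>p\<close> that depend on the span only; the frames
  over the set are then those of the chart with property \<open>p\<close>.\<close>

definition Gr_chart :: "('v, 'a) ext_path set \<Rightarrow> ((('v, 'a, 'f::field) frame_fun) \<Rightarrow> bool) \<Rightarrow>
    ('v \<Rightarrow> (('v, 'a) ext_path \<Rightarrow> 'f) set) set" where
  "Gr_chart S p = {spans b | b. b \<in> frame_chart S \<and> p b}"

lemma Gr_chart_preimage:
  assumes S: "skel S"
    and p: "\<And>b b'. b \<in> frame_chart S \<Longrightarrow> b' \<in> frame_chart S \<Longrightarrow> spans b = spans b' \<Longrightarrow> p b \<Longrightarrow> p b'"
  shows "{b \<in> frame_pts. spans b \<in> Gr_chart S p} = {b \<in> frame_chart S. p b}"
proof (intro equalityI subsetI)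
  fix b' assume "b' \<in> {b \<in> frame_pts. spans b \<in> Gr_chart S p}"
  then obtain b where "b' \<in> frame_pts" "b \<in> frame_chart S" "p b" "spans b = spans b'" by (auto simp: Gr_chart_def)
  then show "b' \<in> {b \<in> frame_chart S. p b}" using frame_chart_saturated(1)[OF S, of b b'] p[of b b'] by simp
next
  fix b' assume "b' \<in> {b \<in> frame_chart S. p b}"
  then show "b' \<in> {b \<in> frame_pts. spans b \<in> Gr_chart S p}" using frame_chart_subset by (auto simp: Gr_chart_def)
qed

lemma zariski_open_trans:
  assumes "zariski_open P C U" "zariski_open U C V"
  shows "zariski_open P C V"
  using openin_ksubspace_open[OF zariski_open_subspace(2)[OF assms(1)], of V] assms(2)
  unfolding zariski_open_subspace(1)[OF assms(1)] by simp

lemma openin_Gr_chart: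
  assumes S: "skel S"
    and p: "\<And>b b'. b \<in> frame_chart S \<Longrightarrow> b' \<in> frame_chart S \<Longrightarrow> spans b = spans b' \<Longrightarrow> p b \<Longrightarrow> p b'"
    and op: "zariski_open (frame_chart S) frame_coords {b \<in> frame_chart S. p b}"
  shows "openin (ktop Gr) (Gr_chart S p)"
proof -
  have "Gr_chart S p \<subseteq> spans ` frame_pts" using frame_chart_subset by (auto simp: Gr_chart_def)
  moreover have "{b \<in> frame_pts. spans b \<in> Gr_chart S p} = {b \<in> frame_chart S. p b}" by (rule Gr_chart_preimage[OF S p])
  ultimately show ?thesis
    using zariski_open_trans[OF zariski_open_frame_chart[OF S] op] by (simp only: openin_Gr simp_thms)
qed

lemma kmorphism_renorm:
  assumes S: "skel S"
  shows "kmorphism (zariski (frame_chart S) frame_coords) (zariski stables coords) (renorm S)"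
  using kmorphism_comp[OF kmorphism_free_coords[OF S] kmorphism_normal_form[OF S]] by (simp add: renorm_def[abs_def] o_def)

lemma renorm_cong:
  assumes "skel S" "b \<in> frame_chart S" "b' \<in> frame_pts" "spans b = spans b'"
  shows "renorm S b' = renorm S b"
  using frame_chart_saturated(3)[OF assms] by (simp add: renorm_def)

lemma normal_eqs_cong:
  assumes "skel S" "b \<in> frame_chart S" "b' \<in> frame_pts" "spans b = spans b'"
  shows "normal_eqs S b' \<longleftrightarrow> normal_eqs S b"
  using frame_chart_saturated(2)[OF assms] renorm_cong[OF assms] by (simp add: normal_eqs_def)

text \<open>Each equation is the vanishing of a regular function on the frame chart, so the failure
  locus is a union of open sets.\<close>

lemma zariski_open_not_normal_eqs:
  assumes S: "skel S"
  shows "zariski_open (frame_chart S) frame_coords {b \<in> frame_chart S. \<not> normal_eqs S (b :: ('v, 'a, 'k::field alg_closure) frame_fun)}"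
proof -
  let ?e = "\<lambda>i \<pi> s (b :: ('v, 'a, 'k alg_closure) frame_fun). path_row (renorm S b) \<pi> s - normed S b i \<pi> s"
  have "zariski_open (frame_chart S) frame_coords {b \<in> frame_chart S. ?e i \<pi> s b \<noteq> 0}"
    if i: "i \<in> verts Q" and \<pi>: "\<pi> \<in> Gam_at i" and s: "s < \<alpha> i" for i \<pi> s
  proof (intro zariski_open_kfun_neq_0 kfun_diff kfun_normed[OF S i \<pi> s])
    have "kreg (zariski stables coords) stables
        (\<lambda>Mf :: ('v, 'a, 'k alg_closure) framed_rep. path_row Mf \<pi> s)"
      unfolding kreg_zariski
      using kfun_path_row[OF stable_subset GiD(1)[OF \<pi>], of s] GiD(2)[OF \<pi>] s by (simp add: zariski_open_whole)
    from kmorphism_kreg[OF kmorphism_renorm[OF S] this]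
    have "kfun (kpreimage (zariski (frame_chart S) frame_coords) (renorm S) stables) frame_coords
        (\<lambda>b :: ('v, 'a, 'k alg_closure) frame_fun. path_row (renorm S b) \<pi> s)"
      by (simp add: kreg_zariski o_def)
    moreover have "kpreimage (zariski (frame_chart S) frame_coords) (renorm S) stables =
        (frame_chart S :: (('v, 'a, 'k alg_closure) frame_fun) set)"
      using normal_form_stable[OF S] by (auto simp: kpreimage_def renorm_def)
    ultimately show "kfun (frame_chart S) frame_coords (\<lambda>b :: ('v, 'a, 'k alg_closure) frame_fun. path_row (renorm S b) \<pi> s)"
      by simp
  qed
  then have "openin (ktop (zariski (frame_chart S) frame_coords))
      (\<Union>{{b \<in> frame_chart S. ?e i \<pi> s b \<noteq> 0} | i \<pi> s. i \<in> verts Q \<and> \<pi> \<in> Gam_at i \<and> s < \<alpha> i})"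
    by (intro openin_Union) auto
  moreover have "\<Union>{{b \<in> frame_chart S. ?e i \<pi> s b \<noteq> 0} | i \<pi> s. i \<in> verts Q \<and> \<pi> \<in> Gam_at i \<and> s < \<alpha> i} =
      {b \<in> frame_chart S. \<not> normal_eqs S b}" (is "\<Union>?U = _")
  proof (intro equalityI subsetI)
    fix b :: "('v, 'a, 'k alg_closure) frame_fun"
    assume "b \<in> {b \<in> frame_chart S. \<not> normal_eqs S b}"
    then obtain i \<pi> s where b: "b \<in> frame_chart S" "path_row (renorm S b) \<pi> s \<noteq> normed S b i \<pi> s"
      and *: "i \<in> verts Q" "\<pi> \<in> Gam_at i" "s < \<alpha> i"
      unfolding normal_eqs_def by blast
    from * have "{b \<in> frame_chart S. ?e i \<pi> s b \<noteq> 0} \<in> ?U" by blast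
    moreover have "b \<in> {b \<in> frame_chart S. ?e i \<pi> s b \<noteq> 0}" using b by simp
    ultimately show "b \<in> \<Union>?U" by (rule UnionI)
  next
    fix b :: "('v, 'a, 'k alg_closure) frame_fun"
    assume "b \<in> \<Union>?U"
    then obtain i \<pi> s where b: "b \<in> {b \<in> frame_chart S. ?e i \<pi> s b \<noteq> 0}" and *: "i \<in> verts Q" "\<pi> \<in> Gam_at i" "s < \<alpha> i"
      by blast
    then have "b \<in> frame_chart S" "path_row (renorm S b) \<pi> s \<noteq> normed S b i \<pi> s" by simp_all
    then show "b \<in> {b \<in> frame_chart S. \<not> normal_eqs S b}" using * unfolding normal_eqs_def by blast
  qed
  ultimately show ?thesis by simp
qed

end

section \<open>Charts and embedding of the quotient\<close>

locale framed_quotient = framed_quiver Q \<alpha> \<zeta>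
  for Q :: "('v, 'a) pre_digraph" and \<alpha> \<zeta> :: "'v \<Rightarrow> nat" +
  fixes Y :: "('y, 'k::field) k_space" and q :: "('v, 'a, 'k alg_closure) framed_rep \<Rightarrow> 'y"
  assumes variety: "algebraic_variety Y"
    and quotient: "quotient_like (GL Q \<alpha>) (GL_act Q)
      (zariski stables coords) Y q"
begin

abbreviation E :: "(('v, 'a, 'k alg_closure) framed_rep, 'k) k_space" where
  "E \<equiv> zariski stables coords"

abbreviation chart :: "('v, 'a) ext_path set \<Rightarrow> ('v, 'a, 'k alg_closure) framed_rep set" where
  "chart S \<equiv> cell S"

lemma ksheaf_Y: "ksheaf Y"
  using variety by (simp add: algebraic_variety_def)

lemma q_GL_act: "Mf \<in> stables \<Longrightarrow> g \<in> GL Q \<alpha> \<Longrightarrow> q (GL_act Q g Mf) = q Mf"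
  using quotient_like_act(2)[OF quotient, of Mf g] by simp

lemma q_eq_orbit:
  assumes "Mf \<in> stables" "Mf' \<in> stables" "q Mf' = q Mf"
  obtains g where "g \<in> GL Q \<alpha>" "Mf' = GL_act Q g Mf"
proof -
  have "{y \<in> stables. q y = q Mf} = {GL_act Q g Mf | g. g \<in> GL Q \<alpha>}"
    using quotient_like_fibre[OF quotient, of Mf] assms(1) by simp
  then have "Mf' \<in> {GL_act Q g Mf | g. g \<in> GL Q \<alpha>}" using assms(2,3) by blast
  then show thesis using that by blast
qed

lemma kpts_Y: "kpts Y = q ` stables"
  using quotient_like_surj[OF quotient] by simp

lemma chart_saturated:
  assumes S: "skel S" and Mf: "Mf \<in> chart S" and Mf': "Mf' \<in> stables" and eq: "q Mf' = q Mf"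
  shows "Mf' \<in> chart S" "free_coords S (frame_of Mf') = free_coords S (frame_of Mf)"
proof -
  obtain g where g: "g \<in> GL Q \<alpha>" "Mf' = GL_act Q g Mf"
    using q_eq_orbit[OF subsetD[OF chart_subset(1) Mf] Mf' eq] .
  show "Mf' \<in> chart S" "free_coords S (frame_of Mf') = free_coords S (frame_of Mf)"
    using free_coords_frame_of_GL_act[OF g(1) S Mf] g(2) by simp_all
qed

lemma q_normal_form:
  assumes S: "skel S" and Mf: "Mf \<in> chart S"
  shows "q (normal_form S (free_coords S (frame_of Mf))) = q Mf"
  using q_GL_act[OF subsetD[OF chart_subset(1) Mf] chart_group_GL[OF S Mf]] chart_normalize[OF S Mf]
  by simp

lemma chart_quotient:
  assumes S: "skel S"
  shows "openin (ktop Y) (q ` chart S)"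
    and "quotient_like (GL Q \<alpha>) (GL_act Q) (zariski (chart S) coords) (ksubspace Y (q ` chart S)) q"
proof -
  have sat: "\<And>x y. x \<in> chart S \<Longrightarrow> y \<in> kpts E \<Longrightarrow> q y = q x \<Longrightarrow> y \<in> chart S"
    using chart_saturated(1)[OF S] by simp
  note res = quotient_like_restrict[OF quotient ksheaf_zariski ksheaf_Y
      zariski_open_subspace(2)[OF zariski_open_chart[OF S]] sat]
  show "openin (ktop Y) (q ` chart S)" by (rule res(1))
  show "quotient_like (GL Q \<alpha>) (GL_act Q) (zariski (chart S) coords) (ksubspace Y (q ` chart S)) q"
    using res(2) unfolding zariski_open_subspace(1)[OF zariski_open_chart[OF S]] .
qed

section \<open>Affine coordinates on the quotient\<close>

definition chart_param :: "('v, 'a) ext_path set \<Rightarrow> 'k alg_closure vec \<Rightarrow> 'y" where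
  "chart_param S v = q (normal_form S v)"

text \<open>The choice of representative is harmless, because the free coordinates are constant on
  orbits.\<close>

definition chart_coord :: "('v, 'a) ext_path set \<Rightarrow> 'y \<Rightarrow> 'k alg_closure vec" where
  "chart_coord S y = free_coords S (frame_of (SOME Mf. Mf \<in> chart S \<and> q Mf = y))"

lemma chart_coord_q:
  assumes S: "skel S" and Mf: "Mf \<in> chart S"
  shows "chart_coord S (q Mf) = free_coords S (frame_of Mf)"
proof -
  let ?M = "SOME Mf'. Mf' \<in> chart S \<and> q Mf' = q Mf"
  have M: "?M \<in> chart S \<and> q ?M = q Mf" by (rule someI[of _ Mf]) (simp add: Mf)
  then have "?M \<in> stables" using chart_subset(1)[of S] by blast
  then show ?thesis
    unfolding chart_coord_def by (rule chart_saturated(2)[OF S Mf]) (use M in blast)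
qed

lemma kmorphism_chart_param:
  assumes S: "skel S"
  shows "kmorphism (affine_space chart_dim) (ksubspace Y (q ` chart S)) (chart_param S)"
proof (rule kmorphism_to_ksubspace)
  show "ksheaf (affine_space chart_dim :: (_, 'k) k_space)" by (simp add: affine_space_def ksheaf_zariski)
  show "kmorphism (affine_space chart_dim) Y (chart_param S)"
    using kmorphism_comp[OF kmorphism_normal_form[OF S] quotient_like_kmorphism[OF quotient]]
    by (simp add: chart_param_def[abs_def] o_def)
  show "chart_param S v \<in> q ` chart S" for v
    unfolding chart_param_def by (intro imageI normal_form_in_chart[OF S])
qed

text \<open>Bijectivity of \<open>chart_param\<close> would not show that its inverse is a morphism;
  instead the invariant free coordinates descend by the universal property of the quotient over the
  chart.\<close>

lemma kmorphism_chart_coord: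
  assumes S: "skel S"
  shows "kmorphism (ksubspace Y (q ` chart S)) (affine_space chart_dim) (chart_coord S)"
  by (rule quotient_like_descend[OF chart_quotient(2)[OF S] ksheaf_zariski
        ksheaf_ksubspace[OF ksheaf_Y] kmorphism_free_coords_frame_of[OF S]])
    (simp add: chart_coord_q[OF S])

lemma chart_coord_param:
  assumes S: "skel S" and v: "v \<in> carrier_vec chart_dim"
  shows "chart_coord S (chart_param S v) = v"
  unfolding chart_param_def chart_coord_q[OF S normal_form_in_chart[OF S]] by (rule free_coords_frame_of_normal_form[OF S v])

lemma kpts_chart: "skel S \<Longrightarrow> kpts (ksubspace Y (q ` chart S)) = q ` chart S"
  using openin_subset[OF chart_quotient(1)] by (rule kpts_ksubspace)

lemma chart_param_coord:
  assumes S: "skel S" and y: "y \<in> q ` chart S"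
  shows "chart_param S (chart_coord S y) = y"
proof -
  obtain Mf where "y = q Mf" "Mf \<in> chart S" using y by blast
  then show ?thesis using q_normal_form[OF S] by (simp add: chart_coord_q[OF S] chart_param_def)
qed

lemma kpts_affine_space: "kpts (affine_space n :: (_, 'k) k_space) = carrier_vec n"
  by (simp add: affine_space_def)

lemma kiso_chart_param:
  assumes S: "skel S"
  shows "kiso (affine_space chart_dim) (ksubspace Y (q ` chart S)) (chart_param S)"
  by (rule kisoI[OF ksheaf_ksubspace[OF ksheaf_Y]
        kmorphism_chart_param[OF S] kmorphism_chart_coord[OF S]])
    (simp_all add: kpts_affine_space kpts_chart[OF S] chart_coord_param[OF S] chart_param_coord[OF S])

lemma kaffine_chart:
  assumes S: "skel S"
  shows "kaffine (ksubspace Y (q ` chart S))"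
  by (rule kaffine_affine_space_iso[OF ksheaf_ksubspace[OF ksheaf_Y]
        kmorphism_chart_coord[OF S] kmorphism_chart_param[OF S]])
    (simp_all add: kpts_affine_space kpts_chart[OF S] chart_coord_param[OF S] chart_param_coord[OF S])

lemma geometric_quotient_chart:
  assumes S: "skel S"
  shows "geometric_quotient (GL Q \<alpha>) (GL_act Q) (zariski (chart S) coords)
    (ksubspace Y (q ` chart S)) q"
  unfolding geometric_quotient_alt
  using algebraic_variety_ksubspace_open_affine[OF variety chart_quotient(1)[OF S] kaffine_chart[OF S]]
    chart_quotient(2)[OF S] by blast

section \<open>The embedding into the product of Grassmannians\<close>

definition embed :: "'y \<Rightarrow> 'v \<Rightarrow> (('v, 'a) ext_path \<Rightarrow> 'k alg_closure) set" where
  "embed y = spans (frame_of (SOME Mf. Mf \<in> stables \<and> q Mf = y))"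

lemma embed_q:
  assumes Mf: "Mf \<in> stables"
  shows "embed (q Mf) = spans (frame_of Mf)"
proof -
  let ?M = "SOME Mf'. Mf' \<in> stables \<and> q Mf' = q Mf"
  have M: "?M \<in> stables \<and> q ?M = q Mf" by (rule someI[of _ Mf]) (simp add: Mf)
  then obtain g where "g \<in> GL Q \<alpha>" "?M = GL_act Q g Mf" using q_eq_orbit[OF Mf, of ?M] by blast
  then show ?thesis unfolding embed_def using spans_frame_of_GL_act[of g Mf] Mf stable_subset by auto
qed

lemma kmorphism_embed: "kmorphism Y Gr embed"
  by (rule quotient_like_descend[OF quotient ksheaf_zariski ksheaf_Y kmorphism_comp[OF kmorphism_frame_of kmorphism_spans]])
    (simp add: embed_q)

text \<open>A frame with the span of a stable pair need not be the frame of that pair. Membership in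
  the chart, \<open>renorm\<close> and \<open>normal_eqs\<close> depend on the span alone and can be
  transferred.\<close>

lemma chart_of_frame:
  assumes S: "skel S" and Mf: "Mf \<in> stables" and b: "b \<in> frame_chart S" and eq: "spans b = spans (frame_of Mf)"
  shows "Mf \<in> chart S" "q (renorm S b) = q Mf" "normal_eqs S b"
proof -
  have f: "frame_of Mf \<in> frame_chart S" by (rule frame_chart_saturated(1)[OF S b frame_of_frame_pts[OF Mf] eq])
  then show c: "Mf \<in> chart S" using frame_of_frame_chart[OF S Mf] by simp
  show "q (renorm S b) = q Mf"
    using renorm_cong[OF S b frame_of_frame_pts[OF Mf] eq] q_normal_form[OF S c] by (simp add: renorm_def)
  show "normal_eqs S b" using normal_eqs_cong[OF S b frame_of_frame_pts[OF Mf] eq] normal_eqs_frame_of[OF S c] by simp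
qed

definition embed_inv :: "('v \<Rightarrow> (('v, 'a) ext_path \<Rightarrow> 'k alg_closure) set) \<Rightarrow> 'y" where
  "embed_inv W = q (SOME Mf. Mf \<in> stables \<and> spans (frame_of Mf) = W)"

lemma stable_chart:
  assumes "Mf \<in> stables"
  obtains S where "skel S" "Mf \<in> chart S"
proof -
  have "Mf \<in> (\<Union>S\<in>{S. skel S}. chart S)" using assms stable_pairs_eq_Union by blast
  then show thesis using that by blast
qed

text \<open>Injectivity of the embedding: if two pairs have the same spans, one frame in a chart
  computes the quotient points of both as \<open>q (renorm S b)\<close>.\<close>

lemma embed_inv_fsp:
  assumes Mf: "Mf \<in> stables"
  shows "embed_inv (spans (frame_of Mf)) = q Mf"
proof -
  let ?M = "SOME Mf'. Mf' \<in> stables \<and> spans (frame_of Mf') = spans (frame_of Mf)"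
  have M: "?M \<in> stables \<and> spans (frame_of ?M) = spans (frame_of Mf)" by (rule someI[of _ Mf]) (simp add: Mf)
  obtain S where S: "skel S" "Mf \<in> chart S" using stable_chart[OF Mf] .
  have f: "frame_of Mf \<in> frame_chart S" using frame_of_frame_chart[OF S(1) Mf] S(2) by simp
  have "q (renorm S (frame_of Mf)) = q Mf" by (rule chart_of_frame(2)[OF S(1) Mf f refl])
  moreover have "q (renorm S (frame_of Mf)) = q ?M"
    by (rule chart_of_frame(2)[OF S(1) _ f]) (use M in auto)
  ultimately show ?thesis by (simp add: embed_inv_def)
qed

definition image_Gr :: "('v \<Rightarrow> (('v, 'a) ext_path \<Rightarrow> 'k alg_closure) set) set" where
  "image_Gr = spans ` frame_of ` stables"

lemma image_Gr_subset: "image_Gr \<subseteq> kpts Gr"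
  using frame_of_frame_pts by (auto simp: image_Gr_def kpts_Gr)

lemma image_Gr_E:
  assumes "W \<in> image_Gr"
  obtains Mf S where "Mf \<in> stables" "W = spans (frame_of Mf)" "skel S" "frame_of Mf \<in> frame_chart S"
proof -
  obtain Mf where Mf: "Mf \<in> stables" "W = spans (frame_of Mf)" using assms by (auto simp: image_Gr_def)
  obtain S where S: "skel S" "Mf \<in> chart S" using stable_chart[OF Mf(1)] .
  then have "frame_of Mf \<in> frame_chart S" using frame_of_frame_chart[OF S(1) Mf(1)] by simp
  then show thesis using that Mf S(1) by blast
qed

lemma embed_inv_GD:
  assumes S: "skel S" and W: "W \<in> image_Gr" and b: "b \<in> frame_chart S" "spans b = W"
  shows "embed_inv W = q (renorm S b)"
proof -
  obtain Mf where "Mf \<in> stables" "W = spans (frame_of Mf)" using W by (auto simp: image_Gr_def)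
  then show ?thesis using chart_of_frame(2)[OF S, of Mf b] b embed_inv_fsp[of Mf] by simp
qed

text \<open>The image is closed in each chart, but a closed subset of the whole Grassmannian is
  needed; the complement of the failure loci of all charts together provides it.\<close>

lemma locally_closed_image_Gr: "locally_closed Gr image_Gr"
proof -
  let ?U = "\<Union>{Gr_chart S (\<lambda>_. True) | S. skel S} :: ('v \<Rightarrow> (('v, 'a) ext_path \<Rightarrow> 'k alg_closure) set) set"
  let ?D = "\<Union>{Gr_chart S (\<lambda>b. \<not> normal_eqs S b) | S. skel S} ::
    ('v \<Rightarrow> (('v, 'a) ext_path \<Rightarrow> 'k alg_closure) set) set"
  have opU: "openin (ktop Gr) (Gr_chart S (\<lambda>_ :: ('v, 'a, 'k alg_closure) frame_fun. True))"
    if S: "skel S" for S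
    by (rule openin_Gr_chart[OF S]) (simp_all add: zariski_open_whole)
  have U: "openin (ktop Gr) ?U"
  proof (rule openin_Union)
    fix A :: "('v \<Rightarrow> (('v, 'a) ext_path \<Rightarrow> 'k alg_closure) set) set"
    assume "A \<in> {Gr_chart S (\<lambda>_. True) | S. skel S}"
    then obtain S where "A = Gr_chart S (\<lambda>_. True)" "skel S" by blast
    then show "openin (ktop Gr) A" using opU[of S] by simp
  qed
  have opD: "openin (ktop Gr) (Gr_chart S (\<lambda>b :: ('v, 'a, 'k alg_closure) frame_fun. \<not> normal_eqs S b))"
    if S: "skel S" for S
  proof (rule openin_Gr_chart[OF S])
    fix b b' :: "('v, 'a, 'k alg_closure) frame_fun"
    assume b: "b \<in> frame_chart S" "b' \<in> frame_chart S" "spans b = spans b'" "\<not> normal_eqs S b"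
    have "b' \<in> frame_pts" using b(2) frame_chart_subset by blast
    then show "\<not> normal_eqs S b'" using normal_eqs_cong[OF S b(1) _ b(3)] b(4) by simp
  qed (rule zariski_open_not_normal_eqs[OF S])
  have "openin (ktop Gr) ?D"
  proof (rule openin_Union)
    fix A :: "('v \<Rightarrow> (('v, 'a) ext_path \<Rightarrow> 'k alg_closure) set) set"
    assume "A \<in> {Gr_chart S (\<lambda>b. \<not> normal_eqs S b) | S. skel S}"
    then obtain S where "A = Gr_chart S (\<lambda>b. \<not> normal_eqs S b)" "skel S" by blast
    then show "openin (ktop Gr) A" using opD[of S] by simp
  qed
  then have C: "closedin (ktop Gr) (kpts Gr - ?D)" by (rule closedin_diff[OF closedin_topspace])
  have "image_Gr = ?U \<inter> (kpts Gr - ?D)"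
  proof (intro equalityI subsetI)
    fix W assume W: "W \<in> image_Gr"
    obtain Mf S where Mf: "Mf \<in> stables" "W = spans (frame_of Mf)" and S: "skel S" "frame_of Mf \<in> frame_chart S"
      using image_Gr_E[OF W] .
    have "W \<in> Gr_chart S (\<lambda>_. True)" using Mf(2) S(2) by (auto simp: Gr_chart_def)
    then have "W \<in> ?U" using S(1) by blast
    \<comment> \<open>A point of the image satisfies the equations of every chart that contains it,
      so removing the failure loci of the other charts loses nothing.\<close>
    moreover have "W \<notin> Gr_chart S' (\<lambda>b. \<not> normal_eqs S' b)" if S': "skel S'" for S'
      using chart_of_frame(3)[OF S' Mf(1)] Mf(2) unfolding Gr_chart_def by blast
    ultimately show "W \<in> ?U \<inter> (kpts Gr - ?D)" using W image_Gr_subset by blast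
  next
    fix W assume W: "W \<in> ?U \<inter> (kpts Gr - ?D)"
    then obtain S b where S: "skel S" and b: "b \<in> frame_chart S" "W = spans b" by (auto simp: Gr_chart_def)
    have "normal_eqs S b"
    proof (rule ccontr)
      assume "\<not> normal_eqs S b"
      then have "W \<in> Gr_chart S (\<lambda>b. \<not> normal_eqs S b)" using b unfolding Gr_chart_def by blast
      then show False using W S by blast
    qed
    then have "W = spans (frame_of (renorm S b))" using spans_frame_of_renorm[OF S b(1)] b(2) by simp
    moreover have "renorm S b \<in> stables" unfolding renorm_def by (rule normal_form_stable[OF S])
    ultimately show "W \<in> image_Gr" unfolding image_Gr_def by blast
  qed
  then show ?thesis unfolding locally_closed_def using U C by blast
qed

text \<open>\<open>q \<circ> renorm S\<close> is defined on a whole chart of the Grassmannian and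
  not just on the image. Functions pulled back from \<open>Y\<close> thus extend locally to open
  sets of \<open>Gr\<close>, as the structure on a subspace requires.\<close>

lemma kmorphism_embed_inv: "kmorphism (ksubspace Gr image_Gr) Y embed_inv"
proof -
  have kZ: "kpts (ksubspace Gr image_Gr) = image_Gr" by (rule kpts_ksubspace[OF image_Gr_subset])
  \<comment> \<open>The open part of the chart where renormalisation leads into \<open>V\<close>;
    the traces of these sets on \<open>image_Gr\<close> make up the preimage of
    \<open>V\<close>.\<close>
  define T where "T S V = Gr_chart S (\<lambda>b. q (renorm S b) \<in> V)" for S and V :: "'y set"
  have qrr: "kmorphism (zariski (frame_chart S) frame_coords) Y (q \<circ> renorm S)" if "skel S" for S
    by (rule kmorphism_comp[OF kmorphism_renorm[OF that] quotient_like_kmorphism[OF quotient]])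
  have pT: "q (renorm S b') \<in> V" if "skel S" "b \<in> frame_chart S" "b' \<in> frame_chart S" "spans b = spans b'" "q (renorm S b) \<in> V"
    for S b b' and V
    using renorm_cong[OF that(1,2) subsetD[OF frame_chart_subset that(3)] that(4)] that(5) by simp
  have preF: "kpreimage (zariski (frame_chart S) frame_coords) (q \<circ> renorm S) V = {b \<in> frame_chart S. q (renorm S b) \<in> V}" for S V
    by (auto simp: kpreimage_def)
  have opT: "openin (ktop Gr) (T S V)" if S: "skel S" and V: "openin (ktop Y) V" for S V
    unfolding T_def
  proof (rule openin_Gr_chart[OF S pT[OF S]])
    show "zariski_open (frame_chart S) frame_coords {b \<in> frame_chart S. q (renorm S b) \<in> V}"
      using kmorphism_openin[OF qrr[OF S] V] by (simp add: preF)
  qed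
  have pre: "kpreimage (ksubspace Gr image_Gr) embed_inv V = \<Union>{T S V | S. skel S} \<inter> image_Gr" for V
  proof (intro equalityI subsetI)
    fix W assume "W \<in> kpreimage (ksubspace Gr image_Gr) embed_inv V"
    then have W: "W \<in> image_Gr" "embed_inv W \<in> V" by (auto simp: kpreimage_def kZ)
    obtain Mf S where Mf: "Mf \<in> stables" "W = spans (frame_of Mf)" and S: "skel S" "frame_of Mf \<in> frame_chart S"
      using image_Gr_E[OF W(1)] .
    have "q (renorm S (frame_of Mf)) \<in> V" using embed_inv_GD[OF S(1) W(1) S(2)] Mf(2) W(2) by simp
    then have "W \<in> T S V" unfolding T_def Gr_chart_def using S(2) Mf(2) by blast
    then show "W \<in> \<Union>{T S V | S. skel S} \<inter> image_Gr" using S(1) W(1) by blast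
  next
    fix W assume W: "W \<in> \<Union>{T S V | S. skel S} \<inter> image_Gr"
    then obtain S b where S: "skel S" and b: "b \<in> frame_chart S" "spans b = W" "q (renorm S b) \<in> V"
      by (auto simp: T_def Gr_chart_def)
    then show "W \<in> kpreimage (ksubspace Gr image_Gr) embed_inv V"
      using embed_inv_GD[OF S _ b(1,2)] W by (simp add: kpreimage_def kZ)
  qed
  have op: "openin (ktop (ksubspace Gr image_Gr)) (kpreimage (ksubspace Gr image_Gr) embed_inv V)" if V: "openin (ktop Y) V" for V
  proof -
    have "openin (ktop Gr) (\<Union>{T S V | S. skel S})"
      by (rule openin_Union) (use opT[OF _ V] in blast)
    then show ?thesis unfolding openin_ksubspace pre by blast
  qed
  show ?thesis
  proof (rule kmorphismI)
    show "embed_inv W \<in> kpts Y" if "W \<in> kpts (ksubspace Gr image_Gr)" for W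
      using that[unfolded kZ] by (auto simp: image_Gr_def kpts_Y embed_inv_fsp)
    show "openin (ktop (ksubspace Gr image_Gr)) (kpreimage (ksubspace Gr image_Gr) embed_inv V)" if "openin (ktop Y) V" for V
      by (rule op[OF that])
    fix V f assume f: "kreg Y V f"
    then have V: "openin (ktop Y) V" by (rule ksheaf_openin[OF ksheaf_Y])
    have "\<exists>T' g. W \<in> T' \<and> kreg Gr T' g \<and> (\<forall>W'\<in>kpreimage (ksubspace Gr image_Gr) embed_inv V \<inter> T'. (f \<circ> embed_inv) W' = g W')"
      if W: "W \<in> kpreimage (ksubspace Gr image_Gr) embed_inv V" for W
    proof -
      obtain S where S: "skel S" "W \<in> T S V" using W unfolding pre by blast
      \<comment> \<open>The extension of \<open>f \<circ> embed_inv\<close> from the image to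
        \<open>T S V\<close>. It is independent of the chosen frame, because \<open>renorm\<close>
        depends on the span only.\<close>
      define g where "g W' = f (q (renorm S (SOME b. b \<in> frame_chart S \<and> spans b = W')))" for W'
      have g: "g (spans b) = f (q (renorm S b))" if b: "b \<in> frame_chart S" for b
      proof -
        let ?b = "SOME b'. b' \<in> frame_chart S \<and> spans b' = spans b"
        have b': "?b \<in> frame_chart S \<and> spans ?b = spans b" by (rule someI[of _ b]) (simp add: b)
        then have "renorm S b = renorm S ?b"
          using renorm_cong[OF S(1), of ?b b] frame_chart_subset b by blast
        then show ?thesis by (simp add: g_def)
      qed
      have preT: "{b \<in> frame_pts. spans b \<in> T S V} = {b \<in> frame_chart S. q (renorm S b) \<in> V}"
        unfolding T_def by (rule Gr_chart_preimage[OF S(1) pT[OF S(1)]])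
      have "kreg (zariski (frame_chart S) frame_coords) {b \<in> frame_chart S. q (renorm S b) \<in> V} (f \<circ> (q \<circ> renorm S))"
        using kmorphism_kreg[OF qrr[OF S(1)] f] unfolding preF .
      then have "kreg (ksubspace (zariski frame_pts frame_coords) (frame_chart S)) {b \<in> frame_chart S. q (renorm S b) \<in> V} (f \<circ> (q \<circ> renorm S))"
        unfolding zariski_open_subspace(1)[OF zariski_open_frame_chart[OF S(1)]] .
      then have "kreg (zariski frame_pts frame_coords) {b \<in> frame_chart S. q (renorm S b) \<in> V} (f \<circ> (q \<circ> renorm S))"
        using kreg_ksubspace_open[OF ksheaf_zariski zariski_open_subspace(2)[OF zariski_open_frame_chart[OF S(1)]]]
        by blast
      then have "kreg (zariski frame_pts frame_coords) {b \<in> frame_chart S. q (renorm S b) \<in> V} (g \<circ> spans)"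
        by (rule ksheaf_cong[OF ksheaf_zariski]) (simp add: g)
      then have "kreg Gr (T S V) g" unfolding kreg_Gr preT using opT[OF S(1) V] by blast
      moreover have "(f \<circ> embed_inv) W' = g W'" if W': "W' \<in> kpreimage (ksubspace Gr image_Gr) embed_inv V \<inter> T S V" for W'
      proof -
        have "W' \<in> image_Gr" using W' by (auto simp: kpreimage_def kZ)
        moreover obtain b where b: "b \<in> frame_chart S" "spans b = W'" using W' by (auto simp: T_def Gr_chart_def)
        ultimately show ?thesis using embed_inv_GD[OF S(1) _ b] g[OF b(1)] by (simp add: b(2))
      qed
      ultimately show ?thesis using S(2) by blast
    qed
    then show "kreg (ksubspace Gr image_Gr) (kpreimage (ksubspace Gr image_Gr) embed_inv V) (f \<circ> embed_inv)"
      using op[OF V] by (simp add: ksubspace_def)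
  qed
qed

lemma ksheaf_Gr: "ksheaf (Gr :: (_, 'k) k_space)"
  unfolding ksheaf_def
proof (intro conjI allI impI)
  show "openin (ktop (Gr :: (_, 'k) k_space)) U" if "kreg Gr U f" for U f
    using that by (simp add: kreg_Gr)
  show "kreg (Gr :: (_, 'k) k_space) U g" if f: "kreg Gr U f" and eq: "\<forall>x\<in>U. f x = g x" for U f g
  proof -
    have "kreg (zariski frame_pts frame_coords) {b \<in> frame_pts. spans b \<in> U} (f \<circ> spans)" using f by (simp add: kreg_Gr)
    then have "kreg (zariski frame_pts frame_coords) {b \<in> frame_pts. spans b \<in> U} (g \<circ> spans)"
      by (rule ksheaf_cong[OF ksheaf_zariski]) (simp add: eq)
    then show ?thesis using f by (simp add: kreg_Gr)
  qed
  show "kreg (Gr :: (_, 'k) k_space) V f" if f: "kreg Gr U f" and V: "openin (ktop Gr) V" "V \<subseteq> U" for U V f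
  proof -
    have "kreg (zariski frame_pts frame_coords) {b \<in> frame_pts. spans b \<in> U} (f \<circ> spans)" using f by (simp add: kreg_Gr)
    then have "kreg (zariski frame_pts frame_coords) {b \<in> frame_pts. spans b \<in> V} (f \<circ> spans)"
      by (rule ksheaf_restrict[OF ksheaf_zariski]) (use V in \<open>auto simp: openin_Gr\<close>)
    then show ?thesis using V(1) by (simp add: kreg_Gr)
  qed
  fix \<U> and f :: "('v \<Rightarrow> (('v, 'a) ext_path \<Rightarrow> 'k alg_closure) set) \<Rightarrow> 'k alg_closure"
  assume \<U>: "\<forall>U\<in>\<U>. kreg Gr U f"
  have "kreg (zariski frame_pts frame_coords) (\<Union>((\<lambda>U. {b \<in> frame_pts. spans b \<in> U}) ` \<U>)) (f \<circ> spans)"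
    by (rule ksheaf_glue[OF ksheaf_zariski]) (use \<U> in \<open>auto simp: kreg_Gr\<close>)
  moreover have "\<Union>((\<lambda>U. {b \<in> frame_pts. spans b \<in> U}) ` \<U>) = {b \<in> frame_pts. spans b \<in> \<Union>\<U>}" by blast
  moreover have "openin (ktop (Gr :: (_, 'k) k_space)) (\<Union>\<U>)"
    by (rule openin_Union) (use \<U> in \<open>simp add: kreg_Gr\<close>)
  ultimately show "kreg Gr (\<Union>\<U>) f" unfolding kreg_Gr by simp
qed

lemma kiso_embed: "kiso Y (ksubspace Gr image_Gr) embed"
proof (rule kisoI[OF ksheaf_ksubspace[OF ksheaf_Gr] kmorphism_to_ksubspace[OF ksheaf_Y kmorphism_embed] kmorphism_embed_inv])
  show "embed y \<in> image_Gr" if "y \<in> kpts Y" for y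
    using that embed_q by (auto simp: kpts_Y image_Gr_def)
  show "embed_inv (embed y) = y" if "y \<in> kpts Y" for y
    using that embed_q embed_inv_fsp by (auto simp: kpts_Y)
  show "embed (embed_inv W) = W" if "W \<in> kpts (ksubspace Gr image_Gr)" for W
    using that[unfolded kpts_ksubspace[OF image_Gr_subset]] by (auto simp: image_Gr_def embed_q embed_inv_fsp)
qed

end

section \<open>The covering by affine spaces and the embedding\<close>

theorem theorem3p3:
  fixes Q :: "('v, 'a) pre_digraph"
    and \<alpha> \<zeta> :: "'v \<Rightarrow> nat"
    and Y :: "('y, 'k::field) k_space"
    and q :: "('v, 'a, 'k alg_closure) framed_rep \<Rightarrow> 'y"
  assumes "fin_digraph Q"
    and "geometric_quotient (GL Q \<alpha>) (GL_act Q) (stable_space Q \<alpha> \<zeta>) Y q"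
  shows
    "(stable_pairs Q \<alpha> \<zeta> :: ('v, 'a, 'k) framed_rep set) =
       (\<Union>S\<in>J_skeleta TYPE('k) Q \<alpha> \<zeta>. stable_with_skeleton Q \<alpha> \<zeta> S) \<and>
     kpts (stable_space Q \<alpha> \<zeta> :: (_, 'k) k_space) =
       (\<Union>S\<in>J_skeleta TYPE('k) Q \<alpha> \<zeta>. stable_with_skeleton Q \<alpha> \<zeta> S) \<and>
     (\<forall>S\<in>J_skeleta TYPE('k) Q \<alpha> \<zeta>.
       openin (ktop (stable_space Q \<alpha> \<zeta> :: (_, 'k) k_space)) (stable_with_skeleton Q \<alpha> \<zeta> S)) \<and>
     (\<exists>N. \<forall>S\<in>J_skeleta TYPE('k) Q \<alpha> \<zeta>. \<exists>\<phi> \<psi>.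
       kiso (GL_times_affine Q \<alpha> N)
         (ksubspace (stable_space Q \<alpha> \<zeta>) (stable_with_skeleton Q \<alpha> \<zeta> S)) \<phi> \<and>
       kiso (affine_space N) (ksubspace Y (q ` stable_with_skeleton Q \<alpha> \<zeta> S)) \<psi> \<and>
       (\<forall>g\<in>GL Q \<alpha>. \<forall>v\<in>carrier_vec N. q (\<phi> (g, v)) = \<psi> v)) \<and>
     kpts Y = (\<Union>S\<in>J_skeleta TYPE('k) Q \<alpha> \<zeta>. q ` stable_with_skeleton Q \<alpha> \<zeta> S) \<and>
     (\<forall>S\<in>J_skeleta TYPE('k) Q \<alpha> \<zeta>.
       openin (ktop Y) (q ` stable_with_skeleton Q \<alpha> \<zeta> S) \<and>
       geometric_quotient (GL Q \<alpha>) (GL_act Q)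
         (ksubspace (stable_space Q \<alpha> \<zeta>) (stable_with_skeleton Q \<alpha> \<zeta> S))
         (ksubspace Y (q ` stable_with_skeleton Q \<alpha> \<zeta> S)) q) \<and>
     (\<exists>Z \<iota>. locally_closed (Gr_J_hat Q \<alpha> \<zeta> :: (_, 'k) k_space) Z \<and>
       kiso Y (ksubspace (Gr_J_hat Q \<alpha> \<zeta>) Z) \<iota>)"
proof -
  interpret framed_quiver Q \<alpha> \<zeta> by (rule framed_quiver.intro) (rule assms(1))
  have gq: "algebraic_variety Y"
    "quotient_like (GL Q \<alpha>) (GL_act Q) (zariski (stable_pairs Q \<alpha> \<zeta>) (Rep_coords Q \<alpha> \<zeta>)) Y q"
    using assms(2) by (simp_all add: geometric_quotient_alt stable_space_eq)
  interpret framed_quotient Q \<alpha> \<zeta> Y q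
    by (intro framed_quotient.intro framed_quotient_axioms.intro framed_quiver_axioms gq)
  \<comment> \<open>On an open chart the induced structure is again a Zariski space, the form in
    which the charts have been treated.\<close>
  have sub: "ksubspace E (chart S) = zariski (chart S) (Rep_coords Q \<alpha> \<zeta>)" if "skel S" for S
    by (rule zariski_open_subspace(1)[OF zariski_open_chart[OF that]])
  show ?thesis
    unfolding J_skeleta_eq stable_space_eq Gr_J_hat_eq kpts_zariski openin_zariski
  proof (intro conjI)
    show "\<forall>S\<in>{S. skel S}. zariski_open (stable_pairs Q \<alpha> \<zeta>) (Rep_coords Q \<alpha> \<zeta>) (chart S)"
      using zariski_open_chart by blast
    show "\<exists>N. \<forall>S\<in>{S. skel S}. \<exists>\<phi> \<psi>.
        kiso (GL_times_affine Q \<alpha> N) (ksubspace E (chart S)) \<phi> \<and>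
        kiso (affine_space N) (ksubspace Y (q ` chart S)) \<psi> \<and>
        (\<forall>g\<in>GL Q \<alpha>. \<forall>v\<in>carrier_vec N. q (\<phi> (g, v)) = \<psi> v)"
    \<comment> \<open>The dimension is independent of the skeleton and can be named before
      it.\<close>
    proof (intro exI[of _ chart_dim] ballI)
      fix S assume "S \<in> {S. skel S}"
      then have S: "skel S" by simp
      show "\<exists>\<phi> \<psi>. kiso (GL_times_affine Q \<alpha> chart_dim) (ksubspace E (chart S)) \<phi> \<and>
          kiso (affine_space chart_dim) (ksubspace Y (q ` chart S)) \<psi> \<and>
          (\<forall>g\<in>GL Q \<alpha>. \<forall>v\<in>carrier_vec chart_dim. q (\<phi> (g, v)) = \<psi> v)"
        unfolding sub[OF S]
        by (intro exI[of _ "\<lambda>(g, v). GL_act Q g (normal_form S v)"] exI[of _ "chart_param S"] conjI kiso_chart[OF S]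
            kiso_chart_param[OF S])
          (simp add: chart_param_def q_GL_act[OF normal_form_stable[OF S]])
    qed
    show "kpts Y = (\<Union>S\<in>{S. skel S}. q ` chart S)"
      unfolding kpts_Y stable_pairs_eq_Union image_UN ..
    show "\<forall>S\<in>{S. skel S}. openin (ktop Y) (q ` chart S) \<and>
        geometric_quotient (GL Q \<alpha>) (GL_act Q) (ksubspace E (chart S)) (ksubspace Y (q ` chart S)) q"
      using chart_quotient(1) geometric_quotient_chart by (simp add: sub)
    show "\<exists>Z \<iota>. locally_closed (Gr :: (_, 'k) k_space) Z \<and> kiso Y (ksubspace Gr Z) \<iota>"
      using locally_closed_image_Gr kiso_embed by blast
  \<comment> \<open>The two remaining unions are the same statement over the ground field and over
    its algebraic closure.\<close>
  qed (rule stable_pairs_eq_Union)+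
qed

end
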